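(* Let $q\in\mathbb{C}\setminus\{0\}$ not be a root of unity ($q\notin e^{2i\pi\mathbb{Q}}$). Let $(\boldsymbol\Theta,\overline{\boldsymbol\Theta})\in(\mathbb{C}^* )^4\times(\mathbb{C}^* )^4$, $\boldsymbol\Theta=(\Theta_0,\Theta_1,\Theta_t,\Theta_\infty)$, $\overline{\boldsymbol\Theta}=(\overline\Theta_0,\overline\Theta_1,\overline\Theta_t,\overline\Theta_\infty)$, be such that $\Theta_\infty\neq\overline\Theta_\infty$, $\Theta_0\overline\Theta_0=\Theta_\infty\overline\Theta_\infty\Theta_t\overline\Theta_t\Theta_1\overline\Theta_1$, and $\Theta_i/\overline\Theta_i\notin q^{\mathbb{Z}^*}$ for all $i\in\{0,1,t,\infty\}$. Let $\mathfrak{D}\subset\mathbb{C}^*$ be open, connected and stable under multiplication by $q$ and $1/q$. Let $(\lambda,y,Z)\in\mathcal{M}(\mathfrak{D})^3$. Denote $$X:=\frac{(y-1)(y-t)(1+(q-1)yZ)}{\Theta_\infty\overline\Theta_\infty(y-\Theta_1)(y-\overline\Theta_1)}\in\mathcal{M}(\mathfrak{D})$$ and assume that $y$, $y-1$, $y-t$, $\lambda$, $X$, $\Theta_\infty X-1$, $q\overline\Theta_\infty X-1$, $\Theta_\infty X-\frac{(y-t\Theta_t)(y-t\overline\Theta_t)}{(y-\Theta_1)(y-\overline\Theta_1)}$ are all well-defined meromorphic functions on $\mathfrak{D}$ and are each not identically zero. Let $\mathfrak{A}(x,t)=\mathfrak{A}_0(t)+\frac{x}{x-1}\mathfrak{A}_1(t)+\frac{x}{t(x-t)}\mathfrak{A}_t(t)$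 be defined by $(\lambda,y,Z)$ via the formulas in the context, and assume that the coefficients of $\mathfrak{A}_0,\mathfrak{A}_1,\mathfrak{A}_t$ are holomorphic on a domain $\mathfrak{D}^*\subset\mathfrak{D}$ stable under multiplication by $q$ and $1/q$. Denote $\mathfrak{A}_\infty=\mathfrak{A}_0+\mathfrak{A}_1+\frac1t\mathfrak{A}_t=\mathrm{diag}(\overline\Theta_\infty,\Theta_\infty)$. The following are equivalent. (1) The family of $q$-Fuchsian systems $\sigma_{q,x}Y=\mathfrak{A}Y$, parametrized by $\mathfrak{D}^*$, is $q$-isomonodromic. (2) Denoting $$B_0:=-qt\left(\mathfrak{A}_\infty+\frac{t-1}{(t\Theta_t-1)(t\overline\Theta_t-1)}\mathfrak{A}_1\right)\left(\frac{1}{\Theta_t\overline\Theta_t}\mathfrak{A}_0+\frac{t(t-1)}{(t\Theta_t-1)(t\overline\Theta_t-1)}\mathfrak{A}_1\right)^{-1},$$ $$\mathfrak{C}:=\mathrm{diag}(c,1),\quad c=\frac{\sigma_{q,t}\lambda}{\lambda}\cdot\frac{\Theta_\infty X-1}{q\overline\Theta_\infty X-1},$$ the following equations hold: $$\sigma_{q,t}\mathfrak{A}_0=\mathfrak{C}B_0\mathfrak{A}_0B_0^{-1}\mathfrak{C}^{-1},$$ $$\sigma_{q,t}\mathfrak{A}_1=\frac{t-1}{qt-1}\cdot\frac{(qt\Theta_t-1)(qt\overline\Theta_t-1)}{q(t\Theta_t-1)(t\overline\Theta_t-1)}\,\mathfrak{C}(qI_2+B_0)\mathfrak{A}_1(I_2+B_0)^{-1}\mathfrak{C}^{-1},$$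 $$\sigma_{q,t}\mathfrak{A}_t=-\mathfrak{C}B_0\mathfrak{A}_0\left(\frac{1}{\Theta_t\overline\Theta_t}I_2+qtB_0^{-1}\right)\mathfrak{C}^{-1}-\frac{t(t-1)\,\mathfrak{C}(qI_2+B_0)\mathfrak{A}_1}{(t\Theta_t-1)(t\overline\Theta_t-1)}\left(I_2+\frac{(qt\Theta_t-1)(qt\overline\Theta_t-1)}{qt-1}(I_2+B_0)^{-1}\right)\mathfrak{C}^{-1}.$$ (3) The pair $(y,Z)$ is a solution of the following system of $q$-difference equations: $$\sigma_{q,t}y=\frac{\Theta_1\overline\Theta_1}{y}\cdot\frac{\left(X-t\frac{\Theta_t\overline\Theta_t}{\Theta_0}\right)\left(X-t\frac{\Theta_t\overline\Theta_t}{\overline\Theta_0}\right)}{\left(X-\frac1{\Theta_\infty}\right)\left(X-\frac{1}{q\overline\Theta_\infty}\right)},$$ $$\sigma_{q,t}Z=\frac{1}{(q-1)\sigma_{q,t}y}\left(\frac{(\sigma_{q,t}y-qt\Theta_t)(\sigma_{q,t}y-qt\overline\Theta_t)}{q(\sigma_{q,t}y-1)(\sigma_{q,t}y-qt)X}-1\right).$$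
   Context: Notation: $\mathcal{M}(U)$ is the field of meromorphic functions on $U$; $I_2$ is the $2\times2$ identity; $\sigma_{q,x}f(x)=f(qx)$, $\sigma_{q,t}f(t)=f(qt)$ (acting entrywise on matrices); $\mathbb{Z}^*=\mathbb{Z}\setminus\{0\}$. Formulas for $\mathfrak{A}$. Put $\mathfrak{p}(x)=\mathfrak{p}(x,t)=(x-t\Theta_t)(x-t\overline\Theta_t)(x-\Theta_1)(x-\overline\Theta_1)$. Then $$\mathfrak{A}(x,t)=\frac{1}{(x-1)(x-t)}\begin{pmatrix}\overline\Theta_\infty((x-y)(x-\alpha)+z_1)&(q-1)\lambda(x-y)\\ \Theta_\infty\overline\Theta_\infty\frac{\gamma x+\delta}{(q-1)\lambda}&\Theta_\infty((x-y)(x-\beta)+z_2)\end{pmatrix}$$ with $$z_1=\frac{(y-1)(y-t)(1+(q-1)yZ)}{\overline\Theta_\infty},\qquad z_2=\frac{\mathfrak{p}(y)}{z_1},$$ $$\beta=-(\alpha-1)-(y-t)+\frac{\mathfrak{p}(0)-\mathfrak{p}(y)}{ty}+\frac{\mathfrak{p}(t)-\mathfrak{p}(y)}{t(t-1)(y-t)}-\frac{\mathfrak{p}(1)-\mathfrak{p}(y)}{(t-1)(y-1)},$$ $$\gamma=z_1+z_2+\alpha\beta+(\alpha-1+\beta)(y-1)-\frac{\mathfrak{p}(0)-\mathfrak{p}(y)}{y}+\frac{\mathfrak{p}(1)-\mathfrak{p}(y)}{y-1},$$ $$\delta=\frac{\mathfrak{p}(0)-(\alpha y+z_1)(\beta y+z_2)}{y},$$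 $$\alpha=-\frac{t(\Theta_0+\overline\Theta_0)-(\overline\Theta_\infty z_1+\Theta_\infty z_2)}{(\Theta_\infty-\overline\Theta_\infty)y}+\frac{\Theta_\infty}{\Theta_\infty-\overline\Theta_\infty}\left(1+t-y+\frac{\mathfrak{p}(0)-\mathfrak{p}(y)}{ty}+\frac{\mathfrak{p}(t)-\mathfrak{p}(y)}{t(t-1)(y-t)}-\frac{\mathfrak{p}(1)-\mathfrak{p}(y)}{(t-1)(y-1)}\right).$$ (The resulting $\sigma_{q,x}Y=\mathfrak{A}Y$ is a family of $q$-Fuchsian systems over $\mathfrak{D}^*$: $\mathrm{Spec}(\mathfrak{A}_0(t))=\{\Theta_0,\overline\Theta_0\}$, $\det\mathfrak{A}=\frac{\Theta_\infty\overline\Theta_\infty\mathfrak{p}(x,t)}{(x-1)^2(x-t)^2}$, $\mathfrak{A}_\infty=\mathrm{diag}(\overline\Theta_\infty,\Theta_\infty)$.) $q$-isomonodromic: the family $\sigma_{q,x}Y=\mathfrak{A}(x,t)Y$ parametrized by $\mathfrak{D}^*$ is $q$-isomonodromic if there exists $\mathfrak{B}\in\mathrm{GL}_2(\mathcal{M}(\mathfrak{D}^* )(x))$ (entries rational in $x$ with coefficients meromorphic in $t$) such that $\mathfrak{A}(x,qt)\mathfrak{B}(x,t)=\mathfrak{B}(qx,t)\mathfrak{A}(x,t)$. *)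

theory Defs
  imports "HOL-Complex_Analysis.Complex_Analysis"
begin

text \<open>
  An element of the field of meromorphic functions on an open connected set \<open>U\<close> is represented by
  a function that is \<^const>\<open>meromorphic_on\<close> \<open>U\<close>. Such a function may take arbitrary values at its
  poles and on a discrete subset of \<open>U\<close>, so two representatives define the same element iff they
  agree off a subset of \<open>U\<close> that has no limit point in \<open>U\<close>.
  The same relation is used entrywise, for matrices of meromorphic functions.
\<close>

definition mero_eq :: "complex set \<Rightarrow> (complex \<Rightarrow> 'a) \<Rightarrow> (complex \<Rightarrow> 'a) \<Rightarrow> bool" where
  "mero_eq U f g \<longleftrightarrow> (\<forall>\<^sub>\<approx>t\<in>U. f t = g t)"

text \<open>
  Elements of \<open>\<M>(U)(x)\<close> are represented by functions of \<open>(x, t)\<close>. Two of them are identified iff,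
  for all \<open>t\<close> off a discrete subset of \<open>U\<close>, they agree for all but finitely many \<open>x\<close>.
\<close>

definition ratfun_eq ::
  "complex set \<Rightarrow> (complex \<Rightarrow> complex \<Rightarrow> 'a) \<Rightarrow> (complex \<Rightarrow> complex \<Rightarrow> 'a) \<Rightarrow> bool" where
  "ratfun_eq U f g \<longleftrightarrow> (\<forall>\<^sub>\<approx>t\<in>U. MOST x. f x t = g x t)"

definition mero_ratfun :: "complex set \<Rightarrow> (complex \<Rightarrow> complex \<Rightarrow> complex) \<Rightarrow> bool" where
  "mero_ratfun U f \<longleftrightarrow>
     (\<exists>n (a :: nat \<Rightarrow> complex \<Rightarrow> complex) (b :: nat \<Rightarrow> complex \<Rightarrow> complex).
        (\<forall>k\<le>n. a k meromorphic_on U \<and> b k meromorphic_on U) \<and>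
        (\<exists>k\<le>n. \<not> mero_eq U (b k) (\<lambda>_. 0)) \<and>
        ratfun_eq U f (\<lambda>x t. (\<Sum>k\<le>n. a k t * x ^ k) / (\<Sum>k\<le>n. b k t * x ^ k)))"

definition GL2_mero_ratfun :: "complex set \<Rightarrow> (complex \<Rightarrow> complex \<Rightarrow> complex^2^2) \<Rightarrow> bool" where
  "GL2_mero_ratfun U B \<longleftrightarrow>
     (\<forall>i j. mero_ratfun U (\<lambda>x t. B x t $ i $ j)) \<and>
     \<not> ratfun_eq U (\<lambda>x t. det (B x t)) (\<lambda>_ _. 0)"

definition q_isomonodromic ::
  "complex \<Rightarrow> complex set \<Rightarrow> (complex \<Rightarrow> complex \<Rightarrow> complex^2^2) \<Rightarrow> bool" where
  "q_isomonodromic q U A \<longleftrightarrow>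
     (\<exists>B. GL2_mero_ratfun U B \<and>
          ratfun_eq U (\<lambda>x t. A x (q * t) ** B x t) (\<lambda>x t. B (q * x) t ** A x t))"

definition sigma_qt :: "complex \<Rightarrow> (complex \<Rightarrow> 'a) \<Rightarrow> complex \<Rightarrow> 'a" where
  "sigma_qt q f = (\<lambda>t. f (q * t))"

definition q_stable :: "complex \<Rightarrow> complex set \<Rightarrow> bool" where
  "q_stable q U \<longleftrightarrow> (\<forall>t\<in>U. q * t \<in> U \<and> t / q \<in> U)"

definition mat2 :: "complex \<Rightarrow> complex \<Rightarrow> complex \<Rightarrow> complex \<Rightarrow> complex^2^2" where
  "mat2 a b c d = vector [vector [a, b], vector [c, d]]"

definition mat_smult :: "complex \<Rightarrow> complex^2^2 \<Rightarrow> complex^2^2" (infixr \<open>\<odot>\<close> 75) where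
  "c \<odot> A = (\<chi> i j. c * A $ i $ j)"

text \<open>
  The labels of the spectral data; \<open>\<Theta> It\<close> is the number \<open>\<Theta>\<^sub>t\<close>, which does not depend on the
  variable \<open>t\<close>. Below, \<open>\<Theta>'\<close> stands for the second family (written with a bar in the literature).
\<close>

datatype idx = I0 | I1 | It | Iinf

definition frakp :: "(idx \<Rightarrow> complex) \<Rightarrow> (idx \<Rightarrow> complex) \<Rightarrow> complex \<Rightarrow> complex \<Rightarrow> complex" where
  "frakp \<Theta> \<Theta>' t x = (x - t * \<Theta> It) * (x - t * \<Theta>' It) * (x - \<Theta> I1) * (x - \<Theta>' I1)"

text \<open>
  In the following formulas \<open>t\<close>, \<open>y\<close>, \<open>Z\<close> and \<open>l\<close> are numbers: the point \<open>t\<close> and the values of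
  the functions \<open>y\<close>, \<open>Z\<close>, \<open>\<lambda>\<close> at that point.
\<close>

definition z1 ::
  "complex \<Rightarrow> (idx \<Rightarrow> complex) \<Rightarrow> (idx \<Rightarrow> complex) \<Rightarrow> complex \<Rightarrow> complex \<Rightarrow> complex \<Rightarrow> complex" where
  "z1 q \<Theta> \<Theta>' t y Z = (y - 1) * (y - t) * (1 + (q - 1) * y * Z) / \<Theta>' Iinf"

definition z2 ::
  "complex \<Rightarrow> (idx \<Rightarrow> complex) \<Rightarrow> (idx \<Rightarrow> complex) \<Rightarrow> complex \<Rightarrow> complex \<Rightarrow> complex \<Rightarrow> complex" where
  "z2 q \<Theta> \<Theta>' t y Z = frakp \<Theta> \<Theta>' t y / z1 q \<Theta> \<Theta>' t y Z"

definition alpha ::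
  "complex \<Rightarrow> (idx \<Rightarrow> complex) \<Rightarrow> (idx \<Rightarrow> complex) \<Rightarrow> complex \<Rightarrow> complex \<Rightarrow> complex \<Rightarrow> complex" where
  "alpha q \<Theta> \<Theta>' t y Z =
     (let p = frakp \<Theta> \<Theta>' t in
      - (t * (\<Theta> I0 + \<Theta>' I0) - (\<Theta>' Iinf * z1 q \<Theta> \<Theta>' t y Z + \<Theta> Iinf * z2 q \<Theta> \<Theta>' t y Z))
          / ((\<Theta> Iinf - \<Theta>' Iinf) * y)
      + \<Theta> Iinf / (\<Theta> Iinf - \<Theta>' Iinf)
          * (1 + t - y + (p 0 - p y) / (t * y) + (p t - p y) / (t * (t - 1) * (y - t))
             - (p 1 - p y) / ((t - 1) * (y - 1))))"

definition beta ::
  "complex \<Rightarrow> (idx \<Rightarrow> complex) \<Rightarrow> (idx \<Rightarrow> complex) \<Rightarrow> complex \<Rightarrow> complex \<Rightarrow> complex \<Rightarrow> complex" where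
  "beta q \<Theta> \<Theta>' t y Z =
     (let p = frakp \<Theta> \<Theta>' t in
      - (alpha q \<Theta> \<Theta>' t y Z - 1) - (y - t)
      + (p 0 - p y) / (t * y) + (p t - p y) / (t * (t - 1) * (y - t))
      - (p 1 - p y) / ((t - 1) * (y - 1)))"

definition gamma ::
  "complex \<Rightarrow> (idx \<Rightarrow> complex) \<Rightarrow> (idx \<Rightarrow> complex) \<Rightarrow> complex \<Rightarrow> complex \<Rightarrow> complex \<Rightarrow> complex" where
  "gamma q \<Theta> \<Theta>' t y Z =
     (let p = frakp \<Theta> \<Theta>' t; a = alpha q \<Theta> \<Theta>' t y Z; b = beta q \<Theta> \<Theta>' t y Z in
      z1 q \<Theta> \<Theta>' t y Z + z2 q \<Theta> \<Theta>' t y Z + a * b + (a - 1 + b) * (y - 1)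
      - (p 0 - p y) / y + (p 1 - p y) / (y - 1))"

definition delta ::
  "complex \<Rightarrow> (idx \<Rightarrow> complex) \<Rightarrow> (idx \<Rightarrow> complex) \<Rightarrow> complex \<Rightarrow> complex \<Rightarrow> complex \<Rightarrow> complex" where
  "delta q \<Theta> \<Theta>' t y Z =
     (frakp \<Theta> \<Theta>' t 0
      - (alpha q \<Theta> \<Theta>' t y Z * y + z1 q \<Theta> \<Theta>' t y Z) * (beta q \<Theta> \<Theta>' t y Z * y + z2 q \<Theta> \<Theta>' t y Z))
     / y"

definition frakA ::
  "complex \<Rightarrow> (idx \<Rightarrow> complex) \<Rightarrow> (idx \<Rightarrow> complex) \<Rightarrow> (complex \<Rightarrow> complex) \<Rightarrow> (complex \<Rightarrow> complex) \<Rightarrow>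
   (complex \<Rightarrow> complex) \<Rightarrow> complex \<Rightarrow> complex \<Rightarrow> complex^2^2" where
  "frakA q \<Theta> \<Theta>' lam y Z x t =
     (1 / ((x - 1) * (x - t))) \<odot>
     mat2 (\<Theta>' Iinf * ((x - y t) * (x - alpha q \<Theta> \<Theta>' t (y t) (Z t)) + z1 q \<Theta> \<Theta>' t (y t) (Z t)))
          ((q - 1) * lam t * (x - y t))
          (\<Theta> Iinf * \<Theta>' Iinf * ((gamma q \<Theta> \<Theta>' t (y t) (Z t) * x + delta q \<Theta> \<Theta>' t (y t) (Z t))
             / ((q - 1) * lam t)))
          (\<Theta> Iinf * ((x - y t) * (x - beta q \<Theta> \<Theta>' t (y t) (Z t)) + z2 q \<Theta> \<Theta>' t (y t) (Z t)))"

definition fuchs ::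
  "(complex \<Rightarrow> complex^2^2) \<Rightarrow> (complex \<Rightarrow> complex^2^2) \<Rightarrow> (complex \<Rightarrow> complex^2^2) \<Rightarrow>
   complex \<Rightarrow> complex \<Rightarrow> complex^2^2" where
  "fuchs A0 A1 At x t = A0 t + (x / (x - 1)) \<odot> A1 t + (x / (t * (x - t))) \<odot> At t"

definition A_inf ::
  "(complex \<Rightarrow> complex^2^2) \<Rightarrow> (complex \<Rightarrow> complex^2^2) \<Rightarrow> (complex \<Rightarrow> complex^2^2) \<Rightarrow>
   complex \<Rightarrow> complex^2^2" where
  "A_inf A0 A1 At t = A0 t + A1 t + (1 / t) \<odot> At t"

definition XX ::
  "complex \<Rightarrow> (idx \<Rightarrow> complex) \<Rightarrow> (idx \<Rightarrow> complex) \<Rightarrow> (complex \<Rightarrow> complex) \<Rightarrow> (complex \<Rightarrow> complex) \<Rightarrow>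
   complex \<Rightarrow> complex" where
  "XX q \<Theta> \<Theta>' y Z t =
     (y t - 1) * (y t - t) * (1 + (q - 1) * y t * Z t)
     / (\<Theta> Iinf * \<Theta>' Iinf * (y t - \<Theta> I1) * (y t - \<Theta>' I1))"

definition BB0 ::
  "complex \<Rightarrow> (idx \<Rightarrow> complex) \<Rightarrow> (idx \<Rightarrow> complex) \<Rightarrow> (complex \<Rightarrow> complex^2^2) \<Rightarrow>
   (complex \<Rightarrow> complex^2^2) \<Rightarrow> (complex \<Rightarrow> complex^2^2) \<Rightarrow> complex \<Rightarrow> complex^2^2" where
  "BB0 q \<Theta> \<Theta>' A0 A1 At t =
     (- (q * t)) \<odot>
     ((A_inf A0 A1 At t + ((t - 1) / ((t * \<Theta> It - 1) * (t * \<Theta>' It - 1))) \<odot> A1 t)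
      ** matrix_inv ((1 / (\<Theta> It * \<Theta>' It)) \<odot> A0 t
                     + (t * (t - 1) / ((t * \<Theta> It - 1) * (t * \<Theta>' It - 1))) \<odot> A1 t))"

definition frakC ::
  "complex \<Rightarrow> (idx \<Rightarrow> complex) \<Rightarrow> (idx \<Rightarrow> complex) \<Rightarrow> (complex \<Rightarrow> complex) \<Rightarrow> (complex \<Rightarrow> complex) \<Rightarrow>
   (complex \<Rightarrow> complex) \<Rightarrow> complex \<Rightarrow> complex^2^2" where
  "frakC q \<Theta> \<Theta>' lam y Z t =
     mat2 (sigma_qt q lam t / lam t
           * ((\<Theta> Iinf * XX q \<Theta> \<Theta>' y Z t - 1) / (q * \<Theta>' Iinf * XX q \<Theta> \<Theta>' y Z t - 1)))
          0 0 1"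

end

theory Submission
  imports Defs "HOL-Computational_Algebra.Fundamental_Theorem_Algebra"
begin

text \<open>
  Let \<open>P(x) = (x - 1) (x - t) \<AA>(x, t)\<close> and \<open>h(x) = (x - t \<Theta>\<^sub>t) (x - t \<Theta>'\<^sub>t)\<close>. For generic \<open>t\<close> there is a
  unique matrix \<open>B\<close> such that \<open>h(x)\<close> divides \<open>(q x + B) P(x)\<close> and \<open>det (x + B) = q\<^sup>2 h(x / q)\<close>; it is \<open>B\<^sub>0\<close>.
  The quotient times \<open>adj(x + B)\<close>, divided by \<open>q\<close>, is again of the shape of \<open>P\<close>, with explicit data given by the
  right-hand sides of the \<open>q\<close>-difference equations, and conditions (2) and (3) both say that it agrees with
  \<open>P(x, q t)\<close> up to conjugation by \<open>\<CC>\<close>: a matrix of this shape is determined by its data.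

  For (1), a rational \<open>\<BB>\<close> intertwining \<open>\<AA>(x, t)\<close> and \<open>\<AA>(x, q t)\<close> is analysed at each fixed \<open>t\<close> outside a countable
  set. The poles of \<open>h(x / q) \<BB>(x) / (x - q t)\<close> form finite strings \<open>a, q a, \<dots>\<close> whose ends are controlled by the zeros
  of \<open>det \<AA>\<close>, and non-resonance excludes them; non-resonance at \<open>0\<close> and infinity then leaves only \<open>C (x + B)\<close> with a
  diagonal matrix \<open>C\<close>, and \<open>B\<close> has to be \<open>B\<^sub>0\<close>.
\<close>

text \<open>What makes the equation for y explicit is a triangularity. At x = y the matrix P(y) is
  lower triangular, with diagonal entries w and f, say; since det P(y) = w f, the definition of
  \<open>X\<close> amounts to X f = h(y). Write (q x + B) P(x) = h(x) S(x) with S(x) = q x diag(th',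
  th) + R. The second column at x = y says that the second column of q y + B is X times that of
  S(y). Hence X R - B is lower triangular as well. Its determinant is the product of its diagonal
  entries, which involves y(t) y(q t), and it is also a quadratic polynomial in X known from det and
  trace at 0. The factor h(x / q) in front of the intertwiner is forced. The functional equation of
  \<open>\<BB>\<close> / (x - q t) lets a string of poles start at q u and stop at q u, for a root u
  of h, and the deformation matrix really has these poles. Multiplication by h(x / q) removes
  exactly them: a string would then have to start at q^2 u or q v and stop at some u' or v', where
  v, v' stand for the other zeros of det P, and non-resonance forbids this order.\<close>

no_notation fps_nth (infixl \<open>$\<close> 75)

section \<open>Matrices of size two\<close>

lemma mat2_nth [simp]:
  "mat2 a b c d $ 1 $ 1 = a" "mat2 a b c d $ 1 $ 2 = b"
  "mat2 a b c d $ 2 $ 1 = c" "mat2 a b c d $ 2 $ 2 = d"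
  by (simp_all add: mat2_def)

lemma mat2_eta: "mat2 (A $ 1 $ 1) (A $ 1 $ 2) (A $ 2 $ 1) (A $ 2 $ 2) = A"
  by (simp add: vec_eq_iff forall_2)

lemma mat2_cases: obtains a b c d where "A = mat2 a b c d"
  by (metis mat2_eta)

lemma mat2_eq_iff [simp]:
  "mat2 a b c d = mat2 a' b' c' d' \<longleftrightarrow> a = a' \<and> b = b' \<and> c = c' \<and> d = d'"
  by (auto simp: vec_eq_iff forall_2)

lemma mat2_eqI:
  assumes "A $ 1 $ 1 = B $ 1 $ 1" "A $ 1 $ 2 = B $ 1 $ 2" "A $ 2 $ 1 = B $ 2 $ 1" "A $ 2 $ 2 = B $ 2 $ 2"
  shows "A = (B :: complex^2^2)"
  using assms by (simp add: vec_eq_iff forall_2)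

lemma mat2_mult [simp]:
  "mat2 a b c d ** mat2 a' b' c' d' =
     mat2 (a * a' + b * c') (a * b' + b * d') (c * a' + d * c') (c * b' + d * d')"
  by (simp add: vec_eq_iff forall_2 matrix_matrix_mult_def sum_2)

lemma mat2_arith [simp]:
  "mat2 a b c d + mat2 a' b' c' d' = mat2 (a + a') (b + b') (c + c') (d + d')"
  "mat2 a b c d - mat2 a' b' c' d' = mat2 (a - a') (b - b') (c - c') (d - d')"
  "- mat2 a b c d = mat2 (- a) (- b) (- c) (- d)"
  "k \<odot> mat2 a b c d = mat2 (k * a) (k * b) (k * c) (k * d)"
  by (simp_all add: vec_eq_iff forall_2 mat_smult_def)

lemma mat_eq_mat2: "mat k = mat2 k 0 0 k"
  by (simp add: vec_eq_iff forall_2 mat_def)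

lemma det_mat2 [simp]: "det (mat2 a b c d) = a * d - b * c"
  by (simp add: det_2)

lemma mat_smult_nth [simp]: "(k \<odot> A) $ i $ j = k * A $ i $ j"
  by (simp add: mat_smult_def)

lemma matrix_inv_eqI:
  assumes "A ** B = mat 1"
  shows "matrix_inv A = (B :: complex^2^2)"
proof -
  have BA: "B ** A = mat 1" using assms by (simp add: matrix_left_right_inverse)
  have "A ** matrix_inv A = mat 1 \<and> matrix_inv A ** A = mat 1"
    unfolding matrix_inv_def by (rule someI [of _ B]) (use assms BA in blast)
  then have "matrix_inv A = (B ** A) ** matrix_inv A" "A ** matrix_inv A = mat 1"
    by (simp_all only: BA matrix_mul_lid)
  then show ?thesis
    by (simp only: matrix_mul_rid flip: matrix_mul_assoc)
qed

lemma matrix_inv_mat2: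
  assumes "a * d - b * c \<noteq> 0"
  shows "matrix_inv (mat2 a b c d) = (1 / (a * d - b * c)) \<odot> mat2 d (- b) (- c) a"
proof (rule matrix_inv_eqI)
  define i where "i = 1 / (a * d - b * c)"
  have "i * (a * d - b * c) = 1" using assms by (simp add: i_def)
  then show "mat2 a b c d ** (1 / (a * d - b * c)) \<odot> mat2 d (- b) (- c) a = mat 1"
    unfolding i_def[symmetric] by (simp add: mat_eq_mat2) (simp add: algebra_simps)
qed

lemma mat_smult_mult:
  "(k \<odot> M) ** N = k \<odot> (M ** N)" "M ** (k \<odot> N) = k \<odot> (M ** N)"
  by (simp_all add: vec_eq_iff matrix_matrix_mult_def sum_distrib_left mult_ac)

lemma mat_smult_mat_smult: "j \<odot> k \<odot> M = (j * k) \<odot> M"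
  by (simp add: vec_eq_iff mult.assoc)

lemma mat_smult_vector: "(k \<odot> M) *v v = k *s (M *v v)"
  by (simp add: vec_eq_iff matrix_vector_mult_def sum_distrib_left mult.assoc)

lemma mult_mat_eq: "M ** mat k = k \<odot> M"
  by (rule mat2_cases[of M]) (simp add: mat_eq_mat2 mult.commute)

definition adj2 :: "complex^2^2 \<Rightarrow> complex^2^2" where
  "adj2 M = mat2 (M $ 2 $ 2) (- M $ 1 $ 2) (- M $ 2 $ 1) (M $ 1 $ 1)"

lemma adj2_mat2 [simp]: "adj2 (mat2 a b c d) = mat2 d (- b) (- c) a"
  by (simp add: adj2_def)

lemma mult_adj2: "M ** adj2 M = mat (det M)" "adj2 M ** M = mat (det M)"
  by (rule mat2_cases[of M]; simp add: mat_eq_mat2 mult.commute)+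

lemma mat_mult_eq: "mat k ** M = k \<odot> M"
  by (rule mat2_cases[of M]) (simp add: mat_eq_mat2 mult.commute)

lemma matrix_diff_distrib:
  fixes A B M :: "complex^2^2"
  shows "(A - B) ** M = A ** M - B ** M" "M ** (A - B) = M ** A - M ** B"
  by (simp_all add: vec_eq_iff matrix_matrix_mult_def algebra_simps flip: sum_subtractf)

lemma poly_cofinite_zero:
  assumes "MOST x. poly p x = (0 :: complex)"
  shows "p = 0"
proof (rule ccontr)
  assume "p \<noteq> 0"
  then have "MOST x. poly p x \<noteq> 0" by (simp add: eventually_cofinite poly_roots_finite)
  with assms have "MOST x :: complex. False" by eventually_elim simp
  then show False by (simp add: infinite_UNIV_char_0)
qed

lemma poly_eq_MOST: "(MOST x. poly p x = poly r x) \<longleftrightarrow> p = (r :: complex poly)"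
  using poly_cofinite_zero [of "p - r"] by auto

section \<open>Normal forms\<close>

text \<open>The matrices \<open>(x - 1) (x - t) \<AA>(x, t)\<close> have leading term \<open>diag(th', th) x\<^sup>2\<close>. The upper right
  entry \<open>l (x - y)\<close>, the value \<open>w\<close> of the upper left entry at its zero \<open>y\<close>, the trace \<open>T\<close> at \<open>0\<close> and
  the determinant determine such a matrix.\<close>

definition normal_form where
  "normal_form th th' s d s1 d1 T l y w P \<longleftrightarrow>
    (\<exists>a1 a0 b1 b0 g1 g0 :: complex.
       (\<forall>x. P x = mat2 (th' * x\<^sup>2 + a1 * x + a0) (l * (x - y)) (g1 * x + g0) (th * x\<^sup>2 + b1 * x + b0)) \<and>
       th' * y\<^sup>2 + a1 * y + a0 = w \<and> a0 + b0 = T \<and>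
       (\<forall>x. det (P x) = th * th' * (x\<^sup>2 - s * x + d) * (x\<^sup>2 - s1 * x + d1)))"

text \<open>The coefficients of x^4 agree identically, so four relations remain for the six unknown
  coefficients of a normal form. The two missing ones are supplied by \<open>w\<close> and
  \<open>T\<close>.\<close>

lemma det_coeffs:
  fixes th :: complex
  assumes "MOST x. (th' * x\<^sup>2 + a1 * x + a0) * (th * x\<^sup>2 + b1 * x + b0) - l * (x - y) * (g1 * x + g0)
             = th * th' * (x\<^sup>2 - s * x + d) * (x\<^sup>2 - s1 * x + d1)"
  shows "th' * b1 + th * a1 = - (th * th' * (s + s1))"
    "th' * b0 + th * a0 + a1 * b1 - l * g1 = th * th' * (d + d1 + s * s1)"
    "a1 * b0 + a0 * b1 - l * (g0 - y * g1) = - (th * th' * (s * d1 + s1 * d))"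
    "a0 * b0 + l * y * g0 = th * th' * d * d1"
proof -
  have "MOST x. poly ([:a0, a1, th':] * [:b0, b1, th:] - smult l ([:-y, 1:] * [:g0, g1:])
             - smult (th * th') ([:d, - s, 1:] * [:d1, - s1, 1:])) x = 0"
    using assms by eventually_elim (simp add: power2_eq_square algebra_simps)
  from poly_cofinite_zero[OF this]
  have 0: "[:a0, a1, th':] * [:b0, b1, th:] - smult l ([:-y, 1:] * [:g0, g1:])
             - smult (th * th') ([:d, - s, 1:] * [:d1, - s1, 1:]) = 0" .
  have "th' * b1 + th * a1 + th * th' * (s + s1) = 0"
    using arg_cong[OF 0, of "\<lambda>p. coeff p 3"] by (simp add: numeral_3_eq_3 algebra_simps)
  then show "th' * b1 + th * a1 = - (th * th' * (s + s1))" by (simp only: add_eq_0_iff2)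
  have "th' * b0 + th * a0 + a1 * b1 - l * g1 - th * th' * (d + d1 + s * s1) = 0"
    using arg_cong[OF 0, of "\<lambda>p. coeff p 2"] by (simp add: numeral_2_eq_2 algebra_simps)
  then show "th' * b0 + th * a0 + a1 * b1 - l * g1 = th * th' * (d + d1 + s * s1)"
    by (simp only: right_minus_eq)
  have "a1 * b0 + a0 * b1 - l * (g0 - y * g1) + th * th' * (s * d1 + s1 * d) = 0"
    using arg_cong[OF 0, of "\<lambda>p. coeff p 1"] by (simp add: algebra_simps)
  then show "a1 * b0 + a0 * b1 - l * (g0 - y * g1) = - (th * th' * (s * d1 + s1 * d))"
    by (simp only: add_eq_0_iff2)
  have "a0 * b0 + l * y * g0 - th * th' * d * d1 = 0"
    using arg_cong[OF 0, of "\<lambda>p. coeff p 0"] by (simp add: algebra_simps)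
  then show "a0 * b0 + l * y * g0 = th * th' * d * d1"
    by (simp only: right_minus_eq)
qed

text \<open>At x = y the matrix is lower triangular, so \<open>w\<close> and the determinant fix
  both diagonal entries there. Subtracting the trace at 0 and dividing by y gives a1 + b1. The x^3
  coefficient of the determinant gives th' b1 + th a1, and the two combinations separate because th
  and th' differ. The lower left entry then follows from the determinant by division by l.\<close>

lemma normal_form_unique:
  assumes P: "normal_form th th' s d s1 d1 T l y w P" and Q: "normal_form th th' s d s1 d1 T l y w Q"
    and nz: "l \<noteq> 0" "y \<noteq> 0" "w \<noteq> 0" "th \<noteq> th'"
  shows "P = Q"
proof -
  from P obtain a1 a0 b1 b0 g1 g0 where
    P: "\<And>x. P x = mat2 (th' * x\<^sup>2 + a1 * x + a0) (l * (x - y)) (g1 * x + g0) (th * x\<^sup>2 + b1 * x + b0)"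
    "th' * y\<^sup>2 + a1 * y + a0 = w" "a0 + b0 = T"
    "\<And>x. det (P x) = th * th' * (x\<^sup>2 - s * x + d) * (x\<^sup>2 - s1 * x + d1)"
    unfolding normal_form_def by blast
  from Q obtain A1 A0 B1 B0 G1 G0 where
    Q: "\<And>x. Q x = mat2 (th' * x\<^sup>2 + A1 * x + A0) (l * (x - y)) (G1 * x + G0) (th * x\<^sup>2 + B1 * x + B0)"
    "th' * y\<^sup>2 + A1 * y + A0 = w" "A0 + B0 = T"
    "\<And>x. det (Q x) = th * th' * (x\<^sup>2 - s * x + d) * (x\<^sup>2 - s1 * x + d1)"
    unfolding normal_form_def by blast
  note cP = det_coeffs[OF MOST_I, OF P(4)[unfolded P(1) det_mat2]]
  note cQ = det_coeffs[OF MOST_I, OF Q(4)[unfolded Q(1) det_mat2]]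
  have "w * (th * y\<^sup>2 + b1 * y + b0) = w * (th * y\<^sup>2 + B1 * y + B0)"
    using P(4)[of y] Q(4)[of y] P(2) Q(2) by (simp add: P(1) Q(1))
  then have e: "b1 * y + b0 = B1 * y + B0" using nz by simp
  have e': "a1 * y + a0 = A1 * y + A0" using P(2) Q(2) by (metis add.assoc add_left_cancel)
  have "(a1 + b1) * y = (A1 + B1) * y"
    using e e' P(3) Q(3) by algebra
  then have sm: "a1 + b1 = A1 + B1" using nz by simp
  have "th' * b1 + th * a1 = th' * B1 + th * A1" by (simp only: cP(1) cQ(1))
  then have "th' * (b1 - B1) = th * (A1 - a1)" by (simp add: right_diff_distrib) (simp add: algebra_simps)
  also have "A1 - a1 = b1 - B1" using sm by (simp add: algebra_simps)
  finally have b1: "b1 = B1" using nz by simp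
  then have a1: "a1 = A1" using sm by simp
  have b0: "b0 = B0" "a0 = A0" using e e' b1 a1 by auto
  have "l * g1 = l * G1" using trans[OF cP(2) cQ(2)[symmetric]] by (simp add: a1 b0 b1)
  then have g1: "g1 = G1" using nz by simp
  have "l * (g0 - y * g1) = l * (G0 - y * g1)" using trans[OF cP(3) cQ(3)[symmetric]] by (simp add: a1 b0 b1 g1)
  then have "g0 = G0" using nz by simp
  then show ?thesis by (intro ext) (simp add: P(1) Q(1) a1 b1 b0 g1)
qed

section \<open>The connection matrix\<close>

text \<open>The factorisation behind the \<open>q\<close>-isomonodromic deformation: \<open>B\<close> is the matrix \<open>B\<^sub>0\<close>, and
  \<open>(x - q t) \<CC> (x + B) / (x\<^sup>2 - q s x + q\<^sup>2 d)\<close> is the deformation matrix, where \<open>x\<^sup>2 - s x + d\<close>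
  has the roots \<open>t \<Theta>\<^sub>t\<close> and \<open>t \<Theta>'\<^sub>t\<close>.\<close>

definition connection where
  "connection q th th' s d P B R \<longleftrightarrow>
    (\<forall>x :: complex. (mat (q * x) + B) ** P x
        = (x\<^sup>2 - s * x + d) \<odot> (mat2 (q * th' * x) 0 0 (q * th * x) + R)) \<and>
    (\<forall>x. det (mat x + B) = x\<^sup>2 - q * s * x + q\<^sup>2 * d)"

text \<open>The last two conclusions are the second column of the factorisation at x = y, where the
  second column of P(y) is (0, f) with X f = h(y). They are derived by direct computation, so that f
  = 0 is covered too.\<close>

lemma connection_exists:
  assumes P: "normal_form th th' s d s1 d1 T l y w P"
    and w: "w = th * th' * X * (y\<^sup>2 - s1 * y + d1)"
    and nz: "th \<noteq> 0" "th' \<noteq> 0" "l \<noteq> 0" "X \<noteq> 0" "y\<^sup>2 - s1 * y + d1 \<noteq> 0"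
      "th * X \<noteq> 1" "w \<noteq> th' * (y\<^sup>2 - s * y + d)"
  obtains B R where "connection q th th' s d P B R"
    "R $ 1 $ 2 * (1 - th * X) = q * l" "B $ 1 $ 2 = X * R $ 1 $ 2"
    "q * y + B $ 2 $ 2 = X * (q * th * y + R $ 2 $ 2)"
proof -
  from P obtain a1 a0 b1 b0 g1 g0 where
    P: "\<And>x. P x = mat2 (th' * x\<^sup>2 + a1 * x + a0) (l * (x - y)) (g1 * x + g0) (th * x\<^sup>2 + b1 * x + b0)"
    "th' * y\<^sup>2 + a1 * y + a0 = w" "a0 + b0 = T"
    "\<And>x. det (P x) = th * th' * (x\<^sup>2 - s * x + d) * (x\<^sup>2 - s1 * x + d1)"
    unfolding normal_form_def by blast
  note c = det_coeffs[OF MOST_I, OF P(4)[unfolded P(1) det_mat2]]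
  \<comment> \<open>\<open>P x = (x\<^sup>2 - s x + d) diag(th', th) + x U + V\<close> with \<open>U = (u11, l; g1, u22)\<close> and
    \<open>V = (v11, - l y; g0, v22)\<close>; then \<open>det (x U + V) = D (x\<^sup>2 - s x + d)\<close> and \<open>B = - q (s + V adj(U) / D)\<close>.\<close>
  define u11 v11 u22 v22 where uv: "u11 = a1 + s * th'" "v11 = a0 - d * th'" "u22 = b1 + s * th" "v22 = b0 - d * th"
  define D where "D = u11 * u22 - l * g1"
  define h p where hp: "h = y\<^sup>2 - s * y + d" "p = y\<^sup>2 - s1 * y + d1"
  have ab: "a1 = u11 - s * th'" "a0 = v11 + d * th'" "b1 = u22 - s * th" "b0 = v22 + d * th"
    by (simp_all add: uv)
  have lin: "th' * u22 + th * u11 = th * th' * (s - s1)"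
    using c(1) unfolding ab by algebra
  have D: "D = th * th' * (d1 - d) - th' * v22 - th * v11"
    using c(2) lin unfolding ab D_def by algebra
  have mid: "u11 * v22 + u22 * v11 - l * g0 + l * y * g1 = - (s * D)"
    using c(3) lin D unfolding ab by algebra
  have dV: "v11 * v22 + l * y * g0 = d * D"
    using c(4) D unfolding ab by algebra
  define e1 where "e1 = u11 * y + v11"
  have e1: "e1 = w - th' * h" by (simp add: e1_def uv hp algebra_simps flip: P(2))
  define f where "f = th * y\<^sup>2 + b1 * y + b0"
  have "w * f = th * th' * h * p"
    using P(4)[of y] by (simp add: P hp f_def)
  then have "th * th' * p * (X * f) = th * th' * p * h" by (simp add: w hp)
  then have Xf: "X * f = h" using nz by (simp add: hp)
  \<comment> \<open>At x = y the matrix x U + V is lower triangular with upper left entry e1, so D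
    h(y) = e1 (f - th h(y)); with X f = h(y) this is the next relation multiplied by h(y). As h(y)
    may vanish, D is instead computed from a relation that is linear in the coefficients.\<close>
  have "D = th * th' * (p + h) - th' * f - th * w"
    unfolding D using lin unfolding w hp f_def ab P(2)[unfolded w, symmetric] by algebra
  then have DX: "D * X = e1 * (1 - th * X)"
    using Xf w unfolding e1 hp[symmetric] by algebra
  moreover have "e1 \<noteq> 0" using nz by (simp add: e1 hp)
  ultimately have "D \<noteq> 0" using nz by auto
  define i where "i = 1 / D"
  have i: "i * D = 1" using \<open>D \<noteq> 0\<close> by (simp add: i_def)
  have iX: "i * e1 * (1 - th * X) = X"
    using DX \<open>D \<noteq> 0\<close> by (simp add: i_def field_simps)
  define b11 b12 b21 b22 where b: "b11 = - q * (s + i * (v11 * u22 + l * y * g1))" "b12 = q * i * l * e1"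
    "b21 = - q * i * (g0 * u22 - v22 * g1)" "b22 = - q * (s + i * (v22 * u11 - g0 * l))"
  define B where "B = mat2 b11 b12 b21 b22"
  define R where "R = mat2 (th' * b11 + q * u11) (th * b12 + q * l) (th' * b21 + q * g1) (th * b22 + q * u22)"
  \<comment> \<open>\<open>BU\<close> and \<open>BV\<close> are the coefficients of x and of 1 in (q
    x + B) (x U + V) = q h(x) U; consequently R = B diag(th', th) + q U.\<close>
  have BU: "b11 * u11 + b12 * g1 = - q * (s * u11 + v11)" "b11 * l + b12 * u22 = - q * (s * l - l * y)"
    "b21 * u11 + b22 * g1 = - q * (s * g1 + g0)" "b21 * l + b22 * u22 = - q * (s * u22 + v22)"
    using i unfolding b D_def e1_def by algebra+
  have BV: "b11 * v11 + b12 * g0 = q * d * u11" "b12 * v22 - b11 * l * y = q * d * l"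
    "b21 * v11 + b22 * g0 = q * d * g1" "b22 * v22 - b21 * l * y = q * d * u22"
    using i mid dV unfolding b D_def e1_def by algebra+
  have tr: "b11 + b22 = - q * s"
    using i mid unfolding b by algebra
  have dt: "b11 * b22 - b12 * b21 = q\<^sup>2 * d"
    using i mid dV unfolding b D_def e1_def by algebra
  have connection: "connection q th th' s d P B R"
    unfolding connection_def B_def R_def P(1) mat_eq_mat2
    using BU BV tr dt by (auto simp: ab) (algebra+)
  have "b12 * (1 - th * X) = q * l * (i * e1 * (1 - th * X))" by (simp add: b mult_ac)
  then have b12: "b12 * (1 - th * X) = q * l * X" by (simp only: iX)
  moreover have "(th * b12 + q * l) * (1 - th * X) = th * (b12 * (1 - th * X)) + q * l * (1 - th * X)"
    by (simp add: algebra_simps)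
  ultimately have "(th * b12 + q * l) * (1 - th * X) = th * (q * l * X) + q * l * (1 - th * X)"
    by (simp only:)
  then have R12: "R $ 1 $ 2 * (1 - th * X) = q * l"
    unfolding R_def mat2_nth by (simp only:) (simp add: algebra_simps)
  have "B $ 1 $ 2 * (1 - th * X) = X * (R $ 1 $ 2 * (1 - th * X))"
    unfolding R12 using b12 by (simp add: B_def)
  then have B12: "B $ 1 $ 2 = X * R $ 1 $ 2" using nz by simp
  have 22: "q * y + b22 = q * i * e1 * u22"
    using i mid unfolding b D_def e1_def by algebra
  have "(q * y + b22) * (1 - th * X) = q * u22 * (i * e1 * (1 - th * X))"
    unfolding 22 by (simp add: mult_ac)
  then have "(q * y + b22) * (1 - th * X) = q * u22 * X" by (simp only: iX)
  then have "(q * y + B $ 2 $ 2) * (1 - th * X) = X * (q * th * y + R $ 2 $ 2) * (1 - th * X)"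
    unfolding B_def R_def mat2_nth by algebra
  then have "q * y + B $ 2 $ 2 = X * (q * th * y + R $ 2 $ 2)" using nz by simp
  with connection R12 B12 show ?thesis using that by blast
qed

text \<open>With \<BB> = (x - q t) C (x + B) / h'(x), h'(x) = q^2 h(x / q), the isomonodromy
  equation reads q P(x, q t) C (x + B) = h'(x) C S(x), where S is the quotient of (q x + B) P(x) by
  h(x). Multiplying by adj(x + B), whose product with x + B is h'(x), leaves q P(x, q t) C = C S(x)
  adj(x + B).\<close>

definition next_system where
  "next_system q th th' B R x =
     (1 / q) \<odot> ((mat2 (q * th' * x) 0 0 (q * th * x) + R)
        ** mat2 (x + B $ 2 $ 2) (- B $ 1 $ 2) (- B $ 2 $ 1) (x + B $ 1 $ 1))"

lemma quad_coeffs: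
  fixes a b c :: complex
  assumes "MOST x. a * x\<^sup>2 + b * x + c = a' * x\<^sup>2 + b' * x + c'"
  shows "a = a'" "b = b'" "c = c'"
proof -
  have "MOST x. poly [:c, b, a:] x = poly [:c', b', a':] x"
    using assms by eventually_elim (simp add: power2_eq_square algebra_simps)
  then have "[:c, b, a:] = [:c', b', a':]" by (simp only: poly_eq_MOST)
  then show "a = a'" "b = b'" "c = c'" by auto
qed

lemma MOST_quad_nz: "MOST x :: complex. x\<^sup>2 - s * x + d \<noteq> 0"
proof -
  have "finite {x. poly [:d, -s, 1:] x = 0}" by (rule poly_roots_finite) simp
  moreover have "{x. poly [:d, -s, 1:] x = 0} = {x. x\<^sup>2 - s * x + d = 0}"
    by (auto simp: power2_eq_square algebra_simps)
  ultimately show ?thesis by (simp add: eventually_cofinite)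
qed

lemma connection_facts:
  assumes connection: "connection q th th' s d P B R"
    and det: "\<And>x. det (P x) = th * th' * (x\<^sup>2 - s * x + d) * (x\<^sup>2 - s1 * x + d1)"
    and q: "q \<noteq> 0"
  shows "B $ 1 $ 1 + B $ 2 $ 2 = - (q * s)" "det B = q\<^sup>2 * d"
    "B ** P 0 = d \<odot> R"
    "det (mat2 (q * th' * x) 0 0 (q * th * x) + R) = q\<^sup>2 * th * th' * (x\<^sup>2 - s1 * x + d1)"
proof -
  obtain b11 b12 b21 b22 where B: "B = mat2 b11 b12 b21 b22" by (rule mat2_cases)
  obtain r11 r12 r21 r22 where R: "R = mat2 r11 r12 r21 r22" by (rule mat2_cases)
  have d1: "det (mat x + B) = x\<^sup>2 - q * s * x + q\<^sup>2 * d" for x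
    using connection by (simp add: connection_def)
  have "MOST x. 1 * x\<^sup>2 + (b11 + b22) * x + (b11 * b22 - b12 * b21) = 1 * x\<^sup>2 + (- (q * s)) * x + q\<^sup>2 * d"
    using d1 by (intro MOST_I) (simp add: B mat_eq_mat2 power2_eq_square algebra_simps)
  note c = quad_coeffs[OF this]
  show "B $ 1 $ 1 + B $ 2 $ 2 = - (q * s)" "det B = q\<^sup>2 * d" using c by (simp_all add: B)
  have E: "(mat (q * x) + B) ** P x = (x\<^sup>2 - s * x + d) \<odot> (mat2 (q * th' * x) 0 0 (q * th * x) + R)" for x
    using connection by (simp add: connection_def)
  show "B ** P 0 = d \<odot> R"
    using E[of 0] by (simp add: mat_eq_mat2 B R)
  have "(x\<^sup>2 - s * x + d)\<^sup>2 * det (mat2 (q * th' * x) 0 0 (q * th * x) + R)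
      = (x\<^sup>2 - s * x + d)\<^sup>2 * (q\<^sup>2 * th * th' * (x\<^sup>2 - s1 * x + d1))" for x
  proof -
    have "det ((mat (q * x) + B) ** P x) = ((q*x)\<^sup>2 - q * s * (q*x) + q\<^sup>2 * d) * det (P x)"
      by (simp add: det_mul d1)
    then show ?thesis unfolding E det by (simp add: R power2_eq_square algebra_simps)
  qed
  then have *: "MOST x. det (mat2 (q * th' * x) 0 0 (q * th * x) + R) = q\<^sup>2 * th * th' * (x\<^sup>2 - s1 * x + d1)"
    using MOST_quad_nz[of s d] by (auto elim!: eventually_mono)
  have "MOST x. (q\<^sup>2 * th * th') * x\<^sup>2 + (q * th' * r22 + q * th * r11) * x + (r11 * r22 - r12 * r21)
    = (q\<^sup>2 * th * th') * x\<^sup>2 + (- (q\<^sup>2 * th * th' * s1)) * x + q\<^sup>2 * th * th' * d1"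
    using * by eventually_elim (simp add: R power2_eq_square algebra_simps)
  note c' = quad_coeffs[OF this]
  have "det (mat2 (q * th' * x) 0 0 (q * th * x) + R) =
     (q\<^sup>2 * th * th') * x\<^sup>2 + (q * th' * r22 + q * th * r11) * x + (r11 * r22 - r12 * r21)"
    by (simp add: R power2_eq_square algebra_simps)
  also have "\<dots> = q\<^sup>2 * th * th' * (x\<^sup>2 - s1 * x + d1)"
    unfolding c'(2,3) by (simp add: algebra_simps)
  finally show "det (mat2 (q * th' * x) 0 0 (q * th * x) + R) = q\<^sup>2 * th * th' * (x\<^sup>2 - s1 * x + d1)" .
qed

lemma next_system_normal_form:
  assumes P: "normal_form th th' s d s1 d1 T l y w P"
    and connection: "connection q th th' s d P B R"
    and R12: "R $ 1 $ 2 * (1 - th * X) = q * l" and B12: "B $ 1 $ 2 = X * R $ 1 $ 2"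
    and 22: "q * y + B $ 2 $ 2 = X * (q * th * y + R $ 2 $ 2)"
    and nz: "q \<noteq> 0" "d \<noteq> 0" "l \<noteq> 0" "X \<noteq> 0" "y \<noteq> 0" "th * X \<noteq> 1" "q * th' * X \<noteq> 1"
    and ly: "lh = l * (q * th' * X - 1) / (th * X - 1)"
      "yh = q * (th * th' * d1 * X\<^sup>2 - T * X + d) / (y * (1 - th * X) * (1 - q * th' * X))"
    and wh: "wh = (yh\<^sup>2 - q * s * yh + q\<^sup>2 * d) / (q * X)"
  shows "normal_form th th' (q * s) (q\<^sup>2 * d) s1 d1 (q * T) lh yh wh (next_system q th th' B R)"
proof -
  from P obtain a1 a0 b1 b0 g1 g0 where
    P: "\<And>x. P x = mat2 (th' * x\<^sup>2 + a1 * x + a0) (l * (x - y)) (g1 * x + g0) (th * x\<^sup>2 + b1 * x + b0)"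
    "th' * y\<^sup>2 + a1 * y + a0 = w" "a0 + b0 = T"
    "\<And>x. det (P x) = th * th' * (x\<^sup>2 - s * x + d) * (x\<^sup>2 - s1 * x + d1)"
    unfolding normal_form_def by blast
  note cf = connection_facts[OF connection P(4) nz(1)]
  obtain b11 b12 b21 b22 where B: "B = mat2 b11 b12 b21 b22" by (rule mat2_cases)
  obtain r11 r12 r21 r22 where R: "R = mat2 r11 r12 r21 r22" by (rule mat2_cases)
  have r12: "r12 = q * l / (1 - th * X)" and b12: "b12 = X * r12"
    using R12 B12 nz by (simp_all add: R B field_simps)
  have "r12 \<noteq> 0" using r12 nz by simp
  have dR: "r11 * r22 - r12 * r21 = q\<^sup>2 * th * th' * d1" using cf(4)[of 0] by (simp add: R)
  have dB: "b11 * b22 - b12 * b21 = q\<^sup>2 * d" and tB: "b11 + b22 = - (q * s)" using cf(1,2) by (simp_all add: B)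
  have BP: "b11 * a0 + b12 * g0 = d * r11" "b12 * b0 - b11 * (l * y) = d * r12"
     "b21 * a0 + b22 * g0 = d * r21" "b22 * b0 - b21 * (l * y) = d * r22"
    using cf(3) by (simp_all add: B R P(1))
  \<comment> \<open>This is d tr(R adj B). As d R = B P(0) and adj(B) B = det B, it equals det(B) tr
    P(0) = q^2 d T.\<close>
  have "d * (r11 * b22 + r22 * b11 - r12 * b21 - r21 * b12) = d * (q\<^sup>2 * T)"
    using dB P(3) BP by algebra
  then have tr: "r11 * b22 + r22 * b11 - r12 * b21 - r21 * b12 = q\<^sup>2 * T" using nz by simp
  have X22: "X * r22 - b22 = q * y * (1 - th * X)"
    using 22 unfolding B R mat2_nth by algebra
  \<comment> \<open>Both sides are det (X R - B), whose upper right entry vanishes by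
    \<open>b12\<close>. The second diagonal factor contains y and the first one contains the new
    zero \<open>yh\<close>, because the upper right entry of S adj(x + B) is r12 times (x + b11 - X
    (q th' x + r11)).\<close>
  have "(X * r11 - b11) * (X * r22 - b22) = X\<^sup>2 * (r11 * r22 - r12 * r21)
       - X * (r11 * b22 + r22 * b11 - r12 * b21 - r21 * b12) + (b11 * b22 - b12 * b21)"
    unfolding b12 by algebra
  then have "(X * r11 - b11) * (q * y * (1 - th * X)) = q\<^sup>2 * (th * th' * d1 * X\<^sup>2 - T * X + d)"
    unfolding X22 tr dR dB by algebra
  then have yh: "X * r11 - b11 = yh * (1 - q * th' * X)"
    unfolding ly using nz by (simp add: divide_simps) (simp add: power2_eq_square mult_ac)
  have lh: "q * lh = r12 * (1 - q * th' * X)"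
    unfolding ly r12 using nz by (simp add: divide_simps) algebra
  have nP: "next_system q th th' B R x = mat2 (((q * th' * x + r11) * (x + b22) - r12 * b21) / q)
      ((r12 * (x + b11) - (q * th' * x + r11) * b12) / q)
      ((r21 * (x + b22) - (q * th * x + r22) * b21) / q)
      (((q * th * x + r22) * (x + b11) - r21 * b12) / q)" for x
    by (simp add: next_system_def B R)
  have n12: "r12 * (x + b11) - (q * th' * x + r11) * b12 = q * (lh * (x - yh))" for x
    using yh lh unfolding b12 by algebra
  have form: "next_system q th th' B R x =
      mat2 (th' * x\<^sup>2 + (th' * b22 + r11 / q) * x + (r11 * b22 - r12 * b21) / q) (lh * (x - yh))
        ((r21 - q * th * b21) / q * x + (r21 * b22 - r22 * b21) / q)
        (th * x\<^sup>2 + (th * b11 + r22 / q) * x + (r22 * b11 - r21 * b12) / q)" for x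
    unfolding nP n12 using nz by (simp add: field_simps power2_eq_square)
  have "(r11 * b22 - r12 * b21) / q + (r22 * b11 - r21 * b12) / q
      = (r11 * b22 + r22 * b11 - r12 * b21 - r21 * b12) / q"
    by (simp add: add_divide_distrib diff_divide_distrib)
  then have "(r11 * b22 - r12 * b21) / q + (r22 * b11 - r21 * b12) / q = q * T"
    unfolding tr using nz by (simp add: power2_eq_square)
  moreover have "det (next_system q th th' B R x) =
      th * th' * (x\<^sup>2 - q * s * x + q\<^sup>2 * d) * (x\<^sup>2 - s1 * x + d1)" for x
  proof -
    define M where "M = mat2 (q * th' * x) 0 0 (q * th * x) + R"
    define N where "N = mat2 (x + b22) (- b12) (- b21) (x + b11)"
    have "det ((1 / q) \<odot> (M ** N)) = det M * det N / q\<^sup>2"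
      by (rule mat2_cases[of M], rule mat2_cases[of N])
         (use nz in \<open>simp add: power2_eq_square field_simps\<close>)
    moreover have "det N = x\<^sup>2 - q * s * x + q\<^sup>2 * d"
      using dB tB unfolding N_def det_mat2 by algebra
    moreover have "next_system q th th' B R x = (1 / q) \<odot> (M ** N)"
      by (simp add: next_system_def M_def N_def B)
    moreover have "det M = q\<^sup>2 * th * th' * (x\<^sup>2 - s1 * x + d1)"
      unfolding M_def by (rule cf(4))
    ultimately show ?thesis using nz by simp
  qed
  moreover have "th' * yh\<^sup>2 + (th' * b22 + r11 / q) * yh + (r11 * b22 - r12 * b21) / q = wh" (is "?W = _")
  proof -
    define W where "W = ?W"
    have w: "q * W = (q * th' * yh + r11) * (yh + b22) - r12 * b21"
      unfolding W_def using nz by (simp add: field_simps power2_eq_square)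
    \<comment> \<open>At x = yh the first row of x + B is X times that of S, so X times the upper
      left entry of S adj(x + B) is det (yh + B).\<close>
    have "(q * X * W) * r12 = (yh\<^sup>2 - q * s * yh + q\<^sup>2 * d) * r12"
      using n12[of yh] dB tB w unfolding b12 by algebra
    then have "q * X * W = yh\<^sup>2 - q * s * yh + q\<^sup>2 * d" using \<open>r12 \<noteq> 0\<close> by simp
    then have "W = wh" using nz by (simp add: wh field_simps)
    then show ?thesis by (simp only: W_def)
  qed
  ultimately show ?thesis unfolding normal_form_def using form by blast
qed

section \<open>Diagonal conjugation, and the passage between normal forms and residue
  matrices\<close>

definition gauge_by where
  "gauge_by c M = mat2 c 0 0 1 ** M ** matrix_inv (mat2 c 0 0 1)"

lemma gauge_mat2 [simp]: "c \<noteq> 0 \<Longrightarrow> gauge_by c (mat2 m n k r) = mat2 m (c * n) (k / c) r"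
  by (simp add: gauge_by_def matrix_inv_mat2)

lemma normal_form_gauge:
  assumes "normal_form th th' s d s1 d1 T l y w P" "c \<noteq> 0"
  shows "normal_form th th' s d s1 d1 T (c * l) y w (\<lambda>x. gauge_by c (P x))"
proof -
  from assms(1) obtain a1 a0 b1 b0 g1 g0 where
    P: "\<And>x. P x = mat2 (th' * x\<^sup>2 + a1 * x + a0) (l * (x - y)) (g1 * x + g0) (th * x\<^sup>2 + b1 * x + b0)"
    "th' * y\<^sup>2 + a1 * y + a0 = w" "a0 + b0 = T"
    "\<And>x. det (P x) = th * th' * (x\<^sup>2 - s * x + d) * (x\<^sup>2 - s1 * x + d1)"
    unfolding normal_form_def by blast
  have "gauge_by c (P x) = mat2 (th' * x\<^sup>2 + a1 * x + a0) (c * l * (x - y)) (g1 / c * x + g0 / c)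
    (th * x\<^sup>2 + b1 * x + b0)" for x
    using assms(2) by (simp add: P(1) add_divide_distrib mult_ac)
  moreover have "det (gauge_by c (P x)) = det (P x)" for x
    using assms(2) by (simp add: P(1) field_simps)
  ultimately show ?thesis unfolding normal_form_def using P(2,3,4) by metis
qed

lemma normal_form_read:
  assumes "normal_form th th' s d s1 d1 T l y w P" "normal_form th th' s d s1 d1 T l' y' w' P" "l \<noteq> 0"
  shows "l = l'" "y = y'" "w = w'"
proof -
  from assms(1) obtain a1 a0 b1 b0 g1 g0 where
    P: "\<And>x. P x = mat2 (th' * x\<^sup>2 + a1 * x + a0) (l * (x - y)) (g1 * x + g0) (th * x\<^sup>2 + b1 * x + b0)"
    "th' * y\<^sup>2 + a1 * y + a0 = w"
    unfolding normal_form_def by blast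
  from assms(2) obtain A1 A0 B1 B0 G1 G0 where
    Q: "\<And>x. P x = mat2 (th' * x\<^sup>2 + A1 * x + A0) (l' * (x - y')) (G1 * x + G0) (th * x\<^sup>2 + B1 * x + B0)"
    "th' * y'\<^sup>2 + A1 * y' + A0 = w'"
    unfolding normal_form_def by blast
  have e: "l * (x - y) = l' * (x - y')" "th' * x\<^sup>2 + a1 * x + a0 = th' * x\<^sup>2 + A1 * x + A0" for x
    using P(1)[of x] Q(1)[of x] by simp_all
  show l: "l = l'" using e(1)[of 0] e(1)[of 1] by algebra
  show y: "y = y'" using e(1)[of 0] l assms(3) by simp
  show "w = w'" using e(2)[of y] P(2) Q(2) y by simp
qed

text \<open>Both sides share the exponents, hence the determinant and the trace at 0; three
  parameters are left to compare, and conjugation by diag(c, 1) changes only the first of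
  them.\<close>

lemma gauge_next_iff:
  assumes P': "normal_form th th' s d s1 d1 T l' y' w' P'" and Q: "normal_form th th' s d s1 d1 T lh yh wh Q"
    and nz: "th \<noteq> th'" "l' \<noteq> 0" "y' \<noteq> 0" "w' \<noteq> 0" "c \<noteq> 0"
  shows "P' = (\<lambda>x. gauge_by c (Q x)) \<longleftrightarrow> l' = c * lh \<and> y' = yh \<and> w' = wh"
proof
  assume "P' = (\<lambda>x. gauge_by c (Q x))"
  then show "l' = c * lh \<and> y' = yh \<and> w' = wh"
    using normal_form_read[OF P' _ nz(2)] normal_form_gauge[OF Q nz(5)] by metis
next
  assume "l' = c * lh \<and> y' = yh \<and> w' = wh"
  then show "P' = (\<lambda>x. gauge_by c (Q x))"
    using normal_form_unique[OF P' _ nz(2-4,1)] normal_form_gauge[OF Q nz(5)] by metis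
qed

text \<open>The leading coefficients are prescribed and the off-diagonal entries are linear, so two
  values suffice. The points 0 and 1 are chosen because there the cleared matrix is a multiple of
  \<open>A0\<close> and of \<open>A1\<close>.\<close>

lemma normal_form_eqI:
  assumes P: "normal_form th th' s d s1 d1 T l y w P" and Q: "normal_form th th' s' d' s1' d1' T' l' y' w' Q"
    and "P 0 = Q 0" "P 1 = Q 1"
  shows "P = Q"
proof -
  from P obtain a1 a0 b1 b0 g1 g0 where
    P: "\<And>x. P x = mat2 (th' * x\<^sup>2 + a1 * x + a0) (l * (x - y)) (g1 * x + g0) (th * x\<^sup>2 + b1 * x + b0)"
    unfolding normal_form_def by blast
  from Q obtain A1 A0 B1 B0 G1 G0 where
    Q: "\<And>x. Q x = mat2 (th' * x\<^sup>2 + A1 * x + A0) (l' * (x - y')) (G1 * x + G0) (th * x\<^sup>2 + B1 * x + B0)"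
    unfolding normal_form_def by blast
  from assms(3,4) have "a0 = A0" "b0 = B0" "g0 = G0" "a1 = A1" "b1 = B1" "g1 = G1" "l * y = l' * y'"
    "l * (1 - y) = l' * (1 - y')"
    by (auto simp: P Q)
  moreover from this have "l = l'" by (simp add: right_diff_distrib)
  ultimately show ?thesis by (intro ext) (simp add: P Q right_diff_distrib)
qed

definition cleared where
  "cleared t A0 A1 At x = ((x - 1) * (x - t)) \<odot> A0 + (x * (x - t)) \<odot> A1 + (x * (x - 1) / t) \<odot> At"

lemma cleared_at:
  "cleared t A0 A1 At 0 = t \<odot> A0" "cleared t A0 A1 At 1 = (1 - t) \<odot> A1"
  by (simp_all add: cleared_def vec_eq_iff)

lemma normal_form_cleared_inf:
  assumes P: "normal_form th th' s d s1 d1 T l y w (cleared t A0 A1 At)" and t: "t \<noteq> 0"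
  shows "A0 + A1 + (1 / t) \<odot> At = mat2 th' 0 0 th"
proof -
  from P obtain a1 a0 b1 b0 g1 g0 where
    P: "\<And>x. cleared t A0 A1 At x
      = mat2 (th' * x\<^sup>2 + a1 * x + a0) (l * (x - y)) (g1 * x + g0) (th * x\<^sup>2 + b1 * x + b0)"
    unfolding normal_form_def by blast
  obtain p11 p12 p21 p22 where A0: "A0 = mat2 p11 p12 p21 p22" by (rule mat2_cases)
  obtain q11 q12 q21 q22 where A1: "A1 = mat2 q11 q12 q21 q22" by (rule mat2_cases)
  obtain r11 r12 r21 r22 where At: "At = mat2 r11 r12 r21 r22" by (rule mat2_cases)
  have *: "a + b + c / t = k"
    if "\<And>x. (x - 1) * (x - t) * a + x * (x - t) * b + x * (x - 1) / t * c = k * x\<^sup>2 + m * x + n"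
    for a b c k m n :: complex
  proof (rule quad_coeffs(1))
    show "MOST x. (a + b + c / t) * x\<^sup>2 + (- (1 + t) * a - t * b - c / t) * x + t * a = k * x\<^sup>2 + m * x + n"
    proof (rule MOST_I)
      fix x
      have "(a + b + c / t) * x\<^sup>2 + (- (1 + t) * a - t * b - c / t) * x + t * a
          = (x - 1) * (x - t) * a + x * (x - t) * b + x * (x - 1) / t * c"
        using t by (simp add: field_simps power2_eq_square)
      then show "(a + b + c / t) * x\<^sup>2 + (- (1 + t) * a - t * b - c / t) * x + t * a = k * x\<^sup>2 + m * x + n"
        using that by simp
    qed
  qed
  have e: "mat2 ((x - 1) * (x - t) * p11 + x * (x - t) * q11 + x * (x - 1) / t * r11)
    ((x - 1) * (x - t) * p12 + x * (x - t) * q12 + x * (x - 1) / t * r12)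
    ((x - 1) * (x - t) * p21 + x * (x - t) * q21 + x * (x - 1) / t * r21)
    ((x - 1) * (x - t) * p22 + x * (x - t) * q22 + x * (x - 1) / t * r22) =
    mat2 (th' * x\<^sup>2 + a1 * x + a0) (0 * x\<^sup>2 + l * x + (- l * y)) (0 * x\<^sup>2 + g1 * x + g0)
      (th * x\<^sup>2 + b1 * x + b0)" for x
    using P[of x] by (simp add: cleared_def A0 A1 At algebra_simps)
  note e = e[unfolded mat2_eq_iff]
  have "p11 + q11 + r11 / t = th'" "p12 + q12 + r12 / t = 0"
    "p21 + q21 + r21 / t = 0" "p22 + q22 + r22 / t = th"
    by (rule *[of _ _ _ _ a1 a0] *[of _ _ _ 0 l "- l * y"] *[of _ _ _ 0 g1 g0] *[of _ _ _ _ b1 b0],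
        use e in blast)+
  then show ?thesis by (simp add: A0 A1 At)
qed

text \<open>The formula for B_0 arises by eliminating R between the factorisation at x = 0, that is
  t B A0 = d R, and at x = 1, that is (1 - t) (q + B) A1 = k (q diag(th', th) + R) with k = h(1).
  The weights of A0 and A1 in \<open>M1\<close> are those for which R cancels.\<close>

lemma connection_eq_BB0:
  fixes t a b th th' :: complex
  defines "k \<equiv> (t * a - 1) * (t * b - 1)"
  defines "M1 \<equiv> \<lambda>A0 A1. (1 / (a * b)) \<odot> A0 + (t * (t - 1) / k) \<odot> A1"
    and "M2 \<equiv> \<lambda>A1. mat2 th' 0 0 th + ((t - 1) / k) \<odot> A1"
  assumes P: "normal_form th th' s d s1 d1 T l y w (cleared t A0 A1 At)"
    and connection: "connection q th th' s d (cleared t A0 A1 At) B R"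
    and sd: "s = t * a + t * b" "d = t\<^sup>2 * a * b"
    and nz: "q \<noteq> 0" "t \<noteq> 0" "t \<noteq> 1" "a \<noteq> 0" "b \<noteq> 0" "k \<noteq> 0" "l \<noteq> 0" "w \<noteq> th' * (y\<^sup>2 - s * y + d)"
  shows "B = (- (q * t)) \<odot> (M2 A1 ** matrix_inv (M1 A0 A1))" and "det (M1 A0 A1) \<noteq> 0"
proof -
  obtain b11 b12 b21 b22 where B: "B = mat2 b11 b12 b21 b22" by (rule mat2_cases)
  obtain r11 r12 r21 r22 where R: "R = mat2 r11 r12 r21 r22" by (rule mat2_cases)
  obtain p11 p12 p21 p22 where A0: "A0 = mat2 p11 p12 p21 p22" by (rule mat2_cases)
  obtain q11 q12 q21 q22 where A1: "A1 = mat2 q11 q12 q21 q22" by (rule mat2_cases)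
  have E: "(mat (q * x) + B) ** cleared t A0 A1 At x =
     (x\<^sup>2 - s * x + d) \<odot> (mat2 (q * th' * x) 0 0 (q * th * x) + R)" for x
    using connection by (simp add: connection_def)
  have k: "1 - s + d = k" by (simp add: sd k_def power2_eq_square algebra_simps)
  have e0: "t \<odot> (B ** A0) = d \<odot> R"
    using E[of 0] by (simp add: cleared_at mat_eq_mat2 B A0 R algebra_simps)
  have e1: "(1 - t) \<odot> (B ** A1) = k \<odot> (mat2 (q * th') 0 0 (q * th) + R) - (q * (1 - t)) \<odot> A1"
    using E[of 1] unfolding k[symmetric] by (simp add: cleared_at mat_eq_mat2 B A1 R algebra_simps)
  have BM: "B ** M1 A0 A1 = (- (q * t)) \<odot> M2 A1"
  proof -
    have "B ** A0 = (t * a * b) \<odot> R"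
      using e0 nz by (simp add: B A0 R sd power2_eq_square mult.assoc)
    moreover have "B ** A1 = (k / (1 - t)) \<odot> (mat2 (q * th') 0 0 (q * th) + R) - q \<odot> A1"
      using e1 nz by (simp add: B A1 R field_simps)
    moreover have "B ** M1 A0 A1 = (1 / (a * b)) \<odot> (B ** A0) + (t * (t - 1) / k) \<odot> (B ** A1)"
      by (simp only: M1_def matrix_add_ldistrib mat_smult_mult)
    ultimately have *: "B ** M1 A0 A1 = (1 / (a * b)) \<odot> ((t * a * b) \<odot> R) +
       (t * (t - 1) / k) \<odot> ((k / (1 - t)) \<odot> (mat2 (q * th') 0 0 (q * th) + R) - q \<odot> A1)"
      by (simp only:)
    have c: "t * (t - 1) / k * (k / (1 - t)) = - t" "1 / (a * b) * (t * a * b) = t"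
      using nz by (simp_all add: divide_simps) (simp_all add: algebra_simps)?
    have r: "1 / (a * b) * (t * a * b * x) = t * x"
      "t * (t - 1) / k * (k / (1 - t) * x - q * z) = - t * x - q * t * ((t - 1) / k * z)" for x z
    proof -
      show "1 / (a * b) * (t * a * b * x) = t * x"
        using arg_cong[OF c(2), of "\<lambda>u. u * x"] by (simp only: mult.assoc)
      have "t * (t - 1) / k * (k / (1 - t) * x) = - t * x"
        using arg_cong[OF c(1), of "\<lambda>u. u * x"] by (simp only: mult.assoc)
      then show "t * (t - 1) / k * (k / (1 - t) * x - q * z) = - t * x - q * t * ((t - 1) / k * z)"
        by (simp only: right_diff_distrib [of _ "_ * x"]) (simp add: mult_ac)
    qed
    define m where "m = (t - 1) / k"
    show ?thesis
      unfolding * unfolding M2_def A1 R mat2_arith r mat2_eq_iff m_def[symmetric] by (simp add: algebra_simps)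
  qed
  \<comment> \<open>A vector v killed by \<open>M1\<close> is killed by \<open>M2\<close>, because
    \<open>B ** M1 A0 A1\<close> is a non-zero multiple of \<open>M2 A1\<close>. The two equations
    determine A0 v and A1 v in the first component, and make the first component of P(x) v equal to
    th' v_1 h(x). At x = y it is also w v_1, and w differs from th' h(y).\<close>
  have inv: "invertible (M1 A0 A1)"
    unfolding invertible_left_inverse matrix_left_invertible_ker
  proof (intro allI impI)
    fix v assume v: "M1 A0 A1 *v v = 0"
    have "(- (q * t)) \<odot> M2 A1 *v v = 0"
      unfolding BM[symmetric] by (simp add: v flip: matrix_vector_mul_assoc)
    then have "M2 A1 *v v = 0"
      using nz by (simp add: mat_smult_vector vector_mul_eq_0)
    then have m2: "th' * v $ 1 + (t - 1) / k * (q11 * v $ 1 + q12 * v $ 2) = 0"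
      by (simp add: M2_def A1 vec_eq_iff matrix_vector_mult_def sum_2 forall_2 algebra_simps)
    have m1: "1 / (a * b) * (p11 * v $ 1 + p12 * v $ 2) + t * (t - 1) / k * (q11 * v $ 1 + q12 * v $ 2) = 0"
      using v by (simp add: M1_def A0 A1 vec_eq_iff matrix_vector_mult_def sum_2 forall_2 add_divide_distrib algebra_simps)
    define p r where "p = p11 * v $ 1 + p12 * v $ 2" and "r = q11 * v $ 1 + q12 * v $ 2"
    note pr = p_def[symmetric] r_def[symmetric]
    have r: "(t - 1) * r = - (k * th' * v $ 1)"
      using m2 nz unfolding pr by (simp add: field_simps add_eq_0_iff)
    have "p = - (a * b * t * ((t - 1) / k * r))"
      using m1 nz unfolding pr by (simp add: field_simps add_eq_0_iff)
    also have "(t - 1) / k * r = - (th' * v $ 1)"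
      using m2 unfolding pr by (simp add: add_eq_0_iff)
    finally have p: "p = a * b * t * th' * v $ 1" by simp
    have inf: "(A0 + A1 + (1 / t) \<odot> At) $ 1 $ 1 = th'" "(A0 + A1 + (1 / t) \<odot> At) $ 1 $ 2 = 0"
      unfolding normal_form_cleared_inf[OF P nz(2)] by simp_all
    have at: "At $ 1 $ 1 / t = th' - p11 - q11" "At $ 1 $ 2 / t = - p12 - q12"
      using inf by (simp_all add: A0 A1 algebra_simps add_eq_0_iff)
    have main: "cleared t A0 A1 At x $ 1 $ 1 * v $ 1 + cleared t A0 A1 At x $ 1 $ 2 * v $ 2
        = th' * v $ 1 * (x\<^sup>2 - s * x + d)" for x
    proof -
      have "cleared t A0 A1 At x $ 1 $ 1 * v $ 1 + cleared t A0 A1 At x $ 1 $ 2 * v $ 2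
        = (x - 1) * (x - t) * p + x * (x - t) * r
          + x * (x - 1) * (At $ 1 $ 1 / t * v $ 1 + At $ 1 $ 2 / t * v $ 2)"
        by (simp add: cleared_def A0 A1 p_def r_def ring_distribs mult_ac)
      also have "\<dots> = (x - 1) * (x - t) * p + x * (x - t) * r + x * (x - 1) * (th' * v $ 1 - p - r)"
        unfolding at p_def r_def by (simp add: algebra_simps)
      also have "\<dots> = - ((x - 1) * t * p) - x * ((t - 1) * r) + x * (x - 1) * th' * v $ 1"
        by (simp add: algebra_simps)
      also have "\<dots> = th' * v $ 1 * (x\<^sup>2 - s * x + d)"
        unfolding r p k[symmetric] sd(2) by (simp add: power2_eq_square algebra_simps)
      finally show ?thesis .
    qed
    from P obtain a1 a0 b1 b0 g1 g0 where
      P: "\<And>x. cleared t A0 A1 At x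
        = mat2 (th' * x\<^sup>2 + a1 * x + a0) (l * (x - y)) (g1 * x + g0) (th * x\<^sup>2 + b1 * x + b0)"
      "th' * y\<^sup>2 + a1 * y + a0 = w"
      unfolding normal_form_def by blast
    have "w * v $ 1 = th' * v $ 1 * (y\<^sup>2 - s * y + d)"
      using main[of y] by (simp add: P)
    then have "(w - th' * (y\<^sup>2 - s * y + d)) * v $ 1 = 0"
      by (simp add: algebra_simps)
    then have v1: "v $ 1 = 0" using nz by simp
    have "l * v $ 2 = 0" using main[of "y + 1"] v1 by (simp add: P(1))
    then show "v = 0" using v1 nz by (simp add: vec_eq_iff forall_2)
  qed
  then obtain N where N: "M1 A0 A1 ** N = mat 1" unfolding invertible_def by blast
  have "B = B ** (M1 A0 A1 ** N)" by (simp add: N)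
  also have "\<dots> = ((- (q * t)) \<odot> M2 A1) ** N" by (simp only: matrix_mul_assoc BM)
  also have "\<dots> = (- (q * t)) \<odot> (M2 A1 ** N)"
    by (simp only: mat_smult_mult)
  finally show "B = (- (q * t)) \<odot> (M2 A1 ** matrix_inv (M1 A0 A1))"
    by (simp only: matrix_inv_eqI[OF N])
  show "det (M1 A0 A1) \<noteq> 0" using inv by (simp add: invertible_det_nz)
qed

text \<open>B A0 is a multiple of R, and (q + B) A1 of S(1). Hence the first two formulas are the
  values at x = 0 and x = 1 of the gauged next system, and these determine a normal form. The third
  formula only restates that the residues add up to diag(th', th).\<close>

lemma cond2_iff:
  fixes q t a b c th th' :: complex
  defines "C \<equiv> mat2 c 0 0 1"
  defines "k \<equiv> (t * a - 1) * (t * b - 1)" and "k' \<equiv> (q * t * a - 1) * (q * t * b - 1)"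
  assumes P: "normal_form th th' s d s1 d1 T l y w (cleared t A0 A1 At)"
    and P': "normal_form th th' s' d' s1' d1' T' l' y' w' (cleared (q * t) A0' A1' At')"
    and N: "normal_form th th' s'' d'' s1'' d1'' T'' l'' y'' w'' (next_system q th th' B R)"
    and connection: "connection q th th' s d (cleared t A0 A1 At) B R"
    and sd: "s = t * a + t * b" "d = t\<^sup>2 * a * b"
    and nz: "q \<noteq> 0" "t \<noteq> 0" "t \<noteq> 1" "q * t \<noteq> 1" "a \<noteq> 0" "b \<noteq> 0" "k \<noteq> 0" "k' \<noteq> 0" "c \<noteq> 0"
  shows "A0' = C ** B ** A0 ** matrix_inv B ** matrix_inv C \<and>
     A1' = ((t - 1) / (q * t - 1) * (k' / (q * (t * a - 1) * (t * b - 1)))) \<odot>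
       (C ** (mat q + B) ** A1 ** matrix_inv (mat 1 + B) ** matrix_inv C) \<and>
     At' = - (C ** B ** A0 ** (mat (1 / (a * b)) + (q * t) \<odot> matrix_inv B) ** matrix_inv C)
       - (t * (t - 1) / k) \<odot>
         (C ** (mat q + B) ** A1 ** (mat 1 + (k' / (q * t - 1)) \<odot> matrix_inv (mat 1 + B)) ** matrix_inv C)
   \<longleftrightarrow> cleared (q * t) A0' A1' At' = (\<lambda>x. gauge_by c (next_system q th th' B R x))"
    (is "A0' = ?r0 \<and> A1' = ?r1 \<and> At' = ?rt \<longleftrightarrow> ?key")
proof -
  obtain b11 b12 b21 b22 where B: "B = mat2 b11 b12 b21 b22" by (rule mat2_cases)
  obtain r11 r12 r21 r22 where R: "R = mat2 r11 r12 r21 r22" by (rule mat2_cases)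
  obtain p11 p12 p21 p22 where A0: "A0 = mat2 p11 p12 p21 p22" by (rule mat2_cases)
  obtain q11 q12 q21 q22 where A1: "A1 = mat2 q11 q12 q21 q22" by (rule mat2_cases)
  have E: "(mat (q * x) + B) ** cleared t A0 A1 At x =
     (x\<^sup>2 - s * x + d) \<odot> (mat2 (q * th' * x) 0 0 (q * th * x) + R)" for x
    using connection by (simp add: connection_def)
  have dt: "det (mat x + B) = x\<^sup>2 - q * s * x + q\<^sup>2 * d" for x
    using connection by (simp add: connection_def)
  have k: "1 - s + d = k" "1 - q * s + q\<^sup>2 * d = k'"
    by (simp_all add: sd k_def k'_def power2_eq_square algebra_simps)
  have "d \<noteq> 0" using nz by (simp add: sd)
  define S where "S = mat2 (q * th') 0 0 (q * th) + R"
  define adjB adjB1 where adj: "adjB = mat2 b22 (- b12) (- b21) b11" "adjB1 = mat2 (1 + b22) (- b12) (- b21) (1 + b11)"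
  have iB: "matrix_inv B = (1 / (q\<^sup>2 * d)) \<odot> adjB"
    using dt[of 0] \<open>d \<noteq> 0\<close> nz(1) unfolding B adj by (subst matrix_inv_mat2) (simp_all add: mat_eq_mat2)
  have iB1: "matrix_inv (mat 1 + B) = (1 / k') \<odot> adjB1"
    using dt[of 1] k(2) nz(8) unfolding B adj by (simp add: mat_eq_mat2) (subst matrix_inv_mat2, simp_all)
  have "t \<odot> (B ** A0) = d \<odot> R"
    using E[of 0] by (simp add: cleared_at mat_eq_mat2 B A0 R algebra_simps)
  then have BA: "B ** A0 = (t * a * b) \<odot> R"
    using nz by (simp add: B A0 R sd power2_eq_square mult.assoc)
  have "(1 - t) \<odot> ((mat q + B) ** A1) = k \<odot> S"
    using E[of 1] k(1) by (simp add: cleared_at mat_smult_mult S_def)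
  then have BA1: "(mat q + B) ** A1 = (k / (1 - t)) \<odot> S"
    using nz by (simp add: vec_eq_iff field_simps)
  define N0 N1 where N01: "N0 = next_system q th th' B R 0" "N1 = next_system q th th' B R 1"
  have N0: "R ** adjB = q \<odot> N0" and N1: "S ** adjB1 = q \<odot> N1"
    using nz(1) by (simp_all add: N01 next_system_def B R S_def adj)
  have g: "C ** k \<odot> M ** matrix_inv C = k \<odot> gauge_by c M" for k M
    by (simp add: gauge_by_def C_def mat_smult_mult)
  have r0: "?r0 = (1 / (q * t)) \<odot> gauge_by c N0"
  proof -
    have "?r0 = C ** ((B ** A0) ** matrix_inv B) ** matrix_inv C" by (simp only: matrix_mul_assoc)
    also have "(B ** A0) ** matrix_inv B = (t * a * b * (1 / (q\<^sup>2 * d)) * q) \<odot> N0"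
      unfolding BA iB mat_smult_mult N0 mat_smult_mat_smult by (simp add: mult_ac)
    also have "t * a * b * (1 / (q\<^sup>2 * d)) * q = 1 / (q * t)"
      unfolding sd using nz by (simp add: divide_simps power2_eq_square)
    finally show ?thesis unfolding g .
  qed
  have r1: "?r1 = (1 / (1 - q * t)) \<odot> gauge_by c N1"
  proof -
    have "?r1 = ((t - 1) / (q * t - 1) * (k' / (q * k))) \<odot> (C ** (((mat q + B) ** A1) ** matrix_inv (mat 1 + B)) ** matrix_inv C)"
      by (simp only: matrix_mul_assoc k_def mult.assoc)
    also have "((mat q + B) ** A1) ** matrix_inv (mat 1 + B) = (k / (1 - t) * (1 / k') * q) \<odot> N1"
      unfolding BA1 iB1 mat_smult_mult N1 mat_smult_mat_smult by (simp add: mult_ac)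
    finally have "?r1 = ((t - 1) / (q * t - 1) * (k' / (q * k)) * (k / (1 - t) * (1 / k') * q)) \<odot> gauge_by c N1"
      unfolding g mat_smult_mat_smult .
    also have "(t - 1) / (q * t - 1) * (k' / (q * k)) * (k / (1 - t) * (1 / k') * q) = 1 / (1 - q * t)"
      using nz by (simp add: divide_simps) (simp add: algebra_simps)
    finally show ?thesis .
  qed
  have rt: "?rt = (q * t) \<odot> (mat2 th' 0 0 th - ?r0 - ?r1)"
  proof -
    have "C ** B ** A0 ** (mat (1 / (a * b)) + (q * t) \<odot> matrix_inv B) ** matrix_inv C =
      C ** ((B ** A0) ** (mat (1 / (a * b)) + (q * t) \<odot> matrix_inv B)) ** matrix_inv C"
      by (simp only: matrix_mul_assoc)
    also have "(B ** A0) ** (mat (1 / (a * b)) + (q * t) \<odot> matrix_inv B) = t \<odot> R + N0"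
    proof -
      have "(B ** A0) ** (mat (1 / (a * b)) + (q * t) \<odot> matrix_inv B)
          = (1 / (a * b)) \<odot> (B ** A0) + (q * t * (t * a * b) * (1 / (q\<^sup>2 * d)) * q) \<odot> N0"
        unfolding iB matrix_add_ldistrib mat_smult_mult mat_smult_mat_smult
        by (simp add: BA mult_mat_eq mat_smult_mult N0 mat_smult_mat_smult mult_ac)
      also have "q * t * (t * a * b) * (1 / (q\<^sup>2 * d)) * q = 1"
        unfolding sd using nz by (simp add: divide_simps power2_eq_square)
      also have "(1 / (a * b)) \<odot> (B ** A0) = t \<odot> R"
        unfolding BA mat_smult_mat_smult using nz by simp
      finally show ?thesis by (simp add: vec_eq_iff)
    qed
    finally have 1: "C ** B ** A0 ** (mat (1 / (a * b)) + (q * t) \<odot> matrix_inv B) ** matrix_inv C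
      = C ** (t \<odot> R + N0) ** matrix_inv C" .
    have "C ** (mat q + B) ** A1 ** (mat 1 + (k' / (q * t - 1)) \<odot> matrix_inv (mat 1 + B)) ** matrix_inv C
      = C ** (((mat q + B) ** A1) ** (mat 1 + (k' / (q * t - 1)) \<odot> matrix_inv (mat 1 + B))) ** matrix_inv C"
      by (simp only: matrix_mul_assoc)
    also have "((mat q + B) ** A1) ** (mat 1 + (k' / (q * t - 1)) \<odot> matrix_inv (mat 1 + B))
      = (k / (1 - t)) \<odot> (S + (q / (q * t - 1)) \<odot> N1)"
    proof -
      have "S ** (mat 1 + (k' / (q * t - 1)) \<odot> matrix_inv (mat 1 + B)) = S + (k' / (q * t - 1) * (1 / k') * q) \<odot> N1"
        unfolding iB1 matrix_add_ldistrib mat_smult_mult mat_smult_mat_smult N1 by (simp add: mult_ac)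
      also have "k' / (q * t - 1) * (1 / k') * q = q / (q * t - 1)" using nz by simp
      finally show ?thesis unfolding BA1 mat_smult_mult by simp
    qed
    finally have 2: "(t * (t - 1) / k) \<odot>
         (C ** (mat q + B) ** A1 ** (mat 1 + (k' / (q * t - 1)) \<odot> matrix_inv (mat 1 + B)) ** matrix_inv C)
      = (t * (t - 1) / k * (k / (1 - t))) \<odot> gauge_by c (S + (q / (q * t - 1)) \<odot> N1)"
      by (simp only: g mat_smult_mat_smult)
    have 3: "t * (t - 1) / k * (k / (1 - t)) = - t"
      using nz by (simp add: divide_simps) (simp add: algebra_simps)
    obtain m11 m12 m21 m22 where N0: "N0 = mat2 m11 m12 m21 m22" by (rule mat2_cases)
    obtain n11 n12 n21 n22 where N1: "N1 = mat2 n11 n12 n21 n22" by (rule mat2_cases)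
    have 4: "q / (q * t - 1) = - (q / (1 - q * t))" by (simp add: minus_divide_right)
    define m where "m = 1 / (1 - q * t)"
    have m: "q / (1 - q * t) = q * m" by (simp add: m_def)
    have 5: "C ** M ** matrix_inv C = gauge_by c M" for M by (simp add: gauge_by_def C_def)
    show ?thesis
      unfolding 1 2 3 5 r0 r1 N0 N1 R S_def 4 m m_def[symmetric]
      using nz by (simp add: right_diff_distrib) (simp add: algebra_simps add_divide_distrib diff_divide_distrib)
  qed
  have i': "A0' + A1' + (1 / (q * t)) \<odot> At' = mat2 th' 0 0 th"
    using normal_form_cleared_inf[OF P'] nz by simp
  have at': "At' = (q * t) \<odot> (mat2 th' 0 0 th - A0' - A1')"
    unfolding i'[symmetric] using nz by (simp add: vec_eq_iff)
  have key: "?key \<longleftrightarrow> (q * t) \<odot> A0' = gauge_by c N0 \<and> (1 - q * t) \<odot> A1' = gauge_by c N1"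
  proof
    assume ?key
    from fun_cong[OF this, of 0] fun_cong[OF this, of 1]
    show "(q * t) \<odot> A0' = gauge_by c N0 \<and> (1 - q * t) \<odot> A1' = gauge_by c N1"
      by (simp add: cleared_at N01)
  next
    assume *: "(q * t) \<odot> A0' = gauge_by c N0 \<and> (1 - q * t) \<odot> A1' = gauge_by c N1"
    show ?key
      by (rule normal_form_eqI[OF P' normal_form_gauge[OF N nz(9)]]) (use * in \<open>simp_all add: cleared_at N01\<close>)
  qed
  have "(q * t) \<odot> A0' = gauge_by c N0 \<longleftrightarrow> A0' = (1 / (q * t)) \<odot> gauge_by c N0"
    "(1 - q * t) \<odot> A1' = gauge_by c N1 \<longleftrightarrow> A1' = (1 / (1 - q * t)) \<odot> gauge_by c N1"
    using nz by (auto simp: vec_eq_iff field_simps)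
  then show ?thesis
    unfolding key rt using r0 r1 at' by metis
qed

section \<open>Rational intertwiners\<close>

definition cont_mat :: "(complex \<Rightarrow> complex^2^2) \<Rightarrow> bool" where
  "cont_mat M \<longleftrightarrow> (\<forall>i j. continuous_on UNIV (\<lambda>x. M x $ i $ j))"

lemma cont_mat_mat2:
  assumes "continuous_on UNIV a" "continuous_on UNIV b" "continuous_on UNIV c" "continuous_on UNIV d"
  shows "cont_mat (\<lambda>x. mat2 (a x) (b x) (c x) (d x))"
  using assms by (simp add: cont_mat_def forall_2)

lemma cont_mat_mult: "cont_mat M \<Longrightarrow> cont_mat N \<Longrightarrow> cont_mat (\<lambda>x. M x ** N x)"
  unfolding cont_mat_def matrix_matrix_mult_def
  by (auto intro!: continuous_on_sum continuous_on_mult)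

lemma cont_mat_adj2: "cont_mat M \<Longrightarrow> cont_mat (\<lambda>x. adj2 (M x))"
  unfolding adj2_def by (rule cont_mat_mat2) (auto simp: cont_mat_def intro!: continuous_on_minus)

lemma cont_mat_smult: "cont_mat M \<Longrightarrow> continuous_on UNIV f \<Longrightarrow> cont_mat (\<lambda>x. f x \<odot> M x)"
  unfolding cont_mat_def by (auto intro!: continuous_on_mult)

lemma MOST_cont_eq:
  fixes f g :: "complex \<Rightarrow> complex"
  assumes "MOST x. f x = g x" "continuous_on UNIV f" "continuous_on UNIV g"
  shows "f x = g x"
proof -
  have "open {x. f x \<noteq> g x}" using assms(2,3) by (rule open_Collect_neq)
  moreover have "finite {x. f x \<noteq> g x}" using assms(1) by (simp add: eventually_cofinite)
  ultimately have "{x. f x \<noteq> g x} = {}" using finite_imp_not_open by blast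
  then show ?thesis by blast
qed

lemma MOST_cont_mat_eq:
  assumes "MOST x. M x = N x" "cont_mat M" "cont_mat N"
  shows "M x = N x"
proof -
  have "M x $ i $ j = N x $ i $ j" for i j
  proof (rule MOST_cont_eq [of "\<lambda>x. M x $ i $ j" "\<lambda>x. N x $ i $ j"])
    show "MOST x. M x $ i $ j = N x $ i $ j" using assms(1) by eventually_elim simp
  qed (use assms(2,3) in \<open>auto simp: cont_mat_def\<close>)
  then show ?thesis by (simp add: vec_eq_iff)
qed

definition eval_mat :: "complex poly^2^2 \<Rightarrow> complex \<Rightarrow> complex^2^2" where
  "eval_mat F x = (\<chi> i j. poly (F $ i $ j) x)"

lemma eval_mat_nth [simp]: "eval_mat F x $ i $ j = poly (F $ i $ j) x"
  by (simp add: eval_mat_def)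

lemma cont_mat_eval_mat:
  assumes "continuous_on UNIV f"
  shows "cont_mat (\<lambda>x. eval_mat F (f x))"
  using assms by (auto simp: cont_mat_def intro!: continuous_intros)

lemma cont_mat_normal_form:
  assumes "normal_form th th' s d s1 d1 T l y w P"
  shows "cont_mat P"
proof -
  from assms obtain a1 a0 b1 b0 g1 g0 where
    P: "\<And>x. P x = mat2 (th' * x\<^sup>2 + a1 * x + a0) (l * (x - y)) (g1 * x + g0) (th * x\<^sup>2 + b1 * x + b0)"
    unfolding normal_form_def by blast
  then have "P = (\<lambda>x. mat2 (th' * x\<^sup>2 + a1 * x + a0) (l * (x - y)) (g1 * x + g0) (th * x\<^sup>2 + b1 * x + b0))" ..
  then show ?thesis by (auto intro!: cont_mat_mat2 continuous_intros)
qed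

text \<open>A non-zero root lies in a finite string \<open>a, q a, q\<^sup>2 a, \<dots>\<close> of roots; both ends of the string
  lie on \<open>q\<close>-translates of \<open>Z\<close>, in the wrong order.\<close>

lemma no_root_chain:
  fixes G :: "complex poly"
  assumes "G \<noteq> 0" and q: "q \<noteq> 0" "\<And>n::nat. n > 0 \<Longrightarrow> q ^ n \<noteq> 1"
    and NR: "\<And>n u v. n > 0 \<Longrightarrow> u \<in> Z \<Longrightarrow> v \<in> Z \<Longrightarrow> q ^ n * u \<noteq> v"
    and down: "\<And>a. poly G a = 0 \<Longrightarrow> (\<exists>n>0. \<exists>u\<in>Z. a = q ^ n * u) \<or> poly G (a / q) = 0"
    and up: "\<And>a. poly G a = 0 \<Longrightarrow> a \<in> Z \<or> poly G (q * a) = 0"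
    and a: "poly G a = 0"
  shows "a = 0"
proof (rule ccontr)
  assume a0: "a \<noteq> 0"
  have fin: "finite {x. poly G x = 0}" using \<open>G \<noteq> 0\<close> by (rule poly_roots_finite)
  have qinj: "m = n" if "q ^ m = q ^ n" for m n :: nat
  proof (rule ccontr)
    assume "m \<noteq> n"
    moreover have "q ^ (j - i) = 1" if "q ^ i = q ^ j" "i < j" for i j :: nat
      using that q(1) by (simp add: power_diff)
    ultimately show False using \<open>q ^ m = q ^ n\<close> q(2) by (metis linorder_neqE_nat zero_less_diff)
  qed
  have "\<exists>n>0. \<exists>u\<in>Z. a = q ^ n * u"
  proof (rule ccontr)
    assume no: "\<not> ?thesis"
    have "poly G (a / q ^ m) = 0" for m
    proof (induction m)
      case (Suc m)
      have "\<not> (\<exists>n>0. \<exists>u\<in>Z. a / q ^ m = q ^ n * u)"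
      proof
        assume "\<exists>n>0. \<exists>u\<in>Z. a / q ^ m = q ^ n * u"
        then obtain n u where "n > 0" "u \<in> Z" "a / q ^ m = q ^ n * u" by blast
        then have "a = q ^ (n + m) * u" using q by (simp add: field_simps power_add)
        with \<open>n > 0\<close> \<open>u \<in> Z\<close> no show False by (metis add_gr_0)
      qed
      with down[OF Suc] have "poly G (a / q ^ m / q) = 0" by blast
      then show ?case by (simp add: mult.commute)
    qed (use a in simp)
    then have "range (\<lambda>m. a / q ^ m) \<subseteq> {x. poly G x = 0}" by auto
    moreover have "inj (\<lambda>m. a / q ^ m)"
      using a0 q(1) by (intro injI qinj) (simp add: field_simps)
    ultimately show False using fin finite_subset finite_imageD by blast
  qed
  then obtain n u where nu: "n > 0" "u \<in> Z" "a = q ^ n * u" by blast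
  have "\<exists>m. q ^ m * a \<in> Z"
  proof (rule ccontr)
    assume no: "\<not> ?thesis"
    have "poly G (q ^ m * a) = 0" for m
    proof (induction m)
      case (Suc m)
      then show ?case using up[OF Suc] no by (simp add: mult.assoc)
    qed (use a in simp)
    then have "range (\<lambda>m. q ^ m * a) \<subseteq> {x. poly G x = 0}" by auto
    moreover have "inj (\<lambda>m. q ^ m * a)"
      using a0 by (intro injI qinj) simp
    ultimately show False using fin finite_subset finite_imageD by blast
  qed
  then obtain m where "q ^ m * a \<in> Z" ..
  with nu NR[of "m + n" u "q ^ m * a"] show False by (simp add: power_add mult.assoc)
qed

text \<open>Coprime quadratics: the first one, h, divides h' times the cubic, hence the cubic, and
  the explicit quotient is wanted. The remainder W of degree at most 1 satisfies (h' - h) W = h r,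
  so r is constant by degree. If r is not 0, then h' - h has degree 1 and its root is a common root
  of h and h'. The argument also covers a double root of h.\<close>

lemma quad_dvd_cubic:
  fixes e3 :: complex
  assumes nr: "\<forall>x. x\<^sup>2 - s * x + d = 0 \<longrightarrow> x\<^sup>2 - s' * x + d' \<noteq> 0"
    and eq: "\<And>x. (x\<^sup>2 - s * x + d) * poly p x = (x\<^sup>2 - s' * x + d') * (e3 * x^3 + e2 * x\<^sup>2 + e1 * x + e0)"
  shows "e3 * x^3 + e2 * x\<^sup>2 + e1 * x + e0 = (x\<^sup>2 - s * x + d) * (e3 * x + (e2 + s * e3))"
proof -
  define h h' where h: "h = [:d, - s, 1:]" "h' = [:d', - s', 1:]"
  have ph: "poly h x = x\<^sup>2 - s * x + d" "poly h' x = x\<^sup>2 - s' * x + d'" for x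
    by (simp_all add: h power2_eq_square algebra_simps)
  define W where "W = [:e0 - d * (e2 + s * e3), e1 - d * e3 + s * (e2 + s * e3):]"
  have W: "e3 * x^3 + e2 * x\<^sup>2 + e1 * x + e0 = (x\<^sup>2 - s * x + d) * (e3 * x + (e2 + s * e3)) + poly W x" for x
    by (simp add: W_def power2_eq_square power3_eq_cube algebra_simps)
  have hW: "h' * W = h * (p - h' * [:e2 + s * e3, e3:])"
  proof (rule poly_eq_MOST[THEN iffD1], rule MOST_I)
    fix x
    show "poly (h' * W) x = poly (h * (p - h' * [:e2 + s * e3, e3:])) x"
      using eq[of x] unfolding W by (simp add: ph algebra_simps)
  qed
  define r L where "r = p - h' * [:e2 + s * e3, e3:] - W" and "L = h' - h"
  have LW: "L * W = h * r"
    unfolding r_def L_def left_diff_distrib hW by (simp only: right_diff_distrib)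
  have h0: "h \<noteq> 0" "degree h = 2" by (simp_all add: h)
  have "degree (L * W) \<le> 2"
    by (rule order_trans[OF degree_mult_le]) (simp add: L_def h W_def)
  have "W = 0"
  proof (cases "r = 0")
    case True
    obtain \<rho> where \<rho>: "poly h \<rho> = 0" using alg_closed_imp_poly_has_root[of h] h0 by auto
    then have "poly h' \<rho> \<noteq> 0" using nr by (simp add: ph)
    then have "L \<noteq> 0" using \<rho> by (auto simp: L_def)
    then show ?thesis using LW True by simp
  next
    case False
    then have "degree (L * W) = 2 + degree r" using h0 by (simp add: LW degree_mult_eq)
    then have LW2: "degree (L * W) = 2" and "degree r = 0" using \<open>degree (L * W) \<le> 2\<close> by simp_all
    then obtain k where k: "r = [:k:]" by (auto elim: degree_eq_zeroE)
    have "degree W \<le> 1" by (simp add: W_def)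
    then have "degree L \<noteq> 0" using LW2 degree_mult_le[of L W] by linarith
    then have "s \<noteq> s'" by (auto simp: L_def h)
    define \<rho> where "\<rho> = (d' - d) / (s' - s)"
    have "poly L \<rho> = 0" using \<open>s \<noteq> s'\<close> by (simp add: L_def h \<rho>_def field_simps)
    have "poly (h * r) \<rho> = 0" unfolding LW[symmetric] using \<open>poly L \<rho> = 0\<close> by simp
    moreover have "poly r \<rho> \<noteq> 0" using False unfolding k by simp
    ultimately have "poly h \<rho> = 0" by simp
    moreover from this have "poly h' \<rho> = 0" using \<open>poly L \<rho> = 0\<close> by (simp add: L_def)
    ultimately show ?thesis using nr by (simp add: ph)
  qed
  then show ?thesis using W[of x] by simp
qed

lemma coeff_mult_le_degree:
  assumes "degree p \<le> m" "degree r \<le> n"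
  shows "coeff (p * r) (m + n) = coeff p m * coeff r n"
proof -
  have "coeff (p * r) (m + n) = (\<Sum>i\<le>m + n. coeff p i * coeff r (m + n - i))"
    by (rule coeff_mult)
  also have "\<dots> = (\<Sum>i\<in>{m}. coeff p i * coeff r (m + n - i))"
  proof (rule sum.mono_neutral_right)
    show "\<forall>i\<in>{..m + n} - {m}. coeff p i * coeff r (m + n - i) = 0"
    proof
      fix i assume "i \<in> {..m + n} - {m}"
      then have "i > m \<or> m + n - i > n" by auto
      then show "coeff p i * coeff r (m + n - i) = 0"
        using assms by (auto simp: coeff_eq_0)
    qed
  qed auto
  finally show ?thesis by simp
qed

text \<open>The situation at one value of t: \<open>u1\<close>, \<open>u2\<close> are t times
  \<Theta>_t and its companion, \<open>v1\<close>, \<open>v2\<close> belong to x = 1, and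
  \<open>e1\<close>, \<open>e2\<close> are the eigenvalues of P(0) = t A_0; P' is P at q t. The
  three non-resonance assumptions serve three places: \<open>NR\<close> the non-zero poles,
  \<open>NR0\<close> the pole at 0, \<open>NRi\<close> the degree at infinity.\<close>

locale intertwiner =
  fixes q th th' u1 u2 v1 v2 e1 e2 l y w l' y' w' :: complex
    and P P' :: "complex \<Rightarrow> complex^2^2"
  assumes P: "normal_form th th' (u1 + u2) (u1 * u2) (v1 + v2) (v1 * v2) (e1 + e2) l y w P"
    and P': "normal_form th th' (q * (u1 + u2)) (q\<^sup>2 * (u1 * u2)) (v1 + v2) (v1 * v2) (q * (e1 + e2)) l' y' w' P'"
    and q: "q \<noteq> 0" "\<And>n::nat. n > 0 \<Longrightarrow> q ^ n \<noteq> 1"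
    and nz: "th \<noteq> 0" "th' \<noteq> 0" "u1 \<noteq> 0" "u2 \<noteq> 0" "v1 \<noteq> 0" "v2 \<noteq> 0" "th \<noteq> th'"
    and e: "e1 * e2 = th * th' * (u1 * u2) * (v1 * v2)"
    and NR: "\<And>n a b. n > 0 \<Longrightarrow> a \<in> {u1, u2, v1, v2} \<Longrightarrow> b \<in> {u1, u2, v1, v2} \<Longrightarrow> q ^ n * a \<noteq> b"
    and NR0: "\<And>n a b. n > 0 \<Longrightarrow> a \<in> {e1, e2} \<Longrightarrow> b \<in> {e1, e2} \<Longrightarrow> q ^ n * a \<noteq> b"
    and NRi: "\<And>n a b. n > 0 \<Longrightarrow> a \<in> {th, th'} \<Longrightarrow> b \<in> {th, th'} \<Longrightarrow> q ^ n * a \<noteq> b"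
begin

abbreviation h :: "complex \<Rightarrow> complex" where "h x \<equiv> x\<^sup>2 - (u1 + u2) * x + u1 * u2"
abbreviation h' :: "complex \<Rightarrow> complex" where "h' x \<equiv> x\<^sup>2 - q * (u1 + u2) * x + q\<^sup>2 * (u1 * u2)"
abbreviation p1 :: "complex \<Rightarrow> complex" where "p1 x \<equiv> x\<^sup>2 - (v1 + v2) * x + v1 * v2"

lemma h_factor: "h x = (x - u1) * (x - u2)" "h' x = (x - q * u1) * (x - q * u2)" "p1 x = (x - v1) * (x - v2)"
  by (simp_all add: power2_eq_square algebra_simps)

lemma det_P: "det (P x) = th * th' * h x * p1 x"
  using P unfolding normal_form_def by blast

lemma det_P': "det (P' x) = th * th' * h' x * p1 x"
  using P' unfolding normal_form_def by blast

lemma MOST_h: "MOST x. h x \<noteq> 0"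
  by (rule MOST_quad_nz)

lemma MOST_h': "MOST x. h' x \<noteq> 0"
  using MOST_quad_nz[of "q * (u1 + u2)" "q\<^sup>2 * (u1 * u2)"] .

text \<open>F / G stands for h'(x) \<BB>(x) / (x - q t). The equation is the isomonodromy relation
  cleared of denominators, with the identity h'(q x) = q^2 h(x) used once.\<close>

definition solves :: "complex poly^2^2 \<Rightarrow> complex poly \<Rightarrow> bool" where
  "solves F G \<longleftrightarrow> G \<noteq> 0 \<and> \<not> (MOST x. det (eval_mat F x) = 0) \<and>
    (\<forall>x. (q * h x * poly G (q * x)) \<odot> (P' x ** eval_mat F x) = (h' x * poly G x) \<odot> (eval_mat F (q * x) ** P x))"

lemmas cont_mats = cont_mat_normal_form[OF P] cont_mat_normal_form[OF P'] cont_mat_eval_mat cont_mat_adj2 cont_mat_mult cont_mat_smult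

lemma solvesI:
  assumes "G \<noteq> 0" "\<not> (MOST x. det (eval_mat F x) = 0)"
    "MOST x. (q * h x * poly G (q * x)) \<odot> (P' x ** eval_mat F x) = (h' x * poly G x) \<odot> (eval_mat F (q * x) ** P x)"
  shows "solves F G"
proof -
  have "(q * h x * poly G (q * x)) \<odot> (P' x ** eval_mat F x) = (h' x * poly G x) \<odot> (eval_mat F (q * x) ** P x)" for x
    by (rule MOST_cont_mat_eq[OF assms(3)]) (intro cont_mats continuous_intros)+
  then show ?thesis using assms(1,2) by (simp add: solves_def)
qed

text \<open>Since det P = th th' h p1, multiplication by adj P produces a factor h that cancels the
  one on the left. Only the zeros of h' p1 can then start a string of poles;
  \<open>solves_left\<close> cancels h' in the same way at the other end, where the zeros of h p1
  remain.\<close>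

lemma solves_right:
  assumes "solves F G"
  shows "(q * poly G (q * x)) \<odot> (P' x ** eval_mat F x ** adj2 (P x)) = (th * th' * h' x * p1 x * poly G x) \<odot> eval_mat F (q * x)"
proof -
  have *: "MOST x. (q * poly G (q * x)) \<odot> (P' x ** eval_mat F x ** adj2 (P x)) = (th * th' * h' x * p1 x * poly G x) \<odot> eval_mat F (q * x)"
    using MOST_h
  proof eventually_elim
    case (elim x)
    have "(q * h x * poly G (q * x)) \<odot> (P' x ** eval_mat F x ** adj2 (P x))
      = (h' x * poly G x) \<odot> (eval_mat F (q * x) ** (P x ** adj2 (P x)))"
      using assms by (simp add: solves_def mat_smult_mult(1)[symmetric] matrix_mul_assoc)
    also have "\<dots> = (h' x * poly G x * det (P x)) \<odot> eval_mat F (q * x)"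
      by (simp only: mult_adj2 mult_mat_eq mat_smult_mat_smult)
    finally have e: "(q * h x * poly G (q * x)) \<odot> (P' x ** eval_mat F x ** adj2 (P x)) =
      (h' x * poly G x * det (P x)) \<odot> eval_mat F (q * x)" .
    have "h x * (q * poly G (q * x) * (P' x ** eval_mat F x ** adj2 (P x)) $ i $ j)
       = h x * (th * th' * h' x * p1 x * poly G x * eval_mat F (q * x) $ i $ j)" for i j
      using arg_cong[OF e, of "\<lambda>M. M $ i $ j"] by (simp add: det_P mult_ac)
    then show ?case using elim by (simp add: vec_eq_iff)
  qed
  show ?thesis by (rule MOST_cont_mat_eq[OF *]) (intro cont_mats continuous_intros)+
qed

lemma solves_left:
  assumes "solves F G"
  shows "(q * th * th' * h x * p1 x * poly G (q * x)) \<odot> eval_mat F x = poly G x \<odot> (adj2 (P' x) ** eval_mat F (q * x) ** P x)"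
proof -
  have *: "MOST x. (q * th * th' * h x * p1 x * poly G (q * x)) \<odot> eval_mat F x = poly G x \<odot> (adj2 (P' x) ** eval_mat F (q * x) ** P x)"
    using MOST_h'
  proof eventually_elim
    case (elim x)
    have "(q * h x * poly G (q * x)) \<odot> ((adj2 (P' x) ** P' x) ** eval_mat F x)
      = adj2 (P' x) ** ((q * h x * poly G (q * x)) \<odot> (P' x ** eval_mat F x))"
      by (simp add: mat_smult_mult matrix_mul_assoc)
    also have "\<dots> = (h' x * poly G x) \<odot> (adj2 (P' x) ** eval_mat F (q * x) ** P x)"
      using assms by (simp add: solves_def mat_smult_mult matrix_mul_assoc)
    finally have e: "(q * h x * poly G (q * x)) \<odot> ((adj2 (P' x) ** P' x) ** eval_mat F x) =
      (h' x * poly G x) \<odot> (adj2 (P' x) ** eval_mat F (q * x) ** P x)" .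
    have "h' x * (q * th * th' * h x * p1 x * poly G (q * x) * eval_mat F x $ i $ j)
       = h' x * (poly G x * (adj2 (P' x) ** eval_mat F (q * x) ** P x) $ i $ j)" for i j
      using arg_cong[OF e, of "\<lambda>M. M $ i $ j"] by (simp add: det_P' mult_adj2 mat_mult_eq mult_ac)
    then show ?case using elim by (simp add: vec_eq_iff)
  qed
  show ?thesis by (rule MOST_cont_mat_eq[OF *]) (intro cont_mats continuous_intros)+
qed

lemma solves_cancel_root:
  assumes "solves F G" "poly G a = 0" "\<And>i j. poly (F $ i $ j) a = 0"
  obtains F' G' where "solves F' G'" "degree G' < degree G"
proof -
  define F' where "F' = (\<chi> i j. F $ i $ j div [:- a, 1:])"
  define G' where "G' = G div [:- a, 1:]"
  have F: "F $ i $ j = [:- a, 1:] * F' $ i $ j" for i j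
    using assms(3)[of i j] unfolding F'_def poly_eq_0_iff_dvd vec_lambda_beta by (rule dvd_mult_div_cancel[symmetric])
  have G: "G = [:- a, 1:] * G'"
    using assms(2) unfolding G'_def poly_eq_0_iff_dvd by (rule dvd_mult_div_cancel[symmetric])
  have "G \<noteq> 0" using assms(1) by (simp add: solves_def)
  then have "G' \<noteq> 0" using G by auto
  then have deg: "degree G' < degree G" unfolding G by (subst degree_mult_eq) auto
  have evF: "eval_mat F x = (x - a) \<odot> eval_mat F' x" for x
    by (simp add: vec_eq_iff F ring_distribs)
  have "solves F' G'"
  proof (rule solvesI)
    show "\<not> (MOST x. det (eval_mat F' x) = 0)"
    proof
      assume "MOST x. det (eval_mat F' x) = 0"
      then have "MOST x. det (eval_mat F x) = 0"
        by eventually_elim (simp add: evF det_2 algebra_simps power2_eq_square)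
      then show False using assms(1) by (simp add: solves_def)
    qed
    have "MOST x. x \<noteq> a" "MOST x. x \<noteq> a / q" by simp_all
    then show "MOST x. (q * h x * poly G' (q * x)) \<odot> (P' x ** eval_mat F' x) = (h' x * poly G' x) \<odot> (eval_mat F' (q * x) ** P x)"
    proof eventually_elim
      case (elim x)
      then have "q * x \<noteq> a" using q(1) by auto
      with elim have nz: "(x - a) * (q * x - a) \<noteq> 0" by simp
      have *: "(q * h x * poly G (q * x)) \<odot> (P' x ** eval_mat F x) = (h' x * poly G x) \<odot> (eval_mat F (q * x) ** P x)"
        using assms(1) unfolding solves_def by blast
      have "((x - a) * (q * x - a)) * ((q * h x * poly G' (q * x)) * (P' x ** eval_mat F' x) $ i $ j)
        = ((x - a) * (q * x - a)) * ((h' x * poly G' x) * (eval_mat F' (q * x) ** P x) $ i $ j)" for i j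
        using arg_cong[OF *[unfolded evF mat_smult_mult], of "\<lambda>M. M $ i $ j"] by (simp add: G algebra_simps)
      then show ?case using nz by (simp add: vec_eq_iff)
    qed
  qed fact
  with deg show ?thesis using that by blast
qed

text \<open>Reduction to lowest terms: afterwards every root of the denominator is a true pole of
  some entry. A linear factor common to G and all entries of F can be divided out because the
  relation is homogeneous in the fraction F / G.\<close>

lemma solves_lowest:
  assumes "solves F G"
  obtains F' G' where "solves F' G'" "\<And>a. poly G' a = 0 \<Longrightarrow> \<exists>i j. poly (F' $ i $ j) a \<noteq> 0"
  using assms
proof (induction "degree G" arbitrary: F G thesis rule: less_induct)
  case less
  show ?case
  proof (cases "\<exists>a. poly G a = 0 \<and> (\<forall>i j. poly (F $ i $ j) a = 0)")
    case True
    then show ?thesis using solves_cancel_root less by metis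
  next
    case False
    then show ?thesis using less by blast
  qed
qed

end

text \<open>S may be singular, so X and Y need not be similar; still they share an eigenvalue. By
  Cayley-Hamilton (Y - e1) (Y - e2) = 0, hence (X - e1) (X - e2) kills S on the left and cannot be
  invertible.\<close>

lemma intertwined_eigenvalue:
  fixes X S Y :: "complex^2^2"
  assumes XS: "X ** S = S ** Y" and "S \<noteq> 0"
    and Y: "Y $ 1 $ 1 + Y $ 2 $ 2 = e1 + e2" "det Y = e1 * e2"
  shows "det (X - mat e1) = 0 \<or> det (X - mat e2) = 0"
proof -
  define Q where "Q = (X - mat e1) ** (X - mat e2)"
  have sub: "(X - mat e) ** S = S ** (Y - mat e)" for e
    by (simp add: matrix_diff_distrib XS mult_mat_eq mat_mult_eq)
  have "(Y - mat e1) ** (Y - mat e2) = 0"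
  proof -
    obtain a b c d where Y': "Y = mat2 a b c d" by (rule mat2_cases)
    have 1: "a + d = e1 + e2" "a * d - b * c = e1 * e2" using Y by (simp_all add: Y')
    show ?thesis
      unfolding Y' mat_eq_mat2 mat2_arith mat2_mult by (rule mat2_eqI; simp; use 1 in algebra)
  qed
  moreover have "Q ** S = (X - mat e1) ** ((X - mat e2) ** S)"
    by (simp only: Q_def matrix_mul_assoc)
  then have "Q ** S = ((X - mat e1) ** S) ** (Y - mat e2)"
    by (simp only: sub[of e2] matrix_mul_assoc)
  then have "Q ** S = S ** ((Y - mat e1) ** (Y - mat e2))"
    by (simp only: sub[of e1] matrix_mul_assoc)
  ultimately have "Q ** S = 0" by simp
  have "det Q \<odot> S = 0"
    using arg_cong[OF \<open>Q ** S = 0\<close>, of "\<lambda>M. adj2 Q ** M"]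
    by (simp add: matrix_mul_assoc mult_adj2 mat_mult_eq)
  then have "det Q = 0" using \<open>S \<noteq> 0\<close> by (auto simp: vec_eq_iff)
  then show ?thesis by (simp add: Q_def det_mul)
qed

lemma poly_no_root_const:
  assumes "\<And>x. poly G x \<noteq> (0 :: complex)"
  obtains g where "G = [:g:]" "g \<noteq> 0"
proof -
  have "degree G = 0" using alg_closed_imp_poly_has_root[of G] assms by blast
  then obtain g where "G = [:g:]" by (rule degree_eq_zeroE)
  with assms show ?thesis using that by auto
qed

section \<open>Exclusion of all finite poles of an intertwiner\<close>

context intertwiner
begin

lemma lowest_nonzero_root:
  assumes "solves F G" and lowest: "\<And>a. poly G a = 0 \<Longrightarrow> \<exists>i j. poly (F $ i $ j) a \<noteq> 0"
    and "poly G a = 0"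
  shows "a = 0"
proof (rule no_root_chain[where Z = "{u1, u2, v1, v2}" and G = G and q = q])
  show "G \<noteq> 0" using assms(1) by (simp add: solves_def)
  show "poly G a = 0" "q \<noteq> 0" using assms(3) q by auto
  show "q ^ n \<noteq> 1" if "n > 0" for n using q that by blast
  show "q ^ n * u \<noteq> v" if "n > 0" "u \<in> {u1, u2, v1, v2}" "v \<in> {u1, u2, v1, v2}" for n u v
    using NR that by blast
  show "(\<exists>n>0. \<exists>u\<in>{u1, u2, v1, v2}. a = q ^ n * u) \<or> poly G (a / q) = 0" if a: "poly G a = 0" for a
  proof -
    obtain i j where ij: "poly (F $ i $ j) a \<noteq> 0" using lowest a by blast
    have "h' (a / q) * p1 (a / q) * poly G (a / q) = 0"
      using arg_cong[OF solves_right[OF assms(1), of "a / q"], of "\<lambda>M. M $ i $ j"] a ij q(1) nz by simp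
    \<comment> \<open>The roots of h' are q u1 and q u2, so one more step from a / q to a gives q^2;
      every exponent is positive, as the order argument requires.\<close>
    then have "a = q ^ 2 * u1 \<or> a = q ^ 2 * u2 \<or> a = q ^ 1 * v1 \<or> a = q ^ 1 * v2 \<or> poly G (a / q) = 0"
      unfolding h_factor mult_eq_0_iff right_minus_eq using q(1) by (auto simp: nonzero_divide_eq_eq power2_eq_square mult_ac)
    then show ?thesis by (metis insertI1 insertI2 zero_less_one zero_less_numeral)
  qed
  show "a \<in> {u1, u2, v1, v2} \<or> poly G (q * a) = 0" if a: "poly G a = 0" for a
  proof -
    obtain i j where ij: "poly (F $ i $ j) a \<noteq> 0" using lowest a by blast
    have "h a * p1 a * poly G (q * a) = 0"
      using arg_cong[OF solves_left[OF assms(1), of "a"], of "\<lambda>M. M $ i $ j"] a ij q(1) nz by simp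
    then show ?thesis by (auto simp: h_factor)
  qed
qed

text \<open>The strings of poles say nothing about 0, which is fixed by multiplication by q. If G
  vanishes there to order m, dividing the relation by x^m and setting x = 0 shows that F(0), which
  is not 0, intertwines q^(m-1) P'(0) and P(0). Their eigenvalues are q^m e1, q^m e2 and e1, e2, so
  a common one is a resonance.\<close>

lemma lowest_zero_root:
  assumes "solves F G" and lowest: "\<And>a. poly G a = 0 \<Longrightarrow> \<exists>i j. poly (F $ i $ j) a \<noteq> 0"
  shows "poly G 0 \<noteq> 0"
proof
  assume G0: "poly G 0 = 0"
  have "G \<noteq> 0" using assms(1) by (simp add: solves_def)
  define m where "m = order 0 G"
  have "m > 0" using G0 \<open>G \<noteq> 0\<close> by (simp add: m_def order_root)
  obtain G1 where G1: "G = [:0, 1:] ^ m * G1" "\<not> [:0, 1:] dvd G1"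
    using order_decomp[OF \<open>G \<noteq> 0\<close>, of 0] by (auto simp: m_def)
  have G10: "poly G1 0 \<noteq> 0" using G1(2) by (simp add: poly_eq_0_iff_dvd)
  obtain i j where ij: "poly (F $ i $ j) 0 \<noteq> 0" using lowest G0 by blast
  have *: "MOST x. (q * h x * q ^ m * poly G1 (q * x)) \<odot> (P' x ** eval_mat F x) = (h' x * poly G1 x) \<odot> (eval_mat F (q * x) ** P x)"
    using MOST_neq(1)[of 0]
  proof eventually_elim
    case (elim x)
    have e: "(q * h x * poly G (q * x)) \<odot> (P' x ** eval_mat F x) = (h' x * poly G x) \<odot> (eval_mat F (q * x) ** P x)"
      using assms(1) unfolding solves_def by blast
    have "x ^ m * (q * h x * q ^ m * poly G1 (q * x) * (P' x ** eval_mat F x) $ i $ j)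
      = x ^ m * (h' x * poly G1 x * (eval_mat F (q * x) ** P x) $ i $ j)" for i j
      using arg_cong[OF e, of "\<lambda>M. M $ i $ j"] by (simp add: G1(1) power_mult_distrib mult_ac)
    then show ?case using elim by (simp add: vec_eq_iff)
  qed
  have "(q * h 0 * q ^ m * poly G1 (q * 0)) \<odot> (P' 0 ** eval_mat F 0) = (h' 0 * poly G1 0) \<odot> (eval_mat F (q * 0) ** P 0)"
    by (rule MOST_cont_mat_eq[OF *]) (intro cont_mats continuous_intros)+
  then have XS: "((q ^ m / q) \<odot> P' 0) ** eval_mat F 0 = eval_mat F 0 ** P 0"
    using G10 nz q(1) by (simp add: vec_eq_iff mat_smult_mult power2_eq_square field_simps)
  from P obtain a1 a0 b1 b0 g1 g0 where
    Pc: "\<And>x. P x = mat2 (th' * x\<^sup>2 + a1 * x + a0) (l * (x - y)) (g1 * x + g0) (th * x\<^sup>2 + b1 * x + b0)"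
    "a0 + b0 = e1 + e2"
    unfolding normal_form_def by blast
  from P' obtain A1 A0 B1 B0 G1 G0 where
    P'c: "\<And>x. P' x = mat2 (th' * x\<^sup>2 + A1 * x + A0) (l' * (x - y')) (G1 * x + G0) (th * x\<^sup>2 + B1 * x + B0)"
    "A0 + B0 = q * (e1 + e2)"
    unfolding normal_form_def by blast
  have dP': "A0 * B0 + l' * y' * G0 = q\<^sup>2 * (e1 * e2)"
    using det_P'[of 0] by (simp add: P'c(1) e)
  have "det ((q ^ m / q) \<odot> P' 0 - mat e) = (q ^ m * e1 - e) * (q ^ m * e2 - e)" for e
  proof -
    define Q where "Q = q ^ m / q"
    have "det (Q \<odot> P' 0 - mat e) = Q\<^sup>2 * (A0 * B0 + l' * y' * G0) - Q * (A0 + B0) * e + e\<^sup>2"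
      by (simp add: P'c(1) mat_eq_mat2 power2_eq_square algebra_simps)
    also have "\<dots> = (Q * q * e1 - e) * (Q * q * e2 - e)"
      unfolding dP' P'c(2) by (simp add: power2_eq_square algebra_simps)
    also have "Q * q = q ^ m" using q(1) by (simp add: Q_def)
    finally show ?thesis by (simp add: Q_def)
  qed
  moreover have "det ((q ^ m / q) \<odot> P' 0 - mat e1) = 0 \<or> det ((q ^ m / q) \<odot> P' 0 - mat e2) = 0"
  proof (rule intertwined_eigenvalue[OF XS])
    show "eval_mat F 0 \<noteq> 0" using ij by (auto simp: vec_eq_iff)
    show "P 0 $ 1 $ 1 + P 0 $ 2 $ 2 = e1 + e2" using Pc by simp
    show "det (P 0) = e1 * e2" using det_P[of 0] by (simp add: e)
  qed
  moreover have "q ^ m * e1 \<noteq> e1" "q ^ m * e2 \<noteq> e1" "q ^ m * e1 \<noteq> e2" "q ^ m * e2 \<noteq> e2"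
    by (rule NR0[OF \<open>m > 0\<close>]; blast)+
  ultimately show False by (simp only: mult_eq_0_iff right_minus_eq simp_thms)
qed

lemma solves_poly:
  assumes "solves F G"
  obtains F' where "solves F' 1"
proof -
  obtain F' G' where FG: "solves F' G'" and low: "\<And>a. poly G' a = 0 \<Longrightarrow> \<exists>i j. poly (F' $ i $ j) a \<noteq> 0"
    by (rule solves_lowest[OF assms]) blast
  have "poly G' a \<noteq> 0" for a
    using lowest_nonzero_root[OF FG low] lowest_zero_root[OF FG low] by blast
  then obtain g where g: "G' = [:g:]" "g \<noteq> 0" by (rule poly_no_root_const)
  have "solves F' 1"
  proof (rule solvesI)
    show "MOST x. (q * h x * poly 1 (q * x)) \<odot> (P' x ** eval_mat F' x) = (h' x * poly 1 x) \<odot> (eval_mat F' (q * x) ** P x)"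
    proof (rule MOST_I)
      fix x
      have e: "(q * h x * poly G' (q * x)) \<odot> (P' x ** eval_mat F' x) = (h' x * poly G' x) \<odot> (eval_mat F' (q * x) ** P x)"
        using FG unfolding solves_def by blast
      have "g * (q * h x * (P' x ** eval_mat F' x) $ i $ j) = g * (h' x * (eval_mat F' (q * x) ** P x) $ i $ j)" for i j
        using arg_cong[OF e, of "\<lambda>M. M $ i $ j"] by (simp add: g(1) mult_ac)
      then show "(q * h x * poly 1 (q * x)) \<odot> (P' x ** eval_mat F' x) = (h' x * poly 1 x) \<odot> (eval_mat F' (q * x) ** P x)"
        using g(2) by (simp add: vec_eq_iff)
    qed
  qed (use FG in \<open>auto simp: solves_def\<close>)
  then show ?thesis using that by blast
qed

end

section \<open>The degree of a polynomial intertwiner\<close>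

lemma normal_form_poly:
  assumes "normal_form th th' s d s1 d1 T l y w P"
  obtains Pp :: "complex poly^2^2" where "\<And>x. eval_mat Pp x = P x" "\<And>i j. degree (Pp $ i $ j) \<le> 2"
    "\<And>i j. coeff (Pp $ i $ j) 2 = (if i = j then (if i = 1 then th' else th) else 0)"
proof -
  from assms obtain a1 a0 b1 b0 g1 g0 where
    P: "\<And>x. P x = mat2 (th' * x\<^sup>2 + a1 * x + a0) (l * (x - y)) (g1 * x + g0) (th * x\<^sup>2 + b1 * x + b0)"
    unfolding normal_form_def by blast
  define Pp :: "complex poly^2^2" where
    "Pp = vector [vector [[:a0, a1, th':], [:- l * y, l:]], vector [[:g0, g1:], [:b0, b1, th:]]]"
  have nth: "Pp $ 1 $ 1 = [:a0, a1, th':]" "Pp $ 1 $ 2 = [:- l * y, l:]"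
    "Pp $ 2 $ 1 = [:g0, g1:]" "Pp $ 2 $ 2 = [:b0, b1, th:]"
    by (simp_all add: Pp_def)
  show ?thesis
  proof
    show "eval_mat Pp x = P x" for x
      unfolding P by (rule mat2_eqI) (simp_all add: nth power2_eq_square algebra_simps)
    show "degree (Pp $ i $ j) \<le> 2" for i j
      using exhaust_2[of i] exhaust_2[of j] by (auto simp: nth)
    show "coeff (Pp $ i $ j) 2 = (if i = j then (if i = 1 then th' else th) else 0)" for i j
      using exhaust_2[of i] exhaust_2[of j] by (auto simp: nth numeral_2_eq_2)
  qed
qed

context intertwiner
begin

text \<open>Coefficients of x^(n+4): both quadratics are monic, P and P' have the leading term
  diag(th', th) x^2, and F(q x) contributes q^n.\<close>

lemma solves_leading:
  assumes F: "solves F 1" and deg: "\<And>i j. degree (F $ i $ j) \<le> n"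
  shows "q * (if i = 1 then th' else th) * coeff (F $ i $ j) n
    = q ^ n * coeff (F $ i $ j) n * (if j = 1 then th' else th)"
proof -
  obtain Pp where Pp: "\<And>x. eval_mat Pp x = P x" "\<And>i j. degree (Pp $ i $ j) \<le> 2"
    "\<And>i j. coeff (Pp $ i $ j) 2 = (if i = j then (if i = 1 then th' else th) else 0)"
    using normal_form_poly[OF P] by blast
  obtain Pp' where Pp': "\<And>x. eval_mat Pp' x = P' x" "\<And>i j. degree (Pp' $ i $ j) \<le> 2"
    "\<And>i j. coeff (Pp' $ i $ j) 2 = (if i = j then (if i = 1 then th' else th) else 0)"
    using normal_form_poly[OF P'] by blast
  define hp hp' where "hp = [:u1 * u2, - (u1 + u2), 1:]" and "hp' = [:q\<^sup>2 * (u1 * u2), - q * (u1 + u2), 1:]"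
  have hp: "poly hp x = h x" "poly hp' x = h' x" for x
    by (simp_all add: hp_def hp'_def power2_eq_square algebra_simps)
  define Fq where "Fq i j = pcompose (F $ i $ j) (monom q (Suc 0))" for i j
  have Fq: "poly (Fq i j) x = poly (F $ i $ j) (q * x)" "degree (Fq i j) \<le> n"
    "coeff (Fq i j) n = q ^ n * coeff (F $ i $ j) n" for i j x
    using deg[of i j] q(1) by (simp_all add: Fq_def poly_pcompose poly_monom degree_pcompose degree_monom_eq)
  define L R where "L = Pp' $ i $ 1 * F $ 1 $ j + Pp' $ i $ 2 * F $ 2 $ j"
    and "R = Fq i 1 * Pp $ 1 $ j + Fq i 2 * Pp $ 2 $ j"
  have "smult q (hp * L) = hp' * R"
  proof (rule poly_eq_MOST[THEN iffD1], rule MOST_I)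
    fix x
    have e: "(q * h x) \<odot> (eval_mat Pp' x ** eval_mat F x) = h' x \<odot> (eval_mat F (q * x) ** eval_mat Pp x)"
      using F by (simp add: solves_def Pp Pp')
    show "poly (smult q (hp * L)) x = poly (hp' * R) x"
      using arg_cong[OF e, of "\<lambda>M. M $ i $ j"]
      by (simp add: hp L_def R_def Fq matrix_matrix_mult_def sum_2 mult_ac)
  qed
  then have e: "q * coeff (hp * L) (2 + (2 + n)) = coeff (hp' * R) (2 + (n + 2))"
    by (metis add.commute coeff_smult)
  have dL: "degree L \<le> 2 + n" unfolding L_def
    by (intro degree_add_le order_trans[OF degree_mult_le] add_mono Pp'(2) deg)
  have dR: "degree R \<le> n + 2" unfolding R_def
    by (intro degree_add_le order_trans[OF degree_mult_le] add_mono Pp(2) Fq(2))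
  have dh: "degree hp \<le> 2" "degree hp' \<le> 2" and ch: "coeff hp 2 = 1" "coeff hp' 2 = 1"
    by (simp_all add: hp_def hp'_def numeral_2_eq_2)
  have "q * coeff L (2 + n) = coeff R (n + 2)"
    using e unfolding coeff_mult_le_degree[OF dh(1) dL] coeff_mult_le_degree[OF dh(2) dR] ch by simp
  moreover have "coeff L (2 + n) = (if i = 1 then th' else th) * coeff (F $ i $ j) n"
    unfolding L_def coeff_add coeff_mult_le_degree[OF Pp'(2) deg] Pp'(3)
    using exhaust_2[of i] by auto
  moreover have "coeff R (n + 2) = q ^ n * coeff (F $ i $ j) n * (if j = 1 then th' else th)"
    unfolding R_def coeff_add coeff_mult_le_degree[OF Fq(2) Pp(2)] Pp(3) Fq(3)
    using exhaust_2[of j] by auto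
  ultimately show ?thesis by (simp add: mult.assoc)
qed

lemma solves_degree:
  assumes F: "solves F 1"
  obtains c1 c2 f11 f12 f21 f22 where
    "\<And>x. eval_mat F x = mat2 (c1 * x + f11) f12 f21 (c2 * x + f22)"
proof -
  define n where "n = Max ((\<lambda>(i, j). degree (F $ i $ j)) ` UNIV)"
  have deg: "degree (F $ i $ j) \<le> n" for i j
    unfolding n_def by (rule Max_ge) (auto intro: image_eqI[where x = "(i, j)"])
  have "n \<in> (\<lambda>(i, j). degree (F $ i $ j)) ` UNIV"
    unfolding n_def by (rule Max_in) auto
  then obtain i j where ij: "degree (F $ i $ j) = n" by auto
  have "\<exists>i j. coeff (F $ i $ j) n \<noteq> 0"
  proof (rule ccontr)
    assume no: "\<not> ?thesis"
    then have "F $ i $ j = 0" using ij leading_coeff_0_iff by metis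
    then have "n = 0" using ij by simp
    then have "F $ i $ j = 0" for i j
      using deg[of i j] no by (metis le_zero_eq leading_coeff_0_iff)
    then have "det (eval_mat F x) = 0" for x by (simp add: det_2)
    then show False using F by (simp add: solves_def)
  qed
  then obtain i j where c: "coeff (F $ i $ j) n \<noteq> 0" by blast
  \<comment> \<open>From q A_i = q^m A_j with A_i, A_j in {th, th'}: m = 0 and m > 1 are resonances,
    while m = 1 gives A_i = A_j, hence i = j. It is used twice, for the top degree and then for the
    off-diagonal entries in degree 1.\<close>
  have diag: "m = 1 \<and> i = j" if "\<And>i j. degree (F $ i $ j) \<le> m" "coeff (F $ i $ j) m \<noteq> 0" for m i j
  proof -
    define A where "A k = (if k = (1 :: 2) then th' else th)" for k
    have A: "A k \<in> {th, th'}" for k by (simp add: A_def)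
    have e: "q * A i = q ^ m * A j"
      using solves_leading[OF F that(1), of i j] that(2) by (simp add: A_def)
    consider "m = 0" | "m = 1" | k where "m = Suc (Suc k)" by (metis One_nat_def not0_implies_Suc)
    then show ?thesis
    proof cases
      case 1
      then show ?thesis using NRi[of 1 "A i" "A j"] A e by simp
    next
      case 2
      then have "A i = A j" using e q(1) by simp
      then show ?thesis using 2 nz(7) exhaust_2[of i] exhaust_2[of j] by (auto simp: A_def)
    next
      case 3
      then have "A i = q ^ Suc k * A j" using e q(1) by simp
      then show ?thesis using NRi[OF zero_less_Suc A[of j] A[of i], of k] by metis
    qed
  qed
  then have "n = 1" using diag[OF deg c] by simp
  have deg1: "degree (F $ i $ j) \<le> 1" for i j using deg \<open>n = 1\<close> by simp
  have p: "poly (F $ i $ j) x = coeff (F $ i $ j) 1 * x + coeff (F $ i $ j) 0" for i j x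
  proof -
    have "F $ i $ j = [:coeff (F $ i $ j) 0, coeff (F $ i $ j) 1:]"
    proof (rule poly_eqI)
      fix k :: nat
      consider "k = 0" | "k = 1" | "k > 1" by linarith
      then show "coeff (F $ i $ j) k = coeff [:coeff (F $ i $ j) 0, coeff (F $ i $ j) 1:] k"
      proof cases
        case 3
        then have "degree (F $ i $ j) < k" "degree [:coeff (F $ i $ j) 0, coeff (F $ i $ j) 1:] < k"
          using deg1[of i j] by (auto split: if_splits)
        then show ?thesis by (simp only: coeff_eq_0)
      qed auto
    qed
    then have "poly (F $ i $ j) x = poly [:coeff (F $ i $ j) 0, coeff (F $ i $ j) 1:] x"
      by (rule arg_cong)
    then show ?thesis by simp
  qed
  have off: "coeff (F $ 1 $ 2) 1 = 0" "coeff (F $ 2 $ 1) 1 = 0"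
    using diag[OF deg1, of 1 2] diag[OF deg1, of 2 1] by auto
  show ?thesis
    by (rule that[of "coeff (F $ 1 $ 1) 1" "coeff (F $ 1 $ 1) 0" "coeff (F $ 1 $ 2) 0"
        "coeff (F $ 2 $ 1) 0" "coeff (F $ 2 $ 2) 1" "coeff (F $ 2 $ 2) 0"], rule mat2_eqI)
      (simp_all add: p off[unfolded One_nat_def])
qed

end

text \<open>The equation says that the quotient of k2 x^2 + k1 x + k0 by h'(x) = q^2 h(x / q) is
  invariant under x -> q x, so it should be the constant k2. The coefficients of x^3 and x^2 confirm
  this, as q (q - 1) and q^2 - 1 do not vanish.\<close>

lemma quad_q_difference:
  fixes q s d k0 k1 k2 :: complex
  assumes eq: "MOST x. q\<^sup>2 * (x\<^sup>2 - s * x + d) * (k2 * x\<^sup>2 + k1 * x + k0)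
      = (x\<^sup>2 - q * s * x + q\<^sup>2 * d) * (k2 * (q * x)\<^sup>2 + k1 * (q * x) + k0)"
    and q: "q \<noteq> 0" "q \<noteq> 1" "q\<^sup>2 \<noteq> 1"
  shows "k1 = - q * s * k2" "k0 = q\<^sup>2 * d * k2"
proof -
  have "MOST x. poly (smult (q\<^sup>2) ([:d, - s, 1:] * [:k0, k1, k2:])
     - [:q\<^sup>2 * d, - q * s, 1:] * [:k0, q * k1, q\<^sup>2 * k2:]) x = 0"
    using eq by eventually_elim (simp add: power2_eq_square algebra_simps)
  from poly_cofinite_zero[OF this]
  have 0: "smult (q\<^sup>2) ([:d, - s, 1:] * [:k0, k1, k2:])
     - [:q\<^sup>2 * d, - q * s, 1:] * [:k0, q * k1, q\<^sup>2 * k2:] = 0" .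
  have "(q * (q - 1)) * (k1 + q * s * k2) = 0"
    using arg_cong[OF 0, of "\<lambda>p. coeff p 3"] by (simp add: numeral_3_eq_3 power2_eq_square algebra_simps)
  then show k1: "k1 = - q * s * k2" using q by (simp add: add_eq_0_iff2)
  have "(q\<^sup>2 - 1) * (k0 - q\<^sup>2 * d * k2) = 0"
    using arg_cong[OF 0, of "\<lambda>p. coeff p 2"] unfolding k1
    by (simp add: numeral_2_eq_2 power2_eq_square algebra_simps)
  then show "k0 = q\<^sup>2 * d * k2" using q by simp
qed

section \<open>From a linear intertwiner to the factorisation\<close>

context intertwiner
begin

lemma solves_gauge:
  assumes "solves F G"
  shows "\<exists>c B R. c \<noteq> 0 \<and> connection q th th' (u1 + u2) (u1 * u2) P B R \<and> P' = (\<lambda>x. gauge_by c (next_system q th th' B R x))"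
proof -
  obtain F where F: "solves F 1" by (rule solves_poly[OF assms])
  obtain c1 c2 f11 f12 f21 f22 where eval_mat: "\<And>x. eval_mat F x = mat2 (c1 * x + f11) f12 f21 (c2 * x + f22)"
    by (rule solves_degree[OF F], rule that, assumption)
  have eq: "(q * h x) \<odot> (P' x ** eval_mat F x) = h' x \<odot> (eval_mat F (q * x) ** P x)" for x
    using F by (simp add: solves_def)
  define k2 k1 k0 where k: "k2 = c1 * c2" "k1 = c1 * f22 + c2 * f11" "k0 = f11 * f22 - f12 * f21"
  have det: "det (eval_mat F x) = k2 * x\<^sup>2 + k1 * x + k0" for x
    by (simp add: eval_mat k power2_eq_square algebra_simps)
  have ds: "det (c \<odot> M) = c\<^sup>2 * det M" for c M
    by (simp add: det_2 power2_eq_square algebra_simps)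
  have MOST_p1: "MOST x. p1 x \<noteq> 0" by (rule MOST_quad_nz)
  have "MOST x. q\<^sup>2 * h x * (k2 * x\<^sup>2 + k1 * x + k0)
      = h' x * (k2 * (q * x)\<^sup>2 + k1 * (q * x) + k0)"
    using MOST_h MOST_h' MOST_p1
  proof eventually_elim
    case (elim x)
    have "(q * h x)\<^sup>2 * (det (P' x) * det (eval_mat F x)) = (h' x)\<^sup>2 * (det (eval_mat F (q * x)) * det (P x))"
      using arg_cong[OF eq[of x], of det] by (simp only: ds det_mul)
    then have "(h x * h' x * p1 x * th * th') * (q\<^sup>2 * h x * det (eval_mat F x))
      = (h x * h' x * p1 x * th * th') * (h' x * det (eval_mat F (q * x)))"
      unfolding det_P det_P' by (simp add: power2_eq_square mult_ac)
    then show ?case using elim nz unfolding det by simp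
  qed
  from quad_q_difference[OF this q(1)] q(2)[of 1] q(2)[of 2]
  have k': "k1 = - q * (u1 + u2) * k2" "k0 = q\<^sup>2 * (u1 * u2) * k2" by simp_all
  have "k2 \<noteq> 0"
  proof
    assume "k2 = 0"
    then have "MOST x. det (eval_mat F x) = 0" by (simp add: det k')
    then show False using F by (simp add: solves_def)
  qed
  then have c: "c1 \<noteq> 0" "c2 \<noteq> 0" by (auto simp: k)
  \<comment> \<open>A scalar factor drops out of the intertwining relation, so F may be replaced by
    diag(c1 / c2, 1) (x + B).\<close>
  define cc where "cc = c1 / c2"
  have cc: "cc \<noteq> 0" using c by (simp add: cc_def)
  define C where "C = mat2 cc 0 0 1"
  define b11 b12 b21 b22 where b: "b11 = f11 / c1" "b12 = f12 / c1" "b21 = f21 / c2" "b22 = f22 / c2"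
  define B where "B = mat2 b11 b12 b21 b22"
  have f: "f11 = c1 * b11" "f12 = c1 * b12" "f21 = c2 * b21" "f22 = c2 * b22" "c2 * (cc * z) = c1 * z" for z
    using c by (simp_all add: b cc_def)
  have evC: "eval_mat F x = c2 \<odot> (C ** (mat x + B))" for x
    by (simp add: eval_mat C_def B_def mat_eq_mat2 f distrib_left)
  have detB: "det (mat x + B) = h' x" for x
  proof -
    have "k2 * det (mat x + B) = det (eval_mat F x)"
      unfolding eval_mat B_def k by (simp add: mat_eq_mat2 f algebra_simps)
    also have "\<dots> = k2 * h' x" unfolding det k' by (simp add: algebra_simps)
    finally show ?thesis using \<open>k2 \<noteq> 0\<close> by simp
  qed
  have eqB: "(q * h x) \<odot> (P' x ** (C ** (mat x + B))) = h' x \<odot> (C ** ((mat (q * x) + B) ** P x))" for x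
  proof -
    have "c2 * (q * h x * (P' x ** (C ** (mat x + B))) $ i $ j) = c2 * (h' x * (C ** ((mat (q * x) + B) ** P x)) $ i $ j)" for i j
      using arg_cong[OF eq[of x, unfolded evC mat_smult_mult], of "\<lambda>M. M $ i $ j"] by (simp add: matrix_mul_assoc mult_ac)
    then show ?thesis using c by (simp add: vec_eq_iff)
  qed
  define Ci where "Ci = mat2 (1 / cc) 0 0 1"
  have CiC: "Ci ** C = mat 1" "C ** Ci = mat 1" using cc by (simp_all add: Ci_def C_def mat_eq_mat2)
  define Q where "Q x = Ci ** P' x ** C" for x
  have eqQ: "(q * h x) \<odot> (Q x ** (mat x + B)) = h' x \<odot> ((mat (q * x) + B) ** P x)" for x
  proof -
    have "(q * h x) \<odot> (Q x ** (mat x + B)) = Ci ** ((q * h x) \<odot> (P' x ** (C ** (mat x + B))))"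
      by (simp only: Q_def mat_smult_mult matrix_mul_assoc)
    also have "\<dots> = Ci ** (h' x \<odot> (C ** ((mat (q * x) + B) ** P x)))"
      by (simp only: eqB)
    also have "\<dots> = h' x \<odot> ((Ci ** C) ** ((mat (q * x) + B) ** P x))"
      by (simp only: mat_smult_mult matrix_mul_assoc)
    finally show ?thesis by (simp add: CiC)
  qed
  from P obtain a1 a0 b1 b0 g1 g0 where
    Pc: "\<And>x. P x = mat2 (th' * x\<^sup>2 + a1 * x + a0) (l * (x - y)) (g1 * x + g0) (th * x\<^sup>2 + b1 * x + b0)"
    unfolding normal_form_def by blast
  from P' obtain A1 A0 B1 B0 G1 G0 where
    P'c: "\<And>x. P' x = mat2 (th' * x\<^sup>2 + A1 * x + A0) (l' * (x - y')) (G1 * x + G0) (th * x\<^sup>2 + B1 * x + B0)"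
    unfolding normal_form_def by blast
  \<comment> \<open>Non-resonance with n = 1 makes h and h' coprime. As h divides h' (q x + B) P(x),
    it divides (q x + B) P(x), which is the factorisation sought.\<close>
  have nr: "\<forall>x. h x = 0 \<longrightarrow> h' x \<noteq> 0"
  proof (intro allI impI)
    fix x assume that: "h x = 0"
    have "x = u1 \<or> x = u2" using that unfolding h_factor by auto
    moreover have "q ^ 1 * u1 \<noteq> u1" "q ^ 1 * u1 \<noteq> u2" "q ^ 1 * u2 \<noteq> u1" "q ^ 1 * u2 \<noteq> u2"
      by (rule NR[OF zero_less_one]; blast)+
    ultimately show "h' x \<noteq> 0" unfolding h_factor power_one_right mult_eq_0_iff right_minus_eq by metis
  qed
  note div = quad_dvd_cubic[OF nr]
  define m where "m = l' / cc"
  have Qc: "Q x = mat2 (th' * x\<^sup>2 + A1 * x + A0) (m * (x - y')) ((G1 * x + G0) * cc) (th * x\<^sup>2 + B1 * x + B0)" for x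
    using cc by (simp add: Q_def Ci_def C_def P'c m_def)
  have cubic: "((mat (q * x) + B) ** P x) =
    mat2 (q * th' * x^3 + (q * a1 + b11 * th') * x\<^sup>2 + (q * a0 + b11 * a1 + b12 * g1) * x + (b11 * a0 + b12 * g0))
      (0 * x^3 + (q * l + b12 * th) * x\<^sup>2 + (b11 * l - q * l * y + b12 * b1) * x + (b12 * b0 - b11 * l * y))
      (0 * x^3 + (q * g1 + b21 * th') * x\<^sup>2 + (q * g0 + b22 * g1 + b21 * a1) * x + (b21 * a0 + b22 * g0))
      (q * th * x^3 + (q * b1 + b22 * th) * x\<^sup>2 + (q * b0 + b22 * b1 + b21 * l) * x + (b22 * b0 - b21 * l * y))" for x
    by (simp add: B_def Pc mat_eq_mat2 power2_eq_square power3_eq_cube algebra_simps)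
  \<comment> \<open>The polynomials on the left are the entries of q Q(x) (x + B), the cofactors
    that \<open>quad_dvd_cubic\<close> asks for.\<close>
  have eqs: "(x\<^sup>2 - (u1 + u2) * x + u1 * u2) * poly (smult q ([:A0, A1, th':] * [:b11, 1:] + smult (b21 * m) [:- y', 1:])) x =
      h' x * (q * th' * x^3 + (q * a1 + b11 * th') * x\<^sup>2 + (q * a0 + b11 * a1 + b12 * g1) * x + (b11 * a0 + b12 * g0))"
    "(x\<^sup>2 - (u1 + u2) * x + u1 * u2) * poly (smult q (smult b12 [:A0, A1, th':] + smult m ([:- y', 1:] * [:b22, 1:]))) x =
      h' x * (0 * x^3 + (q * l + b12 * th) * x\<^sup>2 + (b11 * l - q * l * y + b12 * b1) * x + (b12 * b0 - b11 * l * y))"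
    "(x\<^sup>2 - (u1 + u2) * x + u1 * u2) * poly (smult q (smult cc ([:G0, G1:] * [:b11, 1:]) + smult b21 [:B0, B1, th:])) x =
      h' x * (0 * x^3 + (q * g1 + b21 * th') * x\<^sup>2 + (q * g0 + b22 * g1 + b21 * a1) * x + (b21 * a0 + b22 * g0))"
    "(x\<^sup>2 - (u1 + u2) * x + u1 * u2) * poly (smult q (smult (cc * b12) [:G0, G1:] + [:B0, B1, th:] * [:b22, 1:])) x =
      h' x * (q * th * x^3 + (q * b1 + b22 * th) * x\<^sup>2 + (q * b0 + b22 * b1 + b21 * l) * x + (b22 * b0 - b21 * l * y))" for x
  proof -
    note e = eqQ[of x, unfolded cubic Qc, unfolded B_def mat_eq_mat2 mat2_arith mat2_mult mat2_eq_iff]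
    show "(x\<^sup>2 - (u1 + u2) * x + u1 * u2) * poly (smult q ([:A0, A1, th':] * [:b11, 1:] + smult (b21 * m) [:- y', 1:])) x =
      h' x * (q * th' * x^3 + (q * a1 + b11 * th') * x\<^sup>2 + (q * a0 + b11 * a1 + b12 * g1) * x + (b11 * a0 + b12 * g0))"
      by (rule trans[OF _ conjunct1[OF e]]) (simp add: power2_eq_square algebra_simps)
    show "(x\<^sup>2 - (u1 + u2) * x + u1 * u2) * poly (smult q (smult b12 [:A0, A1, th':] + smult m ([:- y', 1:] * [:b22, 1:]))) x =
      h' x * (0 * x^3 + (q * l + b12 * th) * x\<^sup>2 + (b11 * l - q * l * y + b12 * b1) * x + (b12 * b0 - b11 * l * y))"
      by (rule trans[OF _ conjunct1[OF conjunct2[OF e]]]) (simp add: power2_eq_square algebra_simps)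
    show "(x\<^sup>2 - (u1 + u2) * x + u1 * u2) * poly (smult q (smult cc ([:G0, G1:] * [:b11, 1:]) + smult b21 [:B0, B1, th:])) x =
      h' x * (0 * x^3 + (q * g1 + b21 * th') * x\<^sup>2 + (q * g0 + b22 * g1 + b21 * a1) * x + (b21 * a0 + b22 * g0))"
      by (rule trans[OF _ conjunct1[OF conjunct2[OF conjunct2[OF e]]]]) (simp add: power2_eq_square algebra_simps)
    show "(x\<^sup>2 - (u1 + u2) * x + u1 * u2) * poly (smult q (smult (cc * b12) [:G0, G1:] + [:B0, B1, th:] * [:b22, 1:])) x =
      h' x * (q * th * x^3 + (q * b1 + b22 * th) * x\<^sup>2 + (q * b0 + b22 * b1 + b21 * l) * x + (b22 * b0 - b21 * l * y))"
      by (rule trans[OF _ conjunct2[OF conjunct2[OF conjunct2[OF e]]]]) (simp add: power2_eq_square algebra_simps)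
  qed
  define R where "R = mat2 (q * a1 + b11 * th' + (u1 + u2) * (q * th')) (q * l + b12 * th)
     (q * g1 + b21 * th') (q * b1 + b22 * th + (u1 + u2) * (q * th))"
  have E: "(mat (q * x) + B) ** P x = h x \<odot> (mat2 (q * th' * x) 0 0 (q * th * x) + R)" for x
    unfolding cubic div[OF eqs(1)] div[OF eqs(2)] div[OF eqs(3)] div[OF eqs(4)] R_def by simp
  have connection: "connection q th th' (u1 + u2) (u1 * u2) P B R"
    unfolding connection_def using E detB by blast
  define N where "N x = (mat2 (q * th' * x) 0 0 (q * th * x) + R) ** mat2 (x + b22) (- b12) (- b21) (x + b11)" for x
  have contN: "cont_mat (\<lambda>x. (1 / q) \<odot> N x)"
    unfolding N_def R_def mat2_arith mat2_mult by (intro cont_mat_mat2 continuous_intros)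
  have contQ: "cont_mat Q"
    unfolding Q_def Ci_def C_def by (intro cont_mats cont_mat_mat2 continuous_intros)
  have QN: "MOST x. Q x = (1 / q) \<odot> N x"
    using MOST_h MOST_h'
  proof eventually_elim
    case (elim x)
    define J where "J = mat2 (x + b22) (- b12) (- b21) (x + b11)"
    have BJ: "(mat x + B) ** J = mat (h' x)"
      using detB[of x] by (simp add: J_def B_def mat_eq_mat2 algebra_simps)
    have "(q * h x * h' x) \<odot> Q x = (q * h x) \<odot> (Q x ** ((mat x + B) ** J))"
      by (simp add: BJ mult_mat_eq mat_smult_mat_smult)
    also have "\<dots> = ((q * h x) \<odot> (Q x ** (mat x + B))) ** J"
      by (simp only: mat_smult_mult matrix_mul_assoc)
    also have "\<dots> = (h' x \<odot> h x \<odot> (mat2 (q * th' * x) 0 0 (q * th * x) + R)) ** J"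
      by (simp only: eqQ E)
    also have "\<dots> = (h' x * h x) \<odot> N x"
      by (simp only: N_def J_def mat_smult_mult mat_smult_mat_smult)
    finally have e: "(q * h x * h' x) \<odot> Q x = (h' x * h x) \<odot> N x" .
    have "(h x * h' x) * (q * Q x $ i $ j) = (h x * h' x) * N x $ i $ j" for i j
      using arg_cong[OF e, of "\<lambda>M. M $ i $ j"] by (simp add: mult_ac)
    then show ?case using elim q(1) by (simp add: vec_eq_iff nonzero_eq_divide_eq mult.commute)
  qed
  have "P' x = gauge_by cc (next_system q th th' B R x)" for x
  proof -
    have "next_system q th th' B R x = (1 / q) \<odot> N x" by (simp add: next_system_def N_def B_def)
    also have "\<dots> = Q x" by (rule MOST_cont_mat_eq[OF QN contQ contN, symmetric])
    finally have "gauge_by cc (next_system q th th' B R x) = C ** Q x ** Ci"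
      using cc by (simp add: gauge_by_def C_def Ci_def matrix_inv_mat2)
    also have "\<dots> = (C ** Ci) ** P' x ** (C ** Ci)" by (simp only: Q_def matrix_mul_assoc)
    also have "\<dots> = P' x" by (simp add: CiC)
    finally show ?thesis ..
  qed
  then show ?thesis using connection cc by blast
qed

end

section \<open>The matrix \<open>\<AA>\<close> in normal form\<close>

definition frakM where
  "frakM q \<Theta> \<Theta>' l t y Z x =
     mat2 (\<Theta>' Iinf * ((x - y) * (x - alpha q \<Theta> \<Theta>' t y Z) + z1 q \<Theta> \<Theta>' t y Z))
          ((q - 1) * l * (x - y))
          (\<Theta> Iinf * \<Theta>' Iinf * ((gamma q \<Theta> \<Theta>' t y Z * x + delta q \<Theta> \<Theta>' t y Z) / ((q - 1) * l)))
          (\<Theta> Iinf * ((x - y) * (x - beta q \<Theta> \<Theta>' t y Z) + z2 q \<Theta> \<Theta>' t y Z))"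

text \<open>The combination occurring in \<open>alpha\<close> and \<open>beta\<close> is minus the
  third divided difference of p at the nodes 0, 1, t, y. For a monic quartic this divided difference
  is the sum of the nodes plus \<open>c3\<close>.\<close>

lemma divided_differences:
  fixes c3 :: complex
  assumes p: "\<And>x. p x = x^4 + c3 * x^3 + c2 * x\<^sup>2 + c1 * x + c0"
    and nz: "t \<noteq> 0" "t \<noteq> 1" "y \<noteq> 0" "y \<noteq> 1" "y \<noteq> t"
  shows "(p 0 - p y) / y = - (y^3 + c3 * y\<^sup>2 + c2 * y + c1)"
    "(p 1 - p y) / (y - 1) = - ((y^3 + y\<^sup>2 + y + 1) + c3 * (y\<^sup>2 + y + 1) + c2 * (y + 1) + c1)"
    "(p 0 - p y) / (t * y) + (p t - p y) / (t * (t - 1) * (y - t)) - (p 1 - p y) / ((t - 1) * (y - 1))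
       = - (1 + t + y) - c3"
proof -
  show e0: "(p 0 - p y) / y = - (y^3 + c3 * y\<^sup>2 + c2 * y + c1)"
    by (subst nonzero_divide_eq_eq)
      (use nz in simp, simp add: p power4_eq_xxxx power3_eq_cube power2_eq_square algebra_simps)
  show e1: "(p 1 - p y) / (y - 1) = - ((y^3 + y\<^sup>2 + y + 1) + c3 * (y\<^sup>2 + y + 1) + c2 * (y + 1) + c1)"
    by (subst nonzero_divide_eq_eq)
      (use nz in simp, simp add: p power4_eq_xxxx power3_eq_cube power2_eq_square algebra_simps)
  have et: "(p t - p y) / (y - t) = - ((y^3 + y\<^sup>2 * t + y * t\<^sup>2 + t^3) + c3 * (y\<^sup>2 + y * t + t\<^sup>2) + c2 * (y + t) + c1)"
    by (subst nonzero_divide_eq_eq)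
      (use nz in simp, simp add: p power4_eq_xxxx power3_eq_cube power2_eq_square algebra_simps)
  have comb: "A / t + B / (t * (t - 1)) - C / (t - 1) = ((t - 1) * A + B - t * C) / (t * (t - 1))" for A B C
    using nz by (simp add: divide_simps)
  have "(p 0 - p y) / (t * y) + (p t - p y) / (t * (t - 1) * (y - t)) - (p 1 - p y) / ((t - 1) * (y - 1))
     = (p 0 - p y) / y / t + (p t - p y) / (y - t) / (t * (t - 1)) - (p 1 - p y) / (y - 1) / (t - 1)"
    by (simp only: divide_divide_eq_left mult.commute)
  also have "\<dots> = ((t - 1) * ((p 0 - p y) / y) + (p t - p y) / (y - t) - t * ((p 1 - p y) / (y - 1))) / (t * (t - 1))"
    by (rule comb)
  also have "(t - 1) * ((p 0 - p y) / y) + (p t - p y) / (y - t) - t * ((p 1 - p y) / (y - 1))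
     = (- (1 + t + y) - c3) * (t * (t - 1))"
    unfolding e0 e1 et by (simp add: power3_eq_cube power2_eq_square algebra_simps)
  finally show "(p 0 - p y) / (t * y) + (p t - p y) / (t * (t - 1) * (y - t)) - (p 1 - p y) / ((t - 1) * (y - 1))
       = - (1 + t + y) - c3"
    using nz by simp
qed

lemma frakM_normal_form:
  fixes t y Z l q :: complex
  assumes nz: "t \<noteq> 0" "t \<noteq> 1" "y \<noteq> 0" "y \<noteq> 1" "y \<noteq> t" "l \<noteq> 0" "q \<noteq> 1" "z1 q \<Theta> \<Theta>' t y Z \<noteq> 0"
    and th: "\<Theta> Iinf \<noteq> \<Theta>' Iinf"
  shows "normal_form (\<Theta> Iinf) (\<Theta>' Iinf) (t * \<Theta> It + t * \<Theta>' It) (t * \<Theta> It * (t * \<Theta>' It))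
     (\<Theta> I1 + \<Theta>' I1) (\<Theta> I1 * \<Theta>' I1) (t * \<Theta> I0 + t * \<Theta>' I0) ((q - 1) * l) y
     (\<Theta>' Iinf * z1 q \<Theta> \<Theta>' t y Z) (frakM q \<Theta> \<Theta>' l t y Z)"
proof -
  define p where "p = frakp \<Theta> \<Theta>' t"
  define s d s1 d1 where sd: "s = t * \<Theta> It + t * \<Theta>' It" "d = t * \<Theta> It * (t * \<Theta>' It)"
    "s1 = \<Theta> I1 + \<Theta>' I1" "d1 = \<Theta> I1 * \<Theta>' I1"
  define c3 c2 c1 c0 where c: "c3 = - (s + s1)" "c2 = d + d1 + s * s1" "c1 = - (s * d1 + s1 * d)" "c0 = d * d1"
  have pf: "p x = (x\<^sup>2 - s * x + d) * (x\<^sup>2 - s1 * x + d1)" for x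
    by (simp add: p_def frakp_def sd power2_eq_square algebra_simps)
  have p: "p x = x^4 + c3 * x^3 + c2 * x\<^sup>2 + c1 * x + c0" for x
    unfolding pf c by (simp add: power4_eq_xxxx power3_eq_cube power2_eq_square algebra_simps)
  note dd = divided_differences[of p, OF p nz(1-5)]
  define th th' a b g e Z1 Z2 where v: "th = \<Theta> Iinf" "th' = \<Theta>' Iinf" "a = alpha q \<Theta> \<Theta>' t y Z" "b = beta q \<Theta> \<Theta>' t y Z"
    "g = gamma q \<Theta> \<Theta>' t y Z" "e = delta q \<Theta> \<Theta>' t y Z" "Z1 = z1 q \<Theta> \<Theta>' t y Z" "Z2 = z2 q \<Theta> \<Theta>' t y Z"
  have thn: "th - th' \<noteq> 0" using th by (simp add: v)
  have zz: "Z1 * Z2 = p y" using nz(8) by (simp add: v z2_def p_def)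
  have bb: "b = - (a - 1) - (y - t) + (- (1 + t + y) - c3)"
    unfolding dd(3)[symmetric] by (simp add: v beta_def Let_def flip: p_def)
  have ab: "a + b = - c3 - 2 * y" by (subst bb) simp
  have "g = Z1 + Z2 + a * b + (a - 1 + b) * (y - 1) - (p 0 - p y) / y + (p 1 - p y) / (y - 1)"
    by (simp add: v gamma_def Let_def flip: p_def)
  then have "g = Z1 + Z2 + a * b + ((a + b) - 1) * (y - 1) + (y^3 + c3 * y\<^sup>2 + c2 * y + c1)
     - ((y^3 + y\<^sup>2 + y + 1) + c3 * (y\<^sup>2 + y + 1) + c2 * (y + 1) + c1)"
    unfolding dd(1,2) by (simp add: algebra_simps)
  then have g: "g = Z1 + Z2 + a * b + 2 * (a + b) * y + y\<^sup>2 - c2"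
    unfolding ab by (simp add: power2_eq_square algebra_simps)
  have e: "e * y = p 0 - (a * y + Z1) * (b * y + Z2)"
    using nz(3) by (simp add: v delta_def p_def)
  have "a = - (t * (\<Theta> I0 + \<Theta>' I0) - (th' * Z1 + th * Z2)) / ((th - th') * y)
      + th / (th - th') * (1 + t - y + (- (1 + t + y) - c3))"
    unfolding dd(3)[symmetric] by (simp add: v alpha_def Let_def add.assoc add_diff_eq flip: p_def)
  also have "1 + t - y + (- (1 + t + y) - c3) = a + b" unfolding ab by simp
  finally have a: "a = - (t * (\<Theta> I0 + \<Theta>' I0) - (th' * Z1 + th * Z2)) / ((th - th') * y)
      + th / (th - th') * (a + b)" .
  have gen: "k * y * u = - N + m * y * S" if "u = - N / (k * y) + m / k * S" "k \<noteq> 0" for k u N m S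
    using that nz(3) by (simp add: field_simps)
  have "(th - th') * y * a = - (t * (\<Theta> I0 + \<Theta>' I0) - (th' * Z1 + th * Z2)) + th * y * (a + b)"
    by (rule gen[OF a thn])
  then have tr: "th' * (y * a + Z1) + th * (y * b + Z2) = t * \<Theta> I0 + t * \<Theta>' I0"
    by (simp add: algebra_simps)
  \<comment> \<open>The formulas are made for M = p, both monic quartics: \<open>beta\<close> fixes
    the coefficient of x^3, \<open>gamma\<close> that of x^2 and \<open>delta\<close> the constant
    one. For the linear coefficient one compares at x = y, where M(y) = Z1 Z2 = p(y), and divides by
    y. The remaining formula, \<open>alpha\<close>, encodes the trace at 0.\<close>
  define M where "M x = ((x - y) * (x - a) + Z1) * ((x - y) * (x - b) + Z2) - (x - y) * (g * x + e)" for x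
  have M: "M x = p x" for x
  proof -
    define m1 where "m1 = - (y + a) * (y * b + Z2) - (y + b) * (y * a + Z1) + y * g - e"
    have Mx: "M x = x^4 + c3 * x^3 + c2 * x\<^sup>2 + m1 * x + c0" for x
    proof -
      have "M x = x^4 - (2 * y + (a + b)) * x^3 + ((y * (a + b) + Z1 + Z2 + (y + a) * (y + b)) - g) * x\<^sup>2 + m1 * x
         + ((a * y + Z1) * (b * y + Z2) + e * y)"
        unfolding M_def m1_def by (simp add: power4_eq_xxxx power3_eq_cube power2_eq_square algebra_simps)
      also have "2 * y + (a + b) = - c3" unfolding ab by simp
      also have "(a * y + Z1) * (b * y + Z2) + e * y = c0" unfolding e by (simp add: p)
      also have "(y * (a + b) + Z1 + Z2 + (y + a) * (y + b)) - g = c2"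
        unfolding g by (simp add: power2_eq_square algebra_simps)
      finally show ?thesis by simp
    qed
    have "M y = p y" using zz by (simp add: M_def)
    then have "m1 * y = c1 * y" unfolding Mx p by simp
    then have "m1 = c1" using nz(3) by simp
    then show ?thesis unfolding Mx p by simp
  qed
  have k: "(q - 1) * l \<noteq> 0" using nz by simp
  have "det (frakM q \<Theta> \<Theta>' l t y Z x) = th * th' * (x\<^sup>2 - s * x + d) * (x\<^sup>2 - s1 * x + d1)" for x
  proof -
    have "det (frakM q \<Theta> \<Theta>' l t y Z x) = th * th' * M x"
      using k by (simp add: frakM_def M_def flip: v) (simp add: algebra_simps)
    then show ?thesis unfolding M pf by simp
  qed
  moreover have "frakM q \<Theta> \<Theta>' l t y Z x = mat2 (th' * x\<^sup>2 + (- th' * (y + a)) * x + th' * (y * a + Z1))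
     ((q - 1) * l * (x - y)) (th * th' * g / ((q - 1) * l) * x + th * th' * e / ((q - 1) * l))
     (th * x\<^sup>2 + (- th * (y + b)) * x + th * (y * b + Z2))" for x
    using k by (simp add: frakM_def flip: v) (simp add: power2_eq_square add_divide_distrib algebra_simps)
  moreover have "th' * y\<^sup>2 + (- th' * (y + a)) * y + th' * (y * a + Z1) = th' * Z1"
    by (simp add: power2_eq_square algebra_simps)
  ultimately show ?thesis
    unfolding normal_form_def v(1,2,7)[symmetric] sd[symmetric] using tr by blast
qed

section \<open>Meromorphic families\<close>

lemma cosparse_neq_0:
  assumes "f meromorphic_on D" "open D" "connected D" "\<not> mero_eq D f (\<lambda>_. 0)"
  shows "\<forall>\<^sub>\<approx>t\<in>D. f t \<noteq> 0"
  using meromorphic_imp_constant_or_avoid[OF assms(1-3), of 0] assms(4) by (simp add: mero_eq_def)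

lemma cosparse_subset: "(\<forall>\<^sub>\<approx>t\<in>D. Q t) \<Longrightarrow> E \<subseteq> D \<Longrightarrow> \<forall>\<^sub>\<approx>t\<in>E. Q t"
  unfolding eventually_cosparse by (rule sparse_in_subset)

lemma cosparse_neq_const: "open D \<Longrightarrow> \<forall>\<^sub>\<approx>t\<in>D. t \<noteq> (c :: complex)"
  by (simp add: eventually_cosparse_open_eq eventually_neq_at_within)

lemma cosparse_shift:
  assumes "open D" "q \<noteq> 0" "q_stable q D" and Q: "\<forall>\<^sub>\<approx>t\<in>D. Q t"
  shows "\<forall>\<^sub>\<approx>t\<in>D. Q (q * t)"
proof -
  have "eventually (\<lambda>t. Q (q * t)) (at z)" if z: "z \<in> D" for z
  proof -
    have "eventually Q (at (q * z))"
      using Q assms(1,3) z by (simp add: eventually_cosparse_open_eq q_stable_def)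
    moreover have "filterlim (\<lambda>t. q * t) (at (q * z)) (at z)"
    proof (rule filterlim_atI)
      show "((\<lambda>t. q * t) \<longlongrightarrow> q * z) (at z)" by (intro tendsto_intros)
      show "eventually (\<lambda>t. q * t \<noteq> q * z) (at z)"
        using assms(2) by (auto simp: eventually_at_filter)
    qed
    ultimately show ?thesis by (simp add: filterlim_iff)
  qed
  then show ?thesis using assms(1) by (simp add: eventually_cosparse_open_eq)
qed

lemma meromorphic_on_shift:
  assumes "f meromorphic_on D" "q_stable q D"
  shows "(\<lambda>t. f (q * t)) meromorphic_on D"
  by (rule meromorphic_on_compose[OF assms(1)])
    (use assms(2) in \<open>auto simp: q_stable_def intro!: analytic_intros\<close>)

lemma not_cosparse_countable:
  assumes "open D" "D \<noteq> {}" "countable N"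
  shows "\<not> (\<forall>\<^sub>\<approx>t\<in>D. t \<in> (N :: complex set))"
proof
  assume "\<forall>\<^sub>\<approx>t\<in>D. t \<in> N"
  moreover obtain z where "z \<in> D" using assms(2) by blast
  ultimately have "eventually (\<lambda>t. t \<in> N) (at z)"
    using assms(1) by (simp add: eventually_cosparse_open_eq)
  then obtain r where r: "r > 0" "\<And>t. t \<in> ball z r - {z} \<Longrightarrow> t \<in> N"
    by (auto simp: eventually_at dist_commute)
  then have "countable (ball z r - {z})" by (meson assms(3) countable_subset subsetI)
  then have "countable (ball z r)" by (simp add: countable_Diff_eq)
  then show False using uncountable_ball[OF r(1)] by blast
qed

text \<open>If f - g were not zero, it would be non-zero off a sparse set, so almost every point
  would lie in N; but a punctured disc is uncountable.\<close>

lemma mero_eq_off_countable: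
  assumes mero: "f meromorphic_on D" "g meromorphic_on D" and D: "open D" "connected D" "D \<noteq> {}"
    and N: "countable N" and eq: "\<forall>\<^sub>\<approx>t\<in>D. t \<notin> N \<longrightarrow> f t = g t"
  shows "mero_eq D f g"
proof (rule ccontr)
  assume "\<not> mero_eq D f g"
  then have "\<not> mero_eq D (\<lambda>t. f t - g t) (\<lambda>_. 0)" by (simp add: mero_eq_def)
  then have "\<forall>\<^sub>\<approx>t\<in>D. f t - g t \<noteq> 0"
    by (intro cosparse_neq_0 D meromorphic_intros mero)
  with eq have "\<forall>\<^sub>\<approx>t\<in>D. t \<in> N" by eventually_elim auto
  then show False using not_cosparse_countable[OF D(1,3) N] by blast
qed

lemma mero_eq_extend:
  assumes mero: "f meromorphic_on D" "g meromorphic_on D" and D: "open D" "connected D"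
    and E: "open E" "E \<noteq> {}" "E \<subseteq> D" and eq: "mero_eq E f g"
  shows "mero_eq D f g"
proof (rule ccontr)
  assume "\<not> mero_eq D f g"
  then have "\<not> mero_eq D (\<lambda>t. f t - g t) (\<lambda>_. 0)" by (simp add: mero_eq_def)
  then have "\<forall>\<^sub>\<approx>t\<in>D. f t - g t \<noteq> 0"
    by (intro cosparse_neq_0 D meromorphic_intros mero)
  from cosparse_subset[OF this E(3)] eq[unfolded mero_eq_def]
  have "\<forall>\<^sub>\<approx>t\<in>E. t \<in> {}" by eventually_elim auto
  then show False using not_cosparse_countable[OF E(1,2), of "{}"] by blast
qed

text \<open>The uniform degree bound reduces the vanishing of p t for almost all t to finitely many
  coefficients, and finite conjunctions are all that the cosparse filter allows.\<close>

definition mero_polys :: "complex set \<Rightarrow> (complex \<Rightarrow> complex poly) \<Rightarrow> bool" where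
  "mero_polys U p \<longleftrightarrow> (\<forall>k. (\<lambda>t. coeff (p t) k) meromorphic_on U) \<and> (\<exists>m. \<forall>t. degree (p t) \<le> m)"

lemma mero_polys_mult:
  assumes "mero_polys U p" "mero_polys U r"
  shows "mero_polys U (\<lambda>t. p t * r t)"
proof -
  from assms obtain m n where "\<And>t. degree (p t) \<le> m" "\<And>t. degree (r t) \<le> n"
    by (auto simp: mero_polys_def)
  then have "degree (p t * r t) \<le> m + n" for t
    by (meson add_mono degree_mult_le order_trans)
  then show ?thesis
    using assms by (auto simp: mero_polys_def coeff_mult intro!: meromorphic_intros)
qed

lemma mero_polys_diff:
  assumes "mero_polys U p" "mero_polys U r"
  shows "mero_polys U (\<lambda>t. p t - r t)"
proof -
  from assms obtain m n where "\<And>t. degree (p t) \<le> m" "\<And>t. degree (r t) \<le> n"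
    by (auto simp: mero_polys_def)
  then have "degree (p t - r t) \<le> max m n" for t
    by (intro degree_diff_le) (simp_all add: le_max_iff_disj)
  then show ?thesis
    using assms by (auto simp: mero_polys_def intro!: meromorphic_intros)
qed

lemma mero_polys_cases:
  assumes p: "mero_polys U p" and U: "open U" "connected U"
  shows "(\<forall>\<^sub>\<approx>t\<in>U. p t = 0) \<or> (\<forall>\<^sub>\<approx>t\<in>U. p t \<noteq> 0)"
proof -
  obtain m where m: "\<And>t. degree (p t) \<le> m" using p by (auto simp: mero_polys_def)
  show ?thesis
  proof (cases "\<forall>k\<le>m. \<forall>\<^sub>\<approx>t\<in>U. coeff (p t) k = 0")
    case True
    then have "\<forall>\<^sub>\<approx>t\<in>U. \<forall>k\<in>{..m}. coeff (p t) k = 0"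
      by (intro eventually_ball_finite) auto
    then have "\<forall>\<^sub>\<approx>t\<in>U. p t = 0"
    proof eventually_elim
      case (elim t)
      then have "lead_coeff (p t) = 0" using m by blast
      then show ?case by simp
    qed
    then show ?thesis ..
  next
    case False
    then obtain k where "\<not> (\<forall>\<^sub>\<approx>t\<in>U. coeff (p t) k = 0)" by blast
    then have "\<forall>\<^sub>\<approx>t\<in>U. coeff (p t) k \<noteq> 0"
      using meromorphic_imp_constant_or_avoid[OF _ U] p unfolding mero_polys_def by blast
    then have "\<forall>\<^sub>\<approx>t\<in>U. p t \<noteq> 0" by eventually_elim auto
    then show ?thesis ..
  qed
qed

lemma mero_ratfun_polys:
  assumes f: "mero_ratfun U f" and U: "open U" "connected U"
  obtains p r where "mero_polys U p" "mero_polys U r" "\<forall>\<^sub>\<approx>t\<in>U. r t \<noteq> 0"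
    "\<forall>\<^sub>\<approx>t\<in>U. MOST x. f x t = poly (p t) x / poly (r t) x"
proof -
  from f obtain n a b where ab: "\<And>k. k \<le> n \<Longrightarrow> a k meromorphic_on U \<and> b k meromorphic_on U"
    and b: "\<exists>k\<le>n. \<not> mero_eq U (b k) (\<lambda>_. 0)"
    and eq: "\<forall>\<^sub>\<approx>t\<in>U. MOST x. f x t = (\<Sum>k\<le>n. a k t * x ^ k) / (\<Sum>k\<le>n. b k t * x ^ k)"
    unfolding mero_ratfun_def ratfun_eq_def by blast
  define pl where "pl c t = (\<Sum>k\<le>n. monom (c k t) k)" for c :: "nat \<Rightarrow> complex \<Rightarrow> complex" and t
  have cf: "coeff (pl c t) k = (if k \<le> n then c k t else 0)" for c t k
    by (simp add: pl_def coeff_sum)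
  have "degree (pl c t) \<le> n" for c t
    by (rule degree_le) (simp add: cf)
  then have mp: "mero_polys U (pl c)" if "\<And>k. k \<le> n \<Longrightarrow> c k meromorphic_on U" for c
  proof -
    have "(\<lambda>t. coeff (pl c t) k) meromorphic_on U" for k
      using that by (cases "k \<le> n") (simp_all add: cf meromorphic_on_const)
    with \<open>\<And>c t. degree (pl c t) \<le> n\<close> show ?thesis by (auto simp: mero_polys_def)
  qed
  obtain k where k: "k \<le> n" "\<not> mero_eq U (b k) (\<lambda>_. 0)" using b by blast
  then have "\<forall>\<^sub>\<approx>t\<in>U. b k t \<noteq> 0" using ab U by (intro cosparse_neq_0) auto
  then have nz: "\<forall>\<^sub>\<approx>t\<in>U. pl b t \<noteq> 0"
    by eventually_elim (use k cf in \<open>metis coeff_0\<close>)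
  have eval_mat: "poly (pl c t) x = (\<Sum>k\<le>n. c k t * x ^ k)" for c t x
    by (simp add: pl_def poly_sum poly_monom)
  show ?thesis
    by (rule that[of "pl a" "pl b"]) (use ab mp nz eq eval_mat in auto)
qed

lemma mero_ratfun_quadI:
  assumes "a0 meromorphic_on U" "a1 meromorphic_on U" "a2 meromorphic_on U"
    "b0 meromorphic_on U" "b1 meromorphic_on U" "open U" "U \<noteq> {}"
    and "\<And>x t. f x t = (a2 t * x\<^sup>2 + a1 t * x + a0 t) / (x\<^sup>2 + b1 t * x + b0 t)"
  shows "mero_ratfun U f"
proof -
  define a where "a k = (if k = 0 then a0 else if k = 1 then a1 else a2)" for k :: nat
  define b where "b k = (if k = 0 then b0 else if k = 1 then b1 else (\<lambda>_. 1))" for k :: nat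
  have "f x t = (\<Sum>k\<le>2. a k t * x ^ k) / (\<Sum>k\<le>2. b k t * x ^ k)" for x t
    by (simp add: assms(8) a_def b_def numeral_2_eq_2 algebra_simps)
  moreover have "\<not> mero_eq U (b 2) (\<lambda>_. 0)"
    using not_cosparse_countable[OF assms(6,7), of "{}"] by (auto simp: mero_eq_def b_def)
  moreover have "a k meromorphic_on U \<and> b k meromorphic_on U" for k
    using assms by (auto simp: a_def b_def)
  ultimately show ?thesis
    unfolding mero_ratfun_def ratfun_eq_def by (intro exI[of _ 2] exI[of _ a] exI[of _ b]) auto
qed

text \<open>Invertibility over the field only says that the determinant is not identically zero.
  Clearing denominators turns it into a polynomial family, which vanishes for almost all t or for
  almost none, so the determinant is non-zero at almost every single t. Nothing is kept about the
  dependence on t, as the analysis in x takes place at fixed t.\<close>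

lemma GL2_mero_ratfun_polys:
  assumes B: "GL2_mero_ratfun U B" and U: "open U" "connected U"
  shows "\<exists>Nn Dd. (\<forall>\<^sub>\<approx>t\<in>U. (\<forall>i j. Dd i j t \<noteq> 0 \<and>
      (MOST x. B x t $ i $ j = poly (Nn i j t) x / poly (Dd i j t) x)) \<and> \<not> (MOST x. det (B x t) = 0))"
proof -
  define Q where "Q i j p r \<longleftrightarrow> mero_polys U p \<and> mero_polys U r \<and> (\<forall>\<^sub>\<approx>t\<in>U. r t \<noteq> 0) \<and>
    (\<forall>\<^sub>\<approx>t\<in>U. MOST x. B x t $ i $ j = poly (p t) x / poly (r t) x)" for i j p r
  have "\<exists>p r. Q i j p r" for i j
  proof -
    have "mero_ratfun U (\<lambda>x t. B x t $ i $ j)" using B unfolding GL2_mero_ratfun_def by blast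
    then show ?thesis unfolding Q_def by (rule mero_ratfun_polys[OF _ U]) blast
  qed
  then obtain p r where Q: "\<And>i j. Q i j (p i j) (r i j)" by metis
  have pr: "mero_polys U (p i j)" "mero_polys U (r i j)"
    "\<forall>\<^sub>\<approx>t\<in>U. r i j t \<noteq> 0" "\<forall>\<^sub>\<approx>t\<in>U. MOST x. B x t $ i $ j = poly (p i j t) x / poly (r i j t) x" for i j
    using Q[of i j] by (simp_all add: Q_def)
  have eval_mat: "\<forall>\<^sub>\<approx>t\<in>U. \<forall>i j. r i j t \<noteq> 0 \<and> (MOST x. B x t $ i $ j = poly (p i j t) x / poly (r i j t) x)"
    by (intro eventually_all_finite eventually_conj pr)
  define L where "L t = p 1 1 t * p 2 2 t * (r 1 2 t * r 2 1 t) - p 1 2 t * p 2 1 t * (r 1 1 t * r 2 2 t)" for t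
  have "mero_polys U L"
    unfolding L_def by (intro mero_polys_diff mero_polys_mult pr)
  have det: "\<forall>\<^sub>\<approx>t\<in>U. (MOST x. det (B x t) = 0) \<longleftrightarrow> L t = 0"
    using eval_mat
  proof eventually_elim
    case (elim t)
    then have r: "r i j t \<noteq> 0" and e: "MOST x. B x t $ i $ j = poly (p i j t) x / poly (r i j t) x" for i j
      by blast+
    have rn: "MOST x. poly (r i j t) x \<noteq> 0" for i j
      using r[of i j] by (simp add: eventually_cofinite poly_roots_finite)
    have "MOST x. det (B x t) = 0 \<longleftrightarrow> poly (L t) x = 0"
      using e[of 1 1] e[of 1 2] e[of 2 1] e[of 2 2] rn[of 1 1] rn[of 1 2] rn[of 2 1] rn[of 2 2]
    proof eventually_elim
      case (elim x)
      show ?case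
        unfolding det_2 elim(1-4) L_def using elim(5-8) by (simp add: frac_eq_eq mult_ac)
    qed
    then have "(MOST x. det (B x t) = 0) \<longleftrightarrow> (MOST x. poly (L t) x = 0)"
      by (rule eventually_cong) simp
    also have "\<dots> \<longleftrightarrow> L t = 0" using poly_cofinite_zero by auto
    finally show ?case .
  qed
  have "\<forall>\<^sub>\<approx>t\<in>U. L t \<noteq> 0"
  proof -
    have "\<not> (\<forall>\<^sub>\<approx>t\<in>U. L t = 0)"
    proof
      assume "\<forall>\<^sub>\<approx>t\<in>U. L t = 0"
      with det have "\<forall>\<^sub>\<approx>t\<in>U. MOST x. det (B x t) = 0" by eventually_elim simp
      then show False using B by (simp add: GL2_mero_ratfun_def ratfun_eq_def)
    qed
    then show ?thesis using mero_polys_cases[OF \<open>mero_polys U L\<close> U] by blast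
  qed
  with eval_mat det have "\<forall>\<^sub>\<approx>t\<in>U. (\<forall>i j. r i j t \<noteq> 0 \<and>
      (MOST x. B x t $ i $ j = poly (p i j t) x / poly (r i j t) x)) \<and> \<not> (MOST x. det (B x t) = 0)"
    by eventually_elim simp
  then show ?thesis by (intro exI)
qed

section \<open>Generic points\<close>

locale parameters =
  fixes q :: complex and \<Theta> \<Theta>' :: "idx \<Rightarrow> complex"
    and lam y Z :: "complex \<Rightarrow> complex" and A0 A1 At :: "complex \<Rightarrow> complex^2^2"
  assumes q0: "q \<noteq> 0" and q1: "\<forall>n::nat. n > 0 \<longrightarrow> q ^ n \<noteq> 1"
    and Th0: "\<forall>i. \<Theta> i \<noteq> 0" and Th0': "\<forall>i. \<Theta>' i \<noteq> 0"
    and Thi: "\<Theta> Iinf \<noteq> \<Theta>' Iinf"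
    and Thp: "\<Theta> I0 * \<Theta>' I0 = \<Theta> Iinf * \<Theta>' Iinf * \<Theta> It * \<Theta>' It * \<Theta> I1 * \<Theta>' I1"
    and Thr: "\<forall>i. \<forall>k::int. k \<noteq> 0 \<longrightarrow> \<Theta> i / \<Theta>' i \<noteq> q powi k"
begin

abbreviation X where "X \<equiv> XX q \<Theta> \<Theta>' y Z"
abbreviation P where "P t \<equiv> cleared t (A0 t) (A1 t) (At t)"
abbreviation s where "s t \<equiv> t * \<Theta> It + t * \<Theta>' It"
abbreviation d where "d t \<equiv> t * \<Theta> It * (t * \<Theta>' It)"
abbreviation s1 where "s1 \<equiv> \<Theta> I1 + \<Theta>' I1"
abbreviation d1 where "d1 \<equiv> \<Theta> I1 * \<Theta>' I1"
abbreviation T where "T t \<equiv> t * \<Theta> I0 + t * \<Theta>' I0"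
abbreviation ll where "ll t \<equiv> (q - 1) * lam t"
abbreviation ww where "ww t \<equiv> (y t - 1) * (y t - t) * (1 + (q - 1) * y t * Z t)"
abbreviation B0 where "B0 \<equiv> BB0 q \<Theta> \<Theta>' A0 A1 At"
abbreviation M1 where "M1 t \<equiv> (1 / (\<Theta> It * \<Theta>' It)) \<odot> A0 t
                     + (t * (t - 1) / ((t * \<Theta> It - 1) * (t * \<Theta>' It - 1))) \<odot> A1 t"
abbreviation ct where "ct t \<equiv> lam (q * t) / lam t * ((\<Theta> Iinf * X t - 1) / (q * \<Theta>' Iinf * X t - 1))"

text \<open>The equality with \<open>frakM\<close> turns the identity of rational functions into one
  at the point t, valid for every x. The conditions on t times \<open>\<Theta> It\<close> and
  \<open>\<Theta>' It\<close> keep h(1), a denominator in B_0, away from 0.\<close>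

definition generic :: "complex \<Rightarrow> bool" where
  "generic t \<longleftrightarrow> t \<noteq> 0 \<and> t \<noteq> 1 \<and> t * \<Theta> It \<noteq> 1 \<and> t * \<Theta>' It \<noteq> 1 \<and>
     y t \<noteq> \<Theta> I1 \<and> y t \<noteq> \<Theta>' I1 \<and> y t \<noteq> 0 \<and> y t \<noteq> 1 \<and> y t \<noteq> t \<and> lam t \<noteq> 0 \<and> X t \<noteq> 0 \<and>
     \<Theta> Iinf * X t \<noteq> 1 \<and> q * \<Theta>' Iinf * X t \<noteq> 1 \<and>
     \<Theta> Iinf * X t - (y t - t * \<Theta> It) * (y t - t * \<Theta>' It) / ((y t - \<Theta> I1) * (y t - \<Theta>' I1)) \<noteq> 0 \<and>
     P t = frakM q \<Theta> \<Theta>' (lam t) t (y t) (Z t)"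

definition painleve where
  "painleve t \<longleftrightarrow> y (q * t) = \<Theta> I1 * \<Theta>' I1 / y t
             * ((X t - t * (\<Theta> It * \<Theta>' It / \<Theta> I0)) * (X t - t * (\<Theta> It * \<Theta>' It / \<Theta>' I0))
                / ((X t - 1 / \<Theta> Iinf) * (X t - 1 / (q * \<Theta>' Iinf)))) \<and>
     Z (q * t) = 1 / ((q - 1) * y (q * t))
             * ((y (q * t) - q * t * \<Theta> It) * (y (q * t) - q * t * \<Theta>' It)
                / (q * (y (q * t) - 1) * (y (q * t) - q * t) * X t) - 1)"

lemma qn1: "q \<noteq> 1"
  using q1 by (metis power_one_right zero_less_one)

lemma p1_factor: "x\<^sup>2 - s1 * x + d1 = (x - \<Theta> I1) * (x - \<Theta>' I1)"
  "x\<^sup>2 - s t * x + d t = (x - t * \<Theta> It) * (x - t * \<Theta>' It)"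
  by (simp_all add: power2_eq_square algebra_simps)

lemma generic_ww:
  assumes "generic t"
  shows "ww t = \<Theta> Iinf * \<Theta>' Iinf * X t * ((y t)\<^sup>2 - s1 * y t + d1)"
  unfolding p1_factor using assms Th0 Th0' by (simp add: generic_def XX_def)

lemma generic_normal_form:
  assumes g: "generic t"
  shows "normal_form (\<Theta> Iinf) (\<Theta>' Iinf) (s t) (d t) s1 d1 (T t) (ll t) (y t) (ww t) (P t)"
proof -
  have "ww t \<noteq> 0" unfolding generic_ww[OF g] p1_factor using g Th0 Th0' by (simp add: generic_def)
  then have "z1 q \<Theta> \<Theta>' t (y t) (Z t) \<noteq> 0" using Th0' by (simp add: z1_def)
  moreover have "\<Theta>' Iinf * z1 q \<Theta> \<Theta>' t (y t) (Z t) = ww t" using Th0' by (simp add: z1_def)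
  ultimately show ?thesis
    using frakM_normal_form[of t "y t" "lam t" q \<Theta> \<Theta>' "Z t"] g qn1 Thi by (simp add: generic_def)
qed

text \<open>The last non-vanishing hypothesis, multiplied by p1(y), is the condition
  \<open>e1 \<noteq> 0\<close> under which the connection matrix exists.\<close>

lemma generic_last:
  assumes g: "generic t"
  shows "ww t \<noteq> \<Theta>' Iinf * ((y t)\<^sup>2 - s t * y t + d t)"
proof
  assume "ww t = \<Theta>' Iinf * ((y t)\<^sup>2 - s t * y t + d t)"
  then have "\<Theta>' Iinf * (\<Theta> Iinf * X t * ((y t - \<Theta> I1) * (y t - \<Theta>' I1))) = \<Theta>' Iinf * ((y t - t * \<Theta> It) * (y t - t * \<Theta>' It))"
    unfolding generic_ww[OF g] p1_factor by (simp only: mult_ac)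
  then have e: "\<Theta> Iinf * X t * ((y t - \<Theta> I1) * (y t - \<Theta>' I1)) = (y t - t * \<Theta> It) * (y t - t * \<Theta>' It)"
    unfolding mult_cancel_left using Th0' by blast
  have p: "(y t - \<Theta> I1) * (y t - \<Theta>' I1) \<noteq> 0" using g by (simp add: generic_def)
  have "\<Theta> Iinf * X t = (y t - t * \<Theta> It) * (y t - t * \<Theta>' It) / ((y t - \<Theta> I1) * (y t - \<Theta>' I1))"
    unfolding e[symmetric] by (rule nonzero_mult_div_cancel_right[OF p, symmetric])
  then have "\<Theta> Iinf * X t - (y t - t * \<Theta> It) * (y t - t * \<Theta>' It) / ((y t - \<Theta> I1) * (y t - \<Theta>' I1)) = 0"
    by (simp only: right_minus_eq)
  then show False using g unfolding generic_def by blast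
qed

end

section \<open>One q-step at a generic point\<close>

context parameters
begin

abbreviation yh where
  "yh t \<equiv> q * (\<Theta> Iinf * \<Theta>' Iinf * d1 * (X t)\<^sup>2 - T t * X t + d t) / (y t * (1 - \<Theta> Iinf * X t) * (1 - q * \<Theta>' Iinf * X t))"

text \<open>The relation between the exponents makes the quadratic polynomial th th' d1 X^2 - T X +
  d split: with w the product of \<open>\<Theta> It\<close> and \<open>\<Theta>' It\<close>, its
  roots are t w / \<open>\<Theta> I0\<close> and t w / \<open>\<Theta>' I0\<close>.\<close>

lemma yh_eq:
  assumes g: "generic t"
  shows "\<Theta> I1 * \<Theta>' I1 / y t
             * ((X t - t * (\<Theta> It * \<Theta>' It / \<Theta> I0)) * (X t - t * (\<Theta> It * \<Theta>' It / \<Theta>' I0))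
                / ((X t - 1 / \<Theta> Iinf) * (X t - 1 / (q * \<Theta>' Iinf)))) = yh t"
proof -
  define x m n w i j where v: "x = X t" "m = \<Theta> I0" "n = \<Theta>' I0" "w = \<Theta> It * \<Theta>' It" "i = \<Theta> Iinf" "j = \<Theta>' Iinf"
  have nz: "m \<noteq> 0" "n \<noteq> 0" "w \<noteq> 0" "i \<noteq> 0" "j \<noteq> 0" "d1 \<noteq> 0" "y t \<noteq> 0" "i * x \<noteq> 1" "q * j * x \<noteq> 1"
    using Th0 Th0' g by (simp_all add: v generic_def)
  have mn: "m * n = i * j * w * d1" using Thp by (simp add: v mult_ac)
  have canc: "w * K / (i * j * w * D) = K / (i * j * D)" for K D
    using nz(3) by simp
  have "(x - t * (w / m)) * (x - t * (w / n)) = (x * m - t * w) * (x * n - t * w) / (m * n)"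
    using nz by (simp add: field_simps)
  also have "(x * m - t * w) * (x * n - t * w) = w * (i * j * d1 * x\<^sup>2 - (t * m + t * n) * x + t * t * w)"
  proof -
    have "(x * m - t * w) * (x * n - t * w) = (m * n) * x\<^sup>2 - w * (t * m + t * n) * x + t * t * w * w"
      by (simp add: power2_eq_square algebra_simps)
    then show ?thesis unfolding mn by (simp add: power2_eq_square algebra_simps)
  qed
  finally have num: "(x - t * (w / m)) * (x - t * (w / n)) = (i * j * d1 * x\<^sup>2 - (t * m + t * n) * x + t * t * w) / (i * j * d1)"
    unfolding mn by (simp only: canc)
  have den: "(x - 1 / i) * (x - 1 / (q * j)) = (1 - i * x) * (1 - q * j * x) / (q * i * j)"
    using nz q0 by (simp add: field_simps)
  define K where "K = i * j * d1 * x\<^sup>2 - (t * m + t * n) * x + t * t * w"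
  define U V where "U = 1 - i * x" and "V = 1 - q * j * x"
  have UV: "U \<noteq> 0" "V \<noteq> 0" using nz by (simp_all add: U_def V_def)
  have "D / Y * (K / (i * j * D) / (U * V / (q * i * j))) = q * K / (Y * U * V)" if "D \<noteq> 0" "Y \<noteq> 0" for D Y
    using nz UV q0 that by (simp add: field_simps)
  from this[OF nz(6,7)] have "d1 / y t * (K / (i * j * d1) / (U * V / (q * i * j))) = q * K / (y t * U * V)" .
  then have "d1 / y t * ((x - t * (w / m)) * (x - t * (w / n)) / ((x - 1 / i) * (x - 1 / (q * j)))) = q * K / (y t * U * V)"
    unfolding num den K_def U_def V_def .
  moreover have "t * t * w = d t" by (simp add: v)
  ultimately show ?thesis by (simp add: K_def U_def V_def v)
qed

lemma ct_nz:
  assumes "generic t" "generic (q * t)"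
  shows "ct t \<noteq> 0"
  using assms by (simp add: generic_def)

text \<open>The hub of all implications. The gauge factor c is left free because (1) does not
  prescribe it; it is then forced to be \<open>ct t\<close>. Uniqueness of B and R lets a
  factorisation extracted from an arbitrary intertwiner be identified with the one given by
  B_0.\<close>

lemma generic_step:
  assumes g: "generic t" and g': "generic (q * t)"
  obtains R where
    "connection q (\<Theta> Iinf) (\<Theta>' Iinf) (s t) (d t) (P t) (B0 t) R" "det (M1 t) \<noteq> 0"
    "\<And>B R'. connection q (\<Theta> Iinf) (\<Theta>' Iinf) (s t) (d t) (P t) B R' \<Longrightarrow> B = B0 t \<and> R' = R"
    "\<And>c. c \<noteq> 0 \<Longrightarrow> P (q * t) = (\<lambda>x. gauge_by c (next_system q (\<Theta> Iinf) (\<Theta>' Iinf) (B0 t) R x)) \<longleftrightarrow>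
        c = ct t \<and> painleve t"
    "normal_form (\<Theta> Iinf) (\<Theta>' Iinf) (q * s t) (q\<^sup>2 * d t) s1 d1 (q * T t)
       (ll t * (q * \<Theta>' Iinf * X t - 1) / (\<Theta> Iinf * X t - 1)) (yh t)
       (((yh t)\<^sup>2 - q * s t * yh t + q\<^sup>2 * d t) / (q * X t)) (next_system q (\<Theta> Iinf) (\<Theta>' Iinf) (B0 t) R)"
proof -
  note N = generic_normal_form[OF g]
  have g1: "t \<noteq> 0" "t \<noteq> 1" "t * \<Theta> It \<noteq> 1" "t * \<Theta>' It \<noteq> 1" "y t \<noteq> 0" "lam t \<noteq> 0" "X t \<noteq> 0"
    "\<Theta> Iinf * X t \<noteq> 1" "q * \<Theta>' Iinf * X t \<noteq> 1"
    and p1: "(y t)\<^sup>2 - s1 * y t + d1 \<noteq> 0"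
    using g unfolding p1_factor by (simp_all add: generic_def)
  have g1': "y (q * t) \<noteq> 0" "y (q * t) \<noteq> 1" "y (q * t) \<noteq> q * t" "lam (q * t) \<noteq> 0"
    using g' by (simp_all add: generic_def)
  have ll: "ll t \<noteq> 0" "ll (q * t) \<noteq> 0" "d t \<noteq> 0" using g1 g1' qn1 Th0 Th0' by simp_all
  obtain B R where BR: "connection q (\<Theta> Iinf) (\<Theta>' Iinf) (s t) (d t) (P t) B R"
    "R $ 1 $ 2 * (1 - \<Theta> Iinf * X t) = q * ll t" "B $ 1 $ 2 = X t * R $ 1 $ 2"
    "q * y t + B $ 2 $ 2 = X t * (q * \<Theta> Iinf * y t + R $ 2 $ 2)"
    by (rule connection_exists[OF N generic_ww[OF g], of q])
      (use Th0 Th0' ll(1) g1 p1 generic_last[OF g] in auto)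
  have kk: "(t * \<Theta> It - 1) * (t * \<Theta>' It - 1) \<noteq> 0" using g1 by simp
  have d': "d t = t\<^sup>2 * \<Theta> It * \<Theta>' It" by (simp add: power2_eq_square mult_ac)
  have uB: "B' = B0 t \<and> det (M1 t) \<noteq> 0"
    if "connection q (\<Theta> Iinf) (\<Theta>' Iinf) (s t) (d t) (P t) B' R'" for B' R'
  proof -
    note c = connection_eq_BB0[OF N that refl d' q0 g1(1,2) Th0[rule_format] Th0'[rule_format] kk ll(1) generic_last[OF g]]
    have "A_inf A0 A1 At t = mat2 (\<Theta>' Iinf) 0 0 (\<Theta> Iinf)"
      unfolding A_inf_def by (rule normal_form_cleared_inf[OF N g1(1)])
    then show ?thesis using c by (simp add: BB0_def)
  qed
  have B: "B = B0 t" and M: "det (M1 t) \<noteq> 0" using uB[OF BR(1)] by auto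
  have dP: "\<And>x. det (P t x) = \<Theta> Iinf * \<Theta>' Iinf * (x\<^sup>2 - s t * x + d t) * (x\<^sup>2 - s1 * x + d1)"
    using N unfolding normal_form_def by blast
  have u: "B' = B0 t \<and> R' = R" if c: "connection q (\<Theta> Iinf) (\<Theta>' Iinf) (s t) (d t) (P t) B' R'" for B' R'
  proof -
    have "d t \<odot> R' = d t \<odot> R"
      using connection_facts(3)[OF c dP q0] connection_facts(3)[OF BR(1) dP q0] uB[OF c] B by simp
    then show ?thesis using uB[OF c] ll(3) by (simp add: vec_eq_iff)
  qed
  have NN: "normal_form (\<Theta> Iinf) (\<Theta>' Iinf) (q * s t) (q\<^sup>2 * d t) s1 d1 (q * T t)
       (ll t * (q * \<Theta>' Iinf * X t - 1) / (\<Theta> Iinf * X t - 1)) (yh t)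
       (((yh t)\<^sup>2 - q * s t * yh t + q\<^sup>2 * d t) / (q * X t)) (next_system q (\<Theta> Iinf) (\<Theta>' Iinf) (B0 t) R)"
    unfolding B[symmetric]
    by (rule next_system_normal_form[OF N BR q0 ll(3,1) g1(7,5,8,9) refl refl refl])
  have sq: "s (q * t) = q * s t" "d (q * t) = q\<^sup>2 * d t" "T (q * t) = q * T t"
    by (simp_all add: power2_eq_square algebra_simps)
  have w'0: "ww (q * t) \<noteq> 0"
    unfolding generic_ww[OF g'] p1_factor using g' Th0 Th0' by (simp add: generic_def)
  \<comment> \<open>Origin of the factor in \<CC>: gauging multiplies the upper right coefficient by
    c, and it must become that of the system at q t.\<close>
  have ceq: "ll (q * t) = c * (ll t * (q * \<Theta>' Iinf * X t - 1) / (\<Theta> Iinf * X t - 1)) \<longleftrightarrow> c = ct t" for c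
  proof -
    define a b where "a = q * \<Theta>' Iinf * X t - 1" and "b = \<Theta> Iinf * X t - 1"
    have "a \<noteq> 0" "b \<noteq> 0" using g1 by (simp_all add: a_def b_def)
    then show ?thesis
      using qn1 g1(6) unfolding a_def[symmetric] b_def[symmetric] by (auto simp: divide_simps)
  qed
  \<comment> \<open>Given y(q t), the value Z(q t) and \<open>ww (q * t)\<close> determine each
    other, because y, y - 1 and y - q t do not vanish at q t. The equation for Z is thus the one for
    w.\<close>
  have pain: "painleve t \<longleftrightarrow> y (q * t) = yh t \<and> ww (q * t) = ((yh t)\<^sup>2 - q * s t * yh t + q\<^sup>2 * d t) / (q * X t)"
  proof -
    define u where "u = y (q * t)"
    define m where "m = (q * (u - 1) * (u - q * t) * X t)"
    define k where "k = (u - q * t * \<Theta> It) * (u - q * t * \<Theta>' It)"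
    have u: "u \<noteq> 0" "u - 1 \<noteq> 0" "u - q * t \<noteq> 0" "q - 1 \<noteq> 0" using g1' qn1 by (simp_all add: u_def)
    have "m \<noteq> 0" using u q0 g1 by (simp add: m_def)
    have "Z (q * t) = 1 / ((q - 1) * u) * (k / m - 1) \<longleftrightarrow> (q - 1) * u * Z (q * t) = k / m - 1"
      using u by (auto simp: field_simps)
    also have "\<dots> \<longleftrightarrow> 1 + (q - 1) * u * Z (q * t) = k / m" by (metis add_diff_cancel_left' diff_add_cancel)
    also have "\<dots> \<longleftrightarrow> (u - 1) * (u - q * t) * (1 + (q - 1) * u * Z (q * t)) = (u - 1) * (u - q * t) * (k / m)"
      using u by (simp only: mult_cancel_left mult_eq_0_iff simp_thms)
    also have "(u - 1) * (u - q * t) * (k / m) = k / (q * X t)"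
      using u q0 g1 by (simp add: m_def divide_simps)
    finally have Z: "Z (q * t) = 1 / ((q - 1) * u) * (k / m - 1) \<longleftrightarrow> ww (q * t) = k / (q * X t)"
      by (simp only: u_def)
    have keq: "k = u\<^sup>2 - q * s t * u + q\<^sup>2 * d t"
      by (simp add: k_def power2_eq_square algebra_simps)
    show ?thesis
      unfolding painleve_def yh_eq[OF g] u_def[symmetric] k_def[symmetric] m_def[symmetric] Z unfolding keq by auto
  qed
  have key: "P (q * t) = (\<lambda>x. gauge_by c (next_system q (\<Theta> Iinf) (\<Theta>' Iinf) (B0 t) R x)) \<longleftrightarrow> c = ct t \<and> painleve t"
    if "c \<noteq> 0" for c
    unfolding gauge_next_iff[OF generic_normal_form[OF g', unfolded sq] NN Thi ll(2) g1'(1) w'0 that] ceq pain ..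
  show ?thesis by (rule that[OF BR(1)[unfolded B] M u key NN])
qed

end

text \<open>The converse computation, for building the deformation matrix: the isomonodromy relation
  with denominators cleared, using that h'(x) = det (x + B).\<close>

lemma connection_gauge_functional:
  assumes connection: "connection q th th' s d P B R" and P': "P' = (\<lambda>x. gauge_by c (next_system q th th' B R x))"
    and "q \<noteq> 0" "c \<noteq> 0"
  shows "(q * (x\<^sup>2 - s * x + d)) \<odot> (P' x ** (mat2 c 0 0 1 ** (mat x + B)))
    = (x\<^sup>2 - q * s * x + q\<^sup>2 * d) \<odot> (mat2 c 0 0 1 ** (mat (q * x) + B) ** P x)"
proof -
  define C where "C = mat2 c 0 0 1"
  define J where "J = mat2 (x + B $ 2 $ 2) (- B $ 1 $ 2) (- B $ 2 $ 1) (x + B $ 1 $ 1)"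
  define S where "S = mat2 (q * th' * x) 0 0 (q * th * x) + R"
  have "matrix_inv C ** C = mat 1"
    using \<open>c \<noteq> 0\<close> by (simp add: C_def matrix_inv_mat2 mat_eq_mat2)
  have J: "J ** (mat x + B) = mat (x\<^sup>2 - q * s * x + q\<^sup>2 * d)"
  proof -
    have "det (mat x + B) = x\<^sup>2 - q * s * x + q\<^sup>2 * d" using connection by (simp add: connection_def)
    moreover have "J = adj2 (mat x + B)" by (simp add: J_def adj2_def mat_def)
    ultimately show ?thesis by (simp add: mult_adj2)
  qed
  have "P' x ** (C ** (mat x + B)) = C ** ((1 / q) \<odot> (S ** J)) ** (matrix_inv C ** C) ** (mat x + B)"
    by (simp only: P' gauge_by_def next_system_def C_def J_def S_def matrix_mul_assoc)
  also have "\<dots> = (1 / q) \<odot> (C ** S ** (J ** (mat x + B)))"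
    unfolding \<open>matrix_inv C ** C = mat 1\<close> by (simp add: mat_smult_mult matrix_mul_assoc)
  also have "\<dots> = ((1 / q) * (x\<^sup>2 - q * s * x + q\<^sup>2 * d)) \<odot> (C ** S)"
    by (simp only: J mult_mat_eq mat_smult_mat_smult)
  finally have "(q * (x\<^sup>2 - s * x + d)) \<odot> (P' x ** (C ** (mat x + B))) =
     ((x\<^sup>2 - q * s * x + q\<^sup>2 * d) * (x\<^sup>2 - s * x + d)) \<odot> (C ** S)"
    using \<open>q \<noteq> 0\<close> by (simp add: mat_smult_mat_smult mult.commute)
  also have "\<dots> = (x\<^sup>2 - q * s * x + q\<^sup>2 * d) \<odot> (C ** ((x\<^sup>2 - s * x + d) \<odot> S))"
    by (simp only: mat_smult_mult mat_smult_mat_smult)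
  also have "(x\<^sup>2 - s * x + d) \<odot> S = (mat (q * x) + B) ** P x"
    using connection by (simp add: connection_def S_def)
  finally show ?thesis by (simp only: C_def matrix_mul_assoc)
qed

lemma fuchs_cleared:
  assumes "x \<noteq> 1" "x \<noteq> t" "t \<noteq> 0"
  shows "fuchs A0 A1 At x t = (1 / ((x - 1) * (x - t))) \<odot> cleared t (A0 t) (A1 t) (At t) x"
proof -
  have gen: "a + x / u * b + x / (t * v) * c = 1 / (u * v) * (u * v * a + x * v * b + x * u / t * c)"
    if "u \<noteq> 0" "v \<noteq> 0" for a b c u v
  proof -
    have "1 / (u * v) * (u * v * a) = a" "1 / (u * v) * (x * v * b) = x / u * b"
      "1 / (u * v) * (x * u / t * c) = x / (t * v) * c"
      using that by simp_all
    then show ?thesis by (simp only: distrib_left)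
  qed
  have "a + x / (x - 1) * b + x / (t * (x - t)) * c
     = 1 / ((x - 1) * (x - t)) * ((x - 1) * (x - t) * a + x * (x - t) * b + x * (x - 1) / t * c)" for a b c
    by (rule gen) (use assms in simp_all)
  then show ?thesis by (simp add: fuchs_def cleared_def vec_eq_iff)
qed

section \<open>Equivalence of (2) and (3) at a generic point, and resonant parameters\<close>

context parameters
begin

definition cond2_at where
  "cond2_at t \<longleftrightarrow>
     (let C = frakC q \<Theta> \<Theta>' lam y Z t; B = B0 t in
      sigma_qt q A0 t = C ** B ** A0 t ** matrix_inv B ** matrix_inv C \<and>
      sigma_qt q A1 t = ((t - 1) / (q * t - 1)
               * ((q * t * \<Theta> It - 1) * (q * t * \<Theta>' It - 1)
                  / (q * (t * \<Theta> It - 1) * (t * \<Theta>' It - 1)))) \<odot>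
             (C ** (mat q + B) ** A1 t ** matrix_inv (mat 1 + B) ** matrix_inv C) \<and>
      sigma_qt q At t = - (C ** B ** A0 t ** (mat (1 / (\<Theta> It * \<Theta>' It)) + (q * t) \<odot> matrix_inv B) ** matrix_inv C)
             - (t * (t - 1) / ((t * \<Theta> It - 1) * (t * \<Theta>' It - 1))) \<odot>
               (C ** (mat q + B) ** A1 t
                ** (mat 1 + ((q * t * \<Theta> It - 1) * (q * t * \<Theta>' It - 1) / (q * t - 1)) \<odot> matrix_inv (mat 1 + B))
                ** matrix_inv C))"

lemma cond2_at_iff:
  assumes g: "generic t" and g': "generic (q * t)"
  shows "cond2_at t \<longleftrightarrow> painleve t"
proof -
  obtain R where R: "connection q (\<Theta> Iinf) (\<Theta>' Iinf) (s t) (d t) (P t) (B0 t) R"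
    "\<And>c. c \<noteq> 0 \<Longrightarrow> P (q * t) = (\<lambda>x. gauge_by c (next_system q (\<Theta> Iinf) (\<Theta>' Iinf) (B0 t) R x)) \<longleftrightarrow>
        c = ct t \<and> painleve t"
    "normal_form (\<Theta> Iinf) (\<Theta>' Iinf) (q * s t) (q\<^sup>2 * d t) s1 d1 (q * T t)
       (ll t * (q * \<Theta>' Iinf * X t - 1) / (\<Theta> Iinf * X t - 1)) (yh t)
       (((yh t)\<^sup>2 - q * s t * yh t + q\<^sup>2 * d t) / (q * X t)) (next_system q (\<Theta> Iinf) (\<Theta>' Iinf) (B0 t) R)"
    by (rule generic_step[OF g g'], rule that)
  have C: "frakC q \<Theta> \<Theta>' lam y Z t = mat2 (ct t) 0 0 1"
    by (simp add: frakC_def sigma_qt_def)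
  have d': "d t = t\<^sup>2 * \<Theta> It * \<Theta>' It" by (simp add: power2_eq_square mult_ac)
  have nz: "t \<noteq> 0" "t \<noteq> 1" "q * t \<noteq> 1" "(t * \<Theta> It - 1) * (t * \<Theta>' It - 1) \<noteq> 0"
    "(q * t * \<Theta> It - 1) * (q * t * \<Theta>' It - 1) \<noteq> 0"
    using g g' by (simp_all add: generic_def)
  have "cond2_at t \<longleftrightarrow> P (q * t) = (\<lambda>x. gauge_by (ct t) (next_system q (\<Theta> Iinf) (\<Theta>' Iinf) (B0 t) R x))"
    unfolding cond2_at_def Let_def C sigma_qt_def
    by (rule cond2_iff[OF generic_normal_form[OF g] generic_normal_form[OF g'] R(3,1) refl d' q0 nz(1-3)
          Th0[rule_format] Th0'[rule_format] nz(4,5) ct_nz[OF g g']])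
  then show ?thesis using R(2)[OF ct_nz[OF g g']] by simp
qed

lemma nonres:
  assumes "n > 0" "u \<in> {\<Theta> i, \<Theta>' i}" "v \<in> {\<Theta> i, \<Theta>' i}"
  shows "q ^ n * u \<noteq> v"
proof
  assume e: "q ^ n * u = v"
  have "\<Theta> i \<noteq> 0" "\<Theta>' i \<noteq> 0" using Th0 Th0' by auto
  from assms(2,3) consider "u = v" | "u = \<Theta> i" "v = \<Theta>' i" | "u = \<Theta>' i" "v = \<Theta> i" by blast
  then show False
  proof cases
    case 1
    then show False using e q1 assms(1) \<open>\<Theta> i \<noteq> 0\<close> \<open>\<Theta>' i \<noteq> 0\<close> assms(2) by auto
  next
    case 2
    then have "\<Theta> i / \<Theta>' i = q powi (- int n)"
      using e \<open>\<Theta> i \<noteq> 0\<close> \<open>\<Theta>' i \<noteq> 0\<close> q0 by (simp add: power_int_minus field_simps)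
    then show False using Thr assms(1) by (metis neg_equal_0_iff_equal of_nat_0_eq_iff less_numeral_extra(3))
  next
    case 3
    then have "\<Theta> i / \<Theta>' i = q powi (int n)"
      using e \<open>\<Theta>' i \<noteq> 0\<close> by (simp add: field_simps)
    then show False using Thr assms(1) by (metis of_nat_0_eq_iff less_numeral_extra(3))
  qed
qed

text \<open>At these \<open>t\<close> the argument on the poles of an intertwiner breaks down. For \<open>|q| = 1\<close> they may
  accumulate everywhere on a circle, but they form a countable set, which suffices for the identity theorem.\<close>

definition resonant :: "complex set" where
  "resonant = {t. \<exists>n. \<exists>a\<in>{\<Theta> It, \<Theta>' It}. \<exists>b\<in>{\<Theta> I1, \<Theta>' I1}. q ^ n * (t * a) = b \<or> q ^ n * b = t * a}"

lemma countable_resonant: "countable resonant"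
proof -
  have "resonant \<subseteq> (\<Union>n. \<Union>a\<in>{\<Theta> It, \<Theta>' It}. \<Union>b\<in>{\<Theta> I1, \<Theta>' I1}. {b / (q ^ n * a), q ^ n * b / a})"
  proof
    fix t assume "t \<in> resonant"
    then obtain n a b where ab: "a \<in> {\<Theta> It, \<Theta>' It}" "b \<in> {\<Theta> I1, \<Theta>' I1}"
      and e: "q ^ n * (t * a) = b \<or> q ^ n * b = t * a"
      unfolding resonant_def by blast
    have "a \<noteq> 0" using ab(1) Th0 Th0' by auto
    with e q0 have "t \<in> {b / (q ^ n * a), q ^ n * b / a}" by auto
    with ab show "t \<in> (\<Union>n. \<Union>a\<in>{\<Theta> It, \<Theta>' It}. \<Union>b\<in>{\<Theta> I1, \<Theta>' I1}. {b / (q ^ n * a), q ^ n * b / a})"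
      by blast
  qed
  then show ?thesis by (rule countable_subset) auto
qed

lemma intertwiner_at:
  assumes g: "generic t" and g': "generic (q * t)" and t: "t \<notin> resonant"
  shows "intertwiner q (\<Theta> Iinf) (\<Theta>' Iinf) (t * \<Theta> It) (t * \<Theta>' It) (\<Theta> I1) (\<Theta>' I1) (t * \<Theta> I0) (t * \<Theta>' I0)
     (ll t) (y t) (ww t) (ll (q * t)) (y (q * t)) (ww (q * t)) (P t) (P (q * t))"
proof
  have t0: "t \<noteq> 0" using g by (simp add: generic_def)
  show "normal_form (\<Theta> Iinf) (\<Theta>' Iinf) (s t) (d t) s1 d1 (T t) (ll t) (y t) (ww t) (P t)"
    by (rule generic_normal_form[OF g])
  have sq: "s (q * t) = q * s t" "d (q * t) = q\<^sup>2 * d t" "T (q * t) = q * T t"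
    by (simp_all add: power2_eq_square algebra_simps)
  show "normal_form (\<Theta> Iinf) (\<Theta>' Iinf) (q * s t) (q\<^sup>2 * d t) s1 d1 (q * T t) (ll (q * t)) (y (q * t)) (ww (q * t)) (P (q * t))"
    using generic_normal_form[OF g'] unfolding sq .
  show "t * \<Theta> I0 * (t * \<Theta>' I0) = \<Theta> Iinf * \<Theta>' Iinf * d t * d1"
    using Thp by (simp add: mult_ac)
  have sc: "q ^ n * (t * u) \<noteq> t * v" if "n > 0" "u \<in> {\<Theta> i, \<Theta>' i}" "v \<in> {\<Theta> i, \<Theta>' i}" for n u v i
    using nonres[OF that] t0 by (simp add: mult.left_commute)
  show "q ^ n * a \<noteq> b" if n: "n > 0" and ab: "a \<in> {t * \<Theta> It, t * \<Theta>' It, \<Theta> I1, \<Theta>' I1}"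
    "b \<in> {t * \<Theta> It, t * \<Theta>' It, \<Theta> I1, \<Theta>' I1}" for n a b
  proof -
    \<comment> \<open>Within one pair of exponents the factor t cancels and non-resonance applies;
      only the mixed pairs depend on t, and they are the ones excluded by
      \<open>resonant\<close>.\<close>
    consider u v where "u \<in> {\<Theta> It, \<Theta>' It}" "v \<in> {\<Theta> It, \<Theta>' It}" "a = t * u" "b = t * v"
      | u where "u \<in> {\<Theta> It, \<Theta>' It}" "a = t * u" "b \<in> {\<Theta> I1, \<Theta>' I1}"
      | v where "v \<in> {\<Theta> It, \<Theta>' It}" "b = t * v" "a \<in> {\<Theta> I1, \<Theta>' I1}"
      | "a \<in> {\<Theta> I1, \<Theta>' I1}" "b \<in> {\<Theta> I1, \<Theta>' I1}"
      using ab by blast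
    then show ?thesis
    proof cases
      case 1
      then show ?thesis using sc[OF n] by blast
    next
      case 2
      then show ?thesis using t unfolding resonant_def by blast
    next
      case 3
      then show ?thesis using t unfolding resonant_def by blast
    next
      case 4
      then show ?thesis using nonres[OF n] by blast
    qed
  qed
  show "q ^ n * a \<noteq> b" if "n > 0" "a \<in> {t * \<Theta> I0, t * \<Theta>' I0}" "b \<in> {t * \<Theta> I0, t * \<Theta>' I0}" for n a b
    using sc[OF that(1), of _ I0] that(2,3) by blast
  show "q ^ n * a \<noteq> b" if "n > 0" "a \<in> {\<Theta> Iinf, \<Theta>' Iinf}" "b \<in> {\<Theta> Iinf, \<Theta>' Iinf}" for n a b
    using nonres[OF that] .
qed (use q0 q1 Th0 Th0' Thi g in \<open>auto simp: generic_def\<close>)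

end

definition mero_mat :: "complex set \<Rightarrow> (complex \<Rightarrow> complex^2^2) \<Rightarrow> bool" where
  "mero_mat U M \<longleftrightarrow> (\<forall>i j. (\<lambda>t. M t $ i $ j) meromorphic_on U)"

lemma mero_mat_intros:
  "mero_mat U M \<Longrightarrow> mero_mat U N \<Longrightarrow> mero_mat U (\<lambda>t. M t + N t)"
  "mero_mat U M \<Longrightarrow> mero_mat U N \<Longrightarrow> mero_mat U (\<lambda>t. M t ** N t)"
  "f meromorphic_on U \<Longrightarrow> mero_mat U M \<Longrightarrow> mero_mat U (\<lambda>t. f t \<odot> M t)"
  "mero_mat U M \<Longrightarrow> mero_mat U (\<lambda>t. adj2 (M t))"
  by (auto simp: mero_mat_def matrix_matrix_mult_def sum_2 adj2_def forall_2 intro!: meromorphic_intros)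

lemma mero_mat_det: "mero_mat U M \<Longrightarrow> (\<lambda>t. det (M t)) meromorphic_on U"
  by (auto simp: mero_mat_def det_2 intro!: meromorphic_intros)

section \<open>Isomonodromy and the q-difference equations\<close>

context parameters
begin

lemma isomonodromic_imp_painleve:
  assumes Ds: "open Ds" "connected Ds"
    and gen: "\<forall>\<^sub>\<approx>t\<in>Ds. generic t \<and> generic (q * t)"
    and iso: "q_isomonodromic q Ds (fuchs A0 A1 At)"
  shows "\<forall>\<^sub>\<approx>t\<in>Ds. t \<notin> resonant \<longrightarrow> painleve t"
proof -
  from iso obtain B where B: "GL2_mero_ratfun Ds B"
    and eq: "\<forall>\<^sub>\<approx>t\<in>Ds. MOST x. fuchs A0 A1 At x (q * t) ** B x t = B (q * x) t ** fuchs A0 A1 At x t"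
    unfolding q_isomonodromic_def ratfun_eq_def by blast
  obtain Nn Dd where poly: "\<forall>\<^sub>\<approx>t\<in>Ds. (\<forall>i j. Dd i j t \<noteq> 0 \<and>
      (MOST x. B x t $ i $ j = poly (Nn i j t) x / poly (Dd i j t) x)) \<and> \<not> (MOST x. det (B x t) = 0)"
    using GL2_mero_ratfun_polys[OF B Ds] by blast
  from gen eq poly show ?thesis
  proof eventually_elim
    case (elim t)
    then have g: "generic t" and g': "generic (q * t)"
      and eqt: "MOST x. fuchs A0 A1 At x (q * t) ** B x t = B (q * x) t ** fuchs A0 A1 At x t"
      and Dd: "\<And>i j. Dd i j t \<noteq> 0"
      and Bt: "\<And>i j. MOST x. B x t $ i $ j = poly (Nn i j t) x / poly (Dd i j t) x"
      and det: "\<not> (MOST x. det (B x t) = 0)"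
      by blast+
    have t0: "t \<noteq> 0" "q * t \<noteq> 0" using g q0 by (simp_all add: generic_def)
    show ?case
    proof
      assume "t \<notin> resonant"
      then interpret I: intertwiner q "\<Theta> Iinf" "\<Theta>' Iinf" "t * \<Theta> It" "t * \<Theta>' It" "\<Theta> I1" "\<Theta>' I1"
        "t * \<Theta> I0" "t * \<Theta>' I0" "ll t" "y t" "ww t" "ll (q * t)" "y (q * t)" "ww (q * t)" "P t" "P (q * t)"
        by (rule intertwiner_at[OF g g'])
      define DD where "DD = Dd 1 1 t * Dd 1 2 t * Dd 2 1 t * Dd 2 2 t"
      have "\<exists>E. DD = Dd i j t * E" for i j
      proof -
        have "Dd i j t dvd DD" using exhaust_2[of i] exhaust_2[of j] by (auto simp: DD_def)
        then show ?thesis by (auto elim: dvdE)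
      qed
      then obtain E where E: "\<And>i j. DD = Dd i j t * E i j" by metis
      define H where "H = [:q\<^sup>2 * d t, - q * s t, 1:]"
      have H: "poly H x = I.h' x" "poly H (q * x) = q\<^sup>2 * I.h x" for x
        by (simp_all add: H_def power2_eq_square algebra_simps)
      \<comment> \<open>F / G represents H(x) B(x, t) / (x - q t), with all entries over the common
        denominator \<open>DD\<close>. The factor x - q t accounts for the denominator of \<AA>(x, q
        t), and at q x it becomes q (x - t), which accounts for that of \<AA>(x, t).\<close>
      define F :: "complex poly^2^2" where "F = (\<chi> i j. H * Nn i j t * E i j)"
      define G where "G = [:- (q * t), 1:] * DD"
      have "DD \<noteq> 0" using Dd by (simp add: DD_def)
      have "MOST x. poly (F $ i $ j) x = poly H x * poly DD x * B x t $ i $ j" for i j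
      proof -
        have "MOST x. poly (Dd i j t) x \<noteq> 0"
          using Dd[of i j] by (simp add: eventually_cofinite poly_roots_finite)
        with Bt[of i j] show ?thesis
          by eventually_elim (simp add: F_def E[of i j])
      qed
      then have "MOST x. \<forall>i j. poly (F $ i $ j) x = poly H x * poly DD x * B x t $ i $ j"
        by (intro eventually_all_finite)
      then have evF: "MOST x. eval_mat F x = (poly H x * poly DD x) \<odot> B x t"
        by eventually_elim (simp add: vec_eq_iff)
      have evFq: "MOST x. eval_mat F (q * x) = (poly H (q * x) * poly DD (q * x)) \<odot> B (q * x) t"
        by (rule MOST_inj[OF evF]) (use q0 in \<open>simp add: inj_def\<close>)
      have "I.solves F G"
      proof (rule I.solvesI)
        show "G \<noteq> 0" using \<open>DD \<noteq> 0\<close> by (simp only: G_def mult_eq_0_iff pCons_eq_0_iff) simp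
        have nz: "MOST x. poly H x * poly DD x \<noteq> 0"
        proof -
          have "H \<noteq> 0" by (simp add: H_def)
          with \<open>DD \<noteq> 0\<close> have "H * DD \<noteq> 0" by simp
          then have "MOST x. poly (H * DD) x \<noteq> 0" by (simp add: eventually_cofinite poly_roots_finite del: poly_mult)
          then show ?thesis by simp
        qed
        show "\<not> (MOST x. det (eval_mat F x) = 0)"
        proof
          assume "MOST x. det (eval_mat F x) = 0"
          with evF nz have "MOST x. det (B x t) = 0"
          proof eventually_elim
            case (elim x)
            have "(poly H x * poly DD x)\<^sup>2 * det (B x t) = det (eval_mat F x)"
              unfolding elim(1) by (simp add: det_2 power2_eq_square algebra_simps)
            then show ?case using elim(2,3) by simp
          qed
          with det show False ..
        qed
        have ne: "MOST x. x \<noteq> 1" "MOST x. x \<noteq> t" "MOST x. x \<noteq> q * t" by simp_all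
        show "MOST x. (q * I.h x * poly G (q * x)) \<odot> (P (q * t) x ** eval_mat F x)
           = (I.h' x * poly G x) \<odot> (eval_mat F (q * x) ** P t x)"
          using eqt evF evFq ne
        proof eventually_elim
          case (elim x)
          have e: "(1 / ((x - 1) * (x - q * t))) \<odot> (P (q * t) x ** B x t) = (1 / ((x - 1) * (x - t))) \<odot> (B (q * x) t ** P t x)"
            using elim(1) unfolding fuchs_cleared[OF elim(4,6) t0(2)] fuchs_cleared[OF elim(4,5) t0(1)] mat_smult_mult .
          have *: "(x - t) * (P (q * t) x ** B x t) $ i $ j = (x - q * t) * (B (q * x) t ** P t x) $ i $ j" for i j
          proof -
            define b c where "b = (P (q * t) x ** B x t) $ i $ j" and "c = (B (q * x) t ** P t x) $ i $ j"
            define u v w where "u = x - 1" and "v = x - t" and "w = x - q * t"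
            have nz: "u \<noteq> 0" "v \<noteq> 0" "w \<noteq> 0" using elim(4-6) by (simp_all add: u_def v_def w_def)
            have "1 / (u * w) * b = 1 / (u * v) * c"
              using arg_cong[OF e, of "\<lambda>M. M $ i $ j"] by (simp add: b_def c_def u_def v_def w_def)
            then have "v * b = w * c" using nz by (simp add: frac_eq_eq mult_ac)
            then show ?thesis by (simp only: b_def c_def v_def w_def)
          qed
          have "q * I.h x * poly G (q * x) * (poly H x * poly DD x * (P (q * t) x ** B x t) $ i $ j)
            = I.h' x * poly G x * (poly H (q * x) * poly DD (q * x) * (B (q * x) t ** P t x) $ i $ j)" for i j
          proof -
            define b c where "b = (P (q * t) x ** B x t) $ i $ j" and "c = (B (q * x) t ** P t x) $ i $ j"
            define k where "k = q\<^sup>2 * I.h x * I.h' x * poly DD x * poly DD (q * x)"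
            have "q * I.h x * poly G (q * x) * (poly H x * poly DD x * b) = k * ((x - t) * b)"
              unfolding H G_def k_def by (simp add: power2_eq_square ring_distribs mult_ac)
            also have "\<dots> = k * ((x - q * t) * c)" using *[of i j] by (simp add: b_def c_def)
            also have "\<dots> = I.h' x * poly G x * (poly H (q * x) * poly DD (q * x) * c)"
              unfolding H G_def k_def by (simp add: power2_eq_square ring_distribs mult_ac)
            finally show ?thesis by (simp only: b_def c_def)
          qed
          then show ?case unfolding elim(2,3) mat_smult_mult by (simp only: vec_eq_iff mat_smult_nth) blast
        qed
      qed
      from I.solves_gauge[OF this] obtain c B' R' where c: "c \<noteq> 0"
        and connection: "connection q (\<Theta> Iinf) (\<Theta>' Iinf) (s t) (d t) (P t) B' R'"
        and P': "P (q * t) = (\<lambda>x. gauge_by c (next_system q (\<Theta> Iinf) (\<Theta>' Iinf) B' R' x))"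
        by blast
      obtain R where R: "\<And>B R'. connection q (\<Theta> Iinf) (\<Theta>' Iinf) (s t) (d t) (P t) B R' \<Longrightarrow> B = B0 t \<and> R' = R"
        "\<And>c. c \<noteq> 0 \<Longrightarrow> P (q * t) = (\<lambda>x. gauge_by c (next_system q (\<Theta> Iinf) (\<Theta>' Iinf) (B0 t) R x)) \<longleftrightarrow>
        c = ct t \<and> painleve t"
        by (rule generic_step[OF g g'], rule that)
      show "painleve t" using R(2)[OF c] R(1)[OF connection] P' by blast
    qed
  qed
qed

lemma painleve_imp_isomonodromic:
  assumes Ds: "open Ds" "Ds \<noteq> {}" "q_stable q Ds"
    and mero: "lam meromorphic_on Ds" "y meromorphic_on Ds" "Z meromorphic_on Ds"
      "mero_mat Ds A0" "mero_mat Ds A1" "mero_mat Ds At"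
    and gen: "\<forall>\<^sub>\<approx>t\<in>Ds. generic t \<and> generic (q * t)"
    and pain: "\<forall>\<^sub>\<approx>t\<in>Ds. painleve t"
  shows "q_isomonodromic q Ds (fuchs A0 A1 At)"
proof -
  define K where "K t = (t - 1) / ((t * \<Theta> It - 1) * (t * \<Theta>' It - 1))" for t
  \<comment> \<open>The adjugate over the determinant is entrywise meromorphic by inspection. It
    replaces \<open>matrix_inv\<close>, whose value at a singular matrix is unspecified; the two
    agree at generic points.\<close>
  define BB where "BB t = (- (q * t)) \<odot> ((A_inf A0 A1 At t + K t \<odot> A1 t) ** ((1 / det (M1 t)) \<odot> adj2 (M1 t)))" for t
  define c where "c i t = (if i = (1 :: 2) then ct t else 1)" for i t
  define h' where "h' t x = x\<^sup>2 - q * s t * x + q\<^sup>2 * d t" for t x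
  \<comment> \<open>The factor x - q t cancels the pole of \<AA>(x, q t); after x -> q x it is q (x
    - t) and cancels that of \<AA>(x, t).\<close>
  define B where "B x t = ((x - q * t) / h' t x) \<odot> (mat2 (ct t) 0 0 1 ** (mat x + BB t))" for x t
  have m1: "mero_mat Ds M1"
    by (intro mero_mat_intros mero meromorphic_intros)
  have "mero_mat Ds BB"
    unfolding BB_def A_inf_def K_def by (intro mero_mat_intros mero_mat_det m1 mero meromorphic_intros)
  then have mBB: "(\<lambda>t. BB t $ i $ j) meromorphic_on Ds" for i j by (simp add: mero_mat_def)
  have mX: "X meromorphic_on Ds"
    unfolding XX_def by (intro meromorphic_intros mero)
  have "ct meromorphic_on Ds"
    by (intro meromorphic_intros mX mero meromorphic_on_shift[OF mero(1) Ds(3)])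
  then have mc: "c i meromorphic_on Ds" for i
    by (cases "i = 1") (simp_all add: c_def [abs_def] meromorphic_on_const)
  have entry: "B x t $ i $ j = ((if i = j then c i t else 0) * x\<^sup>2
       + (c i t * BB t $ i $ j - q * t * (if i = j then c i t else 0)) * x + (- (q * t * (c i t * BB t $ i $ j))))
     / (x\<^sup>2 + (- (q * s t)) * x + q\<^sup>2 * d t)" for x t i j
  proof -
    have "(mat2 (ct t) 0 0 1 ** (mat x + BB t)) $ i $ j = c i t * ((if i = j then x else 0) + BB t $ i $ j)"
      using exhaust_2[of i] exhaust_2[of j]
      by (auto simp: matrix_matrix_mult_def sum_2 mat_def c_def)
    then show ?thesis
      by (simp add: B_def h'_def) (simp add: power2_eq_square algebra_simps)
  qed
  have rat: "mero_ratfun Ds (\<lambda>x t. B x t $ i $ j)" for i j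
  proof (rule mero_ratfun_quadI[where ?a0.0 = "\<lambda>t. - (q * t * (c i t * BB t $ i $ j))"
        and ?a1.0 = "\<lambda>t. c i t * BB t $ i $ j - q * t * (if i = j then c i t else 0)"
        and ?a2.0 = "\<lambda>t. if i = j then c i t else 0"
        and ?b0.0 = "\<lambda>t. q\<^sup>2 * d t" and ?b1.0 = "\<lambda>t. - (q * s t)", OF _ _ _ _ _ Ds(1,2) entry])
    have 1: "(\<lambda>t. if i = j then c i t else 0) meromorphic_on Ds"
      using mc by (cases "i = j") (auto simp: meromorphic_on_const)
    show "(\<lambda>t. if i = j then c i t else 0) meromorphic_on Ds"
      "(\<lambda>t. - (q * t * (c i t * BB t $ i $ j))) meromorphic_on Ds"
      "(\<lambda>t. c i t * BB t $ i $ j - q * t * (if i = j then c i t else 0)) meromorphic_on Ds"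
      "(\<lambda>t. q\<^sup>2 * d t) meromorphic_on Ds" "(\<lambda>t. - (q * s t)) meromorphic_on Ds"
      by (intro meromorphic_intros mc mBB 1)+
  qed
  have main: "\<forall>\<^sub>\<approx>t\<in>Ds. \<not> (MOST x. det (B x t) = 0) \<and>
     (MOST x. fuchs A0 A1 At x (q * t) ** B x t = B (q * x) t ** fuchs A0 A1 At x t)"
    using gen pain
  proof eventually_elim
    case (elim t)
    then have g: "generic t" and g': "generic (q * t)" and p: "painleve t" by auto
    have t0: "t \<noteq> 0" "q * t \<noteq> 0" using g q0 by (simp_all add: generic_def)
    obtain R where R: "connection q (\<Theta> Iinf) (\<Theta>' Iinf) (s t) (d t) (P t) (B0 t) R" "det (M1 t) \<noteq> 0"
      "\<And>c. c \<noteq> 0 \<Longrightarrow> P (q * t) = (\<lambda>x. gauge_by c (next_system q (\<Theta> Iinf) (\<Theta>' Iinf) (B0 t) R x)) \<longleftrightarrow>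
        c = ct t \<and> painleve t"
      by (rule generic_step[OF g g'], rule that)
    have ct: "ct t \<noteq> 0" by (rule ct_nz[OF g g'])
    have "matrix_inv (M1 t) = (1 / det (M1 t)) \<odot> adj2 (M1 t)"
      by (rule matrix_inv_eqI) (use R(2) in \<open>simp add: mat_smult_mult mult_adj2 vec_eq_iff mat_def\<close>)
    then have BB: "BB t = B0 t" by (simp add: BB_def BB0_def K_def)
    define C where "C = mat2 (ct t) 0 0 1"
    have "P (q * t) = (\<lambda>x. gauge_by (ct t) (next_system q (\<Theta> Iinf) (\<Theta>' Iinf) (B0 t) R x))"
      using R(3)[OF ct] p by blast
    note fe = connection_gauge_functional[OF R(1) this q0 ct, folded C_def]
    have detB: "det (mat x + BB t) = h' t x" for x
      using R(1) by (simp add: connection_def BB h'_def)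
    have nh: "MOST x. h' t x \<noteq> 0"
      unfolding h'_def by (rule MOST_quad_nz)
    have ne: "MOST x. x \<noteq> 1" "MOST x. x \<noteq> t" "MOST x. x \<noteq> q * t" by simp_all
    have "MOST x. det (B x t) \<noteq> 0"
      using nh ne(3)
    proof eventually_elim
      case (elim x)
      have "det (B x t) = ((x - q * t) / h' t x)\<^sup>2 * (ct t * h' t x)"
      proof -
        have "det (k \<odot> M) = k\<^sup>2 * det M" for k and M :: "complex^2^2"
          by (simp add: det_2 power2_eq_square algebra_simps)
        moreover have "det (mat2 (ct t) 0 0 1 ** (mat x + BB t)) = ct t * h' t x"
          unfolding det_mul detB by (simp only: det_mat2) simp
        ultimately show ?thesis by (simp only: B_def)
      qed
      then show ?case using elim ct by simp
    qed
    moreover have "MOST x. fuchs A0 A1 At x (q * t) ** B x t = B (q * x) t ** fuchs A0 A1 At x t"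
      using nh MOST_quad_nz[of "s t" "d t"] ne
    proof eventually_elim
      case (elim x)
      define a where "a = (x\<^sup>2 - s t * x + d t)"
      have h'q: "h' t (q * x) = q\<^sup>2 * a" by (simp add: h'_def a_def power2_eq_square algebra_simps)
      have e: "(q * a) * (P (q * t) x ** (C ** (mat x + BB t))) $ i $ j
          = h' t x * (C ** (mat (q * x) + BB t) ** P t x) $ i $ j" for i j
        using arg_cong[OF fe[of x], of "\<lambda>M. M $ i $ j"] by (simp add: BB a_def h'_def)
      have "(1 / ((x - 1) * (x - q * t))) * ((x - q * t) / h' t x) * (P (q * t) x ** (C ** (mat x + BB t))) $ i $ j
        = ((q * x - q * t) / h' t (q * x)) * (1 / ((x - 1) * (x - t))) * (C ** (mat (q * x) + BB t) ** P t x) $ i $ j" for i j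
      proof -
        define b r where "b = (P (q * t) x ** (C ** (mat x + BB t))) $ i $ j"
          and "r = (C ** (mat (q * x) + BB t) ** P t x) $ i $ j"
        define u v w h where "u = x - 1" and "v = x - t" and "w = x - q * t" and "h = h' t x"
        have nz: "u \<noteq> 0" "v \<noteq> 0" "w \<noteq> 0" "h \<noteq> 0" "a \<noteq> 0"
          using elim by (simp_all add: u_def v_def w_def h_def a_def)
        have br: "q * a * b = h * r" using e[of i j] by (simp only: b_def r_def h_def)
        have "1 / (u * w) * (w / h) * b = b / (u * h)" using nz by simp
        also have "\<dots> = r / (q * a * u)" using br nz q0 by (simp add: frac_eq_eq mult_ac)
        also have "\<dots> = q * v / (q\<^sup>2 * a) * (1 / (u * v)) * r"
          using nz q0 by (simp add: power2_eq_square)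
        finally show ?thesis
          unfolding h'q by (simp only: b_def r_def u_def v_def w_def h_def right_diff_distrib)
      qed
      then have "(1 / ((x - 1) * (x - q * t)) * ((x - q * t) / h' t x)) \<odot> (P (q * t) x ** (C ** (mat x + BB t)))
        = (((q * x - q * t) / h' t (q * x)) * (1 / ((x - 1) * (x - t)))) \<odot> (C ** (mat (q * x) + BB t) ** P t x)"
        by (simp only: vec_eq_iff mat_smult_nth) blast
      then show ?case
        unfolding fuchs_cleared[OF elim(3,5) t0(2)] fuchs_cleared[OF elim(3,4) t0(1)] B_def C_def[symmetric]
          mat_smult_mult mat_smult_mat_smult by (simp only: mult.commute)
    qed
    moreover have "\<not> (MOST x. det (B x t) = 0)"
    proof
      assume "MOST x. det (B x t) = 0"
      with \<open>MOST x. det (B x t) \<noteq> 0\<close> have "MOST x :: complex. False" by eventually_elim simp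
      then show False by (simp add: infinite_UNIV_char_0)
    qed
    ultimately show ?case by blast
  qed
  have "\<not> ratfun_eq Ds (\<lambda>x t. det (B x t)) (\<lambda>_ _. 0)"
  proof
    assume "ratfun_eq Ds (\<lambda>x t. det (B x t)) (\<lambda>_ _. 0)"
    with main have "\<forall>\<^sub>\<approx>t\<in>Ds. t \<in> {}"
      unfolding ratfun_eq_def by eventually_elim simp
    then show False using not_cosparse_countable[OF Ds(1,2), of "{}"] by blast
  qed
  moreover have "ratfun_eq Ds (\<lambda>x t. fuchs A0 A1 At x (q * t) ** B x t) (\<lambda>x t. B (q * x) t ** fuchs A0 A1 At x t)"
    unfolding ratfun_eq_def using main by eventually_elim blast
  ultimately show ?thesis
    unfolding q_isomonodromic_def GL2_mero_ratfun_def using rat by blast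
qed

end

section \<open>Almost all parameters are generic, and the global statement\<close>

context parameters
begin

lemma XX_meromorphic:
  assumes "y meromorphic_on D" "Z meromorphic_on D"
  shows "X meromorphic_on D"
  unfolding XX_def by (intro meromorphic_intros assms)

lemma cosparse_generic:
  assumes D: "open D" "connected D"
    and mero: "lam meromorphic_on D" "y meromorphic_on D" "Z meromorphic_on D"
    and "\<not> mero_eq D (\<lambda>t. y t - \<Theta> I1) (\<lambda>_. 0)"
    and "\<not> mero_eq D (\<lambda>t. y t - \<Theta>' I1) (\<lambda>_. 0)"
    and "\<not> mero_eq D y (\<lambda>_. 0)"
    and "\<not> mero_eq D (\<lambda>t. y t - 1) (\<lambda>_. 0)"
    and "\<not> mero_eq D (\<lambda>t. y t - t) (\<lambda>_. 0)"
    and "\<not> mero_eq D lam (\<lambda>_. 0)"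
    and "\<not> mero_eq D X (\<lambda>_. 0)"
    and "\<not> mero_eq D (\<lambda>t. \<Theta> Iinf * X t - 1) (\<lambda>_. 0)"
    and "\<not> mero_eq D (\<lambda>t. q * \<Theta>' Iinf * X t - 1) (\<lambda>_. 0)"
    and "\<not> mero_eq D (\<lambda>t. \<Theta> Iinf * X t
            - (y t - t * \<Theta> It) * (y t - t * \<Theta>' It) / ((y t - \<Theta> I1) * (y t - \<Theta>' I1))) (\<lambda>_. 0)"
    and rat: "ratfun_eq D (frakA q \<Theta> \<Theta>' lam y Z) (fuchs A0 A1 At)"
  shows "\<forall>\<^sub>\<approx>t\<in>D. generic t"
proof -
  note mX = XX_meromorphic[OF mero(2,3)]
  note nz = assms(6-15)[THEN cosparse_neq_0[OF _ D, rotated]]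
  have "\<forall>\<^sub>\<approx>t\<in>D. y t - \<Theta> I1 \<noteq> 0" "\<forall>\<^sub>\<approx>t\<in>D. y t - \<Theta>' I1 \<noteq> 0" "\<forall>\<^sub>\<approx>t\<in>D. y t \<noteq> 0"
    "\<forall>\<^sub>\<approx>t\<in>D. y t - 1 \<noteq> 0" "\<forall>\<^sub>\<approx>t\<in>D. y t - t \<noteq> 0" "\<forall>\<^sub>\<approx>t\<in>D. lam t \<noteq> 0" "\<forall>\<^sub>\<approx>t\<in>D. X t \<noteq> 0"
    "\<forall>\<^sub>\<approx>t\<in>D. \<Theta> Iinf * X t - 1 \<noteq> 0" "\<forall>\<^sub>\<approx>t\<in>D. q * \<Theta>' Iinf * X t - 1 \<noteq> 0"
    "\<forall>\<^sub>\<approx>t\<in>D. \<Theta> Iinf * X t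
            - (y t - t * \<Theta> It) * (y t - t * \<Theta>' It) / ((y t - \<Theta> I1) * (y t - \<Theta>' I1)) \<noteq> 0"
    by (intro nz meromorphic_intros mero mX)+
  moreover have "\<forall>\<^sub>\<approx>t\<in>D. t \<noteq> 0" "\<forall>\<^sub>\<approx>t\<in>D. t \<noteq> 1" "\<forall>\<^sub>\<approx>t\<in>D. t \<noteq> 1 / \<Theta> It" "\<forall>\<^sub>\<approx>t\<in>D. t \<noteq> 1 / \<Theta>' It"
    by (rule cosparse_neq_const[OF D(1)])+
  moreover note rat[unfolded ratfun_eq_def]
  ultimately show ?thesis
  proof eventually_elim
    case (elim t)
    define M where "M = frakM q \<Theta> \<Theta>' (lam t) t (y t) (Z t)"
    have ne: "MOST x. x \<noteq> 1" "MOST x. x \<noteq> t" by simp_all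
    \<comment> \<open>The hypothesis compares the two matrices only off finitely many x; both are
      continuous in x, so they agree everywhere.\<close>
    have "MOST x. P t x = M x"
      using elim(15) ne
    proof eventually_elim
      case (elim x)
      have "(1 / ((x - 1) * (x - t))) \<odot> P t x = (1 / ((x - 1) * (x - t))) \<odot> M x"
        using elim(1) unfolding fuchs_cleared[OF elim(2,3) \<open>t \<noteq> 0\<close>] by (simp add: frakA_def M_def frakM_def)
      then show ?case using elim(2,3) by (simp add: vec_eq_iff)
    qed
    moreover have "cont_mat (P t)"
      unfolding cleared_def cont_mat_def using \<open>t \<noteq> 0\<close> by (auto intro!: continuous_intros)
    moreover have "cont_mat M"
      unfolding M_def frakM_def [abs_def] using \<open>lam t \<noteq> 0\<close> qn1
      by (auto intro!: cont_mat_mat2 continuous_intros)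
    ultimately have "P t = M" using MOST_cont_mat_eq by blast
    then show ?case
      using elim Th0 Th0' unfolding generic_def M_def by (auto simp: field_simps)
  qed
qed

end

theorem proposition2p10:
  fixes q :: complex
    and \<Theta> \<Theta>' :: "idx \<Rightarrow> complex"
    and D Ds :: "complex set"
    and lam y Z :: "complex \<Rightarrow> complex"
    and A0 A1 At :: "complex \<Rightarrow> complex^2^2"
  defines "X \<equiv> XX q \<Theta> \<Theta>' y Z"
    and "B0 \<equiv> BB0 q \<Theta> \<Theta>' A0 A1 At"
    and "C \<equiv> frakC q \<Theta> \<Theta>' lam y Z"
  assumes "q \<noteq> 0" and "\<forall>n::nat. n > 0 \<longrightarrow> q ^ n \<noteq> 1"
    and "\<forall>i. \<Theta> i \<noteq> 0" and "\<forall>i. \<Theta>' i \<noteq> 0"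
    and "\<Theta> Iinf \<noteq> \<Theta>' Iinf"
    and "\<Theta> I0 * \<Theta>' I0 = \<Theta> Iinf * \<Theta>' Iinf * \<Theta> It * \<Theta>' It * \<Theta> I1 * \<Theta>' I1"
    and "\<forall>i. \<forall>k::int. k \<noteq> 0 \<longrightarrow> \<Theta> i / \<Theta>' i \<noteq> q powi k"
    and "open D" and "connected D" and "D \<noteq> {}" and "0 \<notin> D" and "q_stable q D"
    and "lam meromorphic_on D" and "y meromorphic_on D" and "Z meromorphic_on D"
    and "\<not> mero_eq D (\<lambda>t. y t - \<Theta> I1) (\<lambda>_. 0)"
    and "\<not> mero_eq D (\<lambda>t. y t - \<Theta>' I1) (\<lambda>_. 0)"
    and "\<not> mero_eq D y (\<lambda>_. 0)"
    and "\<not> mero_eq D (\<lambda>t. y t - 1) (\<lambda>_. 0)"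
    and "\<not> mero_eq D (\<lambda>t. y t - t) (\<lambda>_. 0)"
    and "\<not> mero_eq D lam (\<lambda>_. 0)"
    and "\<not> mero_eq D X (\<lambda>_. 0)"
    and "\<not> mero_eq D (\<lambda>t. \<Theta> Iinf * X t - 1) (\<lambda>_. 0)"
    and "\<not> mero_eq D (\<lambda>t. q * \<Theta>' Iinf * X t - 1) (\<lambda>_. 0)"
    and "\<not> mero_eq D (\<lambda>t. \<Theta> Iinf * X t
            - (y t - t * \<Theta> It) * (y t - t * \<Theta>' It) / ((y t - \<Theta> I1) * (y t - \<Theta>' I1))) (\<lambda>_. 0)"
    and "\<forall>i j. (\<lambda>t. A0 t $ i $ j) meromorphic_on D \<and> (\<lambda>t. A1 t $ i $ j) meromorphic_on D
              \<and> (\<lambda>t. At t $ i $ j) meromorphic_on D"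
    and "ratfun_eq D (frakA q \<Theta> \<Theta>' lam y Z) (fuchs A0 A1 At)"
    and "open Ds" and "connected Ds" and "Ds \<noteq> {}" and "Ds \<subseteq> D" and "q_stable q Ds"
    and "\<forall>i j. (\<lambda>t. A0 t $ i $ j) holomorphic_on Ds \<and> (\<lambda>t. A1 t $ i $ j) holomorphic_on Ds
              \<and> (\<lambda>t. At t $ i $ j) holomorphic_on Ds"
  defines "cond1 \<equiv> q_isomonodromic q Ds (fuchs A0 A1 At)"
    and "cond2 \<equiv>
      mero_eq Ds (sigma_qt q A0)
        (\<lambda>t. C t ** B0 t ** A0 t ** matrix_inv (B0 t) ** matrix_inv (C t)) \<and>
      mero_eq Ds (sigma_qt q A1)
        (\<lambda>t. ((t - 1) / (q * t - 1)
               * ((q * t * \<Theta> It - 1) * (q * t * \<Theta>' It - 1)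
                  / (q * (t * \<Theta> It - 1) * (t * \<Theta>' It - 1)))) \<odot>
             (C t ** (mat q + B0 t) ** A1 t ** matrix_inv (mat 1 + B0 t) ** matrix_inv (C t))) \<and>
      mero_eq Ds (sigma_qt q At)
        (\<lambda>t. - (C t ** B0 t ** A0 t
                ** (mat (1 / (\<Theta> It * \<Theta>' It)) + (q * t) \<odot> matrix_inv (B0 t))
                ** matrix_inv (C t))
             - (t * (t - 1) / ((t * \<Theta> It - 1) * (t * \<Theta>' It - 1))) \<odot>
               (C t ** (mat q + B0 t) ** A1 t
                ** (mat 1 + ((q * t * \<Theta> It - 1) * (q * t * \<Theta>' It - 1) / (q * t - 1)) \<odot>
                            matrix_inv (mat 1 + B0 t))
                ** matrix_inv (C t)))"
    and "cond3 \<equiv>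
      mero_eq D (sigma_qt q y)
        (\<lambda>t. \<Theta> I1 * \<Theta>' I1 / y t
             * ((X t - t * (\<Theta> It * \<Theta>' It / \<Theta> I0)) * (X t - t * (\<Theta> It * \<Theta>' It / \<Theta>' I0))
                / ((X t - 1 / \<Theta> Iinf) * (X t - 1 / (q * \<Theta>' Iinf))))) \<and>
      mero_eq D (sigma_qt q Z)
        (\<lambda>t. 1 / ((q - 1) * sigma_qt q y t)
             * ((sigma_qt q y t - q * t * \<Theta> It) * (sigma_qt q y t - q * t * \<Theta>' It)
                / (q * (sigma_qt q y t - 1) * (sigma_qt q y t - q * t) * X t) - 1))"
  shows "(cond1 \<longleftrightarrow> cond2) \<and> (cond2 \<longleftrightarrow> cond3)"
proof -
  interpret parameters q \<Theta> \<Theta>' lam y Z A0 A1 At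
    by standard (use assms in auto)
  have q0: "q \<noteq> 0" and D: "open D" "connected D" "D \<noteq> {}" "q_stable q D"
    and Ds: "open Ds" "connected Ds" "Ds \<noteq> {}" "Ds \<subseteq> D" "q_stable q Ds"
    and mero: "lam meromorphic_on D" "y meromorphic_on D" "Z meromorphic_on D"
    and mA: "\<forall>i j. (\<lambda>t. A0 t $ i $ j) meromorphic_on D \<and> (\<lambda>t. A1 t $ i $ j) meromorphic_on D
              \<and> (\<lambda>t. At t $ i $ j) meromorphic_on D"
    by fact+
  have gD: "\<forall>\<^sub>\<approx>t\<in>D. generic t"
    by (rule cosparse_generic[OF D(1,2) mero]; fact assms[unfolded X_def])
  then have gen: "\<forall>\<^sub>\<approx>t\<in>D. generic t \<and> generic (q * t)"
    using cosparse_shift[OF D(1) q0 D(4)] by (simp add: eventually_conj)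
  note gens = cosparse_subset[OF this Ds(4)]
  define Ry where "Ry = (\<lambda>t. \<Theta> I1 * \<Theta>' I1 / y t
             * ((X t - t * (\<Theta> It * \<Theta>' It / \<Theta> I0)) * (X t - t * (\<Theta> It * \<Theta>' It / \<Theta>' I0))
                / ((X t - 1 / \<Theta> Iinf) * (X t - 1 / (q * \<Theta>' Iinf)))))"
  define RZ where "RZ = (\<lambda>t. 1 / ((q - 1) * sigma_qt q y t)
             * ((sigma_qt q y t - q * t * \<Theta> It) * (sigma_qt q y t - q * t * \<Theta>' It)
                / (q * (sigma_qt q y t - 1) * (sigma_qt q y t - q * t) * X t) - 1))"
  have pain: "painleve t \<longleftrightarrow> sigma_qt q y t = Ry t \<and> sigma_qt q Z t = RZ t" for t
    by (simp only: painleve_def Ry_def RZ_def sigma_qt_def X_def)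
  have mX: "X meromorphic_on D" unfolding X_def by (rule XX_meromorphic[OF mero(2,3)])
  have my: "sigma_qt q y meromorphic_on D" and mZ: "sigma_qt q Z meromorphic_on D"
    unfolding sigma_qt_def by (intro meromorphic_on_shift mero D(4))+
  have mR: "Ry meromorphic_on D" "RZ meromorphic_on D"
    unfolding Ry_def RZ_def by (intro meromorphic_intros mero mX my)+
  have c3: "cond3 \<longleftrightarrow> mero_eq D (sigma_qt q y) Ry \<and> mero_eq D (sigma_qt q Z) RZ"
    unfolding cond3_def Ry_def RZ_def ..
  have c2: "cond2 \<longleftrightarrow> (\<forall>\<^sub>\<approx>t\<in>Ds. cond2_at t)"
    unfolding cond2_def mero_eq_def cond2_at_def Let_def eventually_conj_iff B0_def C_def ..
  have "(\<forall>\<^sub>\<approx>t\<in>Ds. cond2_at t) \<longleftrightarrow> (\<forall>\<^sub>\<approx>t\<in>Ds. painleve t)"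
    by (rule eventually_cong[OF gens]) (use cond2_at_iff in blast)
  with c2 have c2p: "cond2 \<longleftrightarrow> (\<forall>\<^sub>\<approx>t\<in>Ds. painleve t)" by simp
  have c32: "\<forall>\<^sub>\<approx>t\<in>Ds. painleve t" if cond3
  proof -
    have "\<forall>\<^sub>\<approx>t\<in>D. painleve t"
      using that unfolding c3 mero_eq_def pain by (simp add: eventually_conj)
    then show ?thesis by (rule cosparse_subset[OF _ Ds(4)])
  qed
  \<comment> \<open>Two extensions: the countable set of resonant parameters is removed inside
    \<open>Ds\<close>, and the equations then spread from the open subset \<open>Ds\<close> to
    \<open>D\<close>, since (3) is a statement on \<open>D\<close> whereas (1) and (2) live on
    \<open>Ds\<close>.\<close>
  have c23: cond3 if "\<forall>\<^sub>\<approx>t\<in>Ds. t \<notin> resonant \<longrightarrow> painleve t"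
  proof -
    have sub: "f meromorphic_on Ds" if "f meromorphic_on D" for f
      using that Ds(4) by (rule meromorphic_on_subset)
    have "\<forall>\<^sub>\<approx>t\<in>Ds. t \<notin> resonant \<longrightarrow> sigma_qt q y t = Ry t" "\<forall>\<^sub>\<approx>t\<in>Ds. t \<notin> resonant \<longrightarrow> sigma_qt q Z t = RZ t"
      using that unfolding pain by (auto elim: eventually_mono)
    then have "mero_eq Ds (sigma_qt q y) Ry" "mero_eq Ds (sigma_qt q Z) RZ"
      by (auto intro: mero_eq_off_countable[OF sub sub Ds(1-3) countable_resonant] my mZ mR)
    then show ?thesis
      unfolding c3 by (auto intro: mero_eq_extend[OF _ _ D(1,2) Ds(1,3,4)] my mZ mR)
  qed
  have c12: cond3 if cond1
    using isomonodromic_imp_painleve[OF Ds(1,2) gens] that c23 unfolding cond1_def by blast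
  have "lam meromorphic_on Ds" "y meromorphic_on Ds" "Z meromorphic_on Ds"
    using mero Ds(4) by (auto intro: meromorphic_on_subset)
  moreover have "mero_mat Ds A0" "mero_mat Ds A1" "mero_mat Ds At"
    using mA Ds(4) by (auto simp: mero_mat_def intro: meromorphic_on_subset)
  ultimately have c21: cond1 if "\<forall>\<^sub>\<approx>t\<in>Ds. painleve t"
    unfolding cond1_def by (intro painleve_imp_isomonodromic Ds gens that)
  have "\<forall>\<^sub>\<approx>t\<in>Ds. t \<notin> resonant \<longrightarrow> painleve t" if "\<forall>\<^sub>\<approx>t\<in>Ds. painleve t"
    using that by eventually_elim blast
  then show ?thesis using c2p c32 c23 c12 c21 by blast
qed

end
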